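(* Fix any field $\mathbb{K}$. For every finite simple graph $H$ the limit $c_H=\lim_{n\to\infty}\sqrt[n]{b_H(n)}$ exists. Moreover: (i) If $H$ is not an induced subgraph of the infinite complete multipartite graph $K_{5,5,\dots}$ (infinitely many parts, each of size $5$), then $c_H=4^{1/5}$. (ii) For every $i\in\{1,\dots,5\}$ there is a value $c'_i$ such that whenever $H=K_{i_1,\dots,i_m}$ is a complete multipartite graph with $5\ge i_1\ge\cdots\ge i_m\ge 1$ (for $m=1$ this is the edgeless graph $I_{i_1}$ on $i_1$ vertices), we have $c_H=c'_{i_1}$. Moreover $c'_5=3^{1/4}$, $c'_4=2^{1/3}$, $c'_3\in[8^{1/14},\Gamma_4]$, and $c'_2=c'_1=1$.
   Context: For a graph $G$, $\mathrm{cl}(G)$ denotes its clique complex (the simplicial complex whose faces are the vertex sets of cliques of $G$, including the empty face). For a finite simple graph $H$ and a field $\mathbb{K}$, $b_H(n)=\max_G \sum_{i\ge -1}\dim_{\mathbb{K}}\widetilde H_i(\mathrm{cl}(G);\mathbb{K})$, where $G$ ranges over all simple graphs on at most $n$ vertices containing no induced copy of $H$ (reduced homology; the empty graph contributes $1$, so $b_H(0)=1$). $\Gamma_4$ is the unique root in $[1,2]$ of $x^{8}-x^{3}-x^{2}-x-1=0$ ($\Gamma_4\approx 1.2434$). *)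

theory Defs
  imports Complex_Main "HOL-Library.Function_Algebras"
begin

definition simple_graph :: "'a set \<Rightarrow> 'a set set \<Rightarrow> bool" where
  "simple_graph V E \<longleftrightarrow> finite V \<and> (\<forall>e\<in>E. e \<subseteq> V \<and> card e = 2)"

definition induced_sub :: "'a set \<Rightarrow> 'a set set \<Rightarrow> 'b set \<Rightarrow> 'b set set \<Rightarrow> bool" where
  "induced_sub V1 E1 V2 E2 \<longleftrightarrow> (\<exists>f. inj_on f V1 \<and> f ` V1 \<subseteq> V2 \<and>
     (\<forall>u\<in>V1. \<forall>v\<in>V1. {u, v} \<in> E1 \<longleftrightarrow> {f u, f v} \<in> E2))"

definition clique_faces :: "'a set \<Rightarrow> 'a set set \<Rightarrow> 'a set set" where
  "clique_faces V E = {\<sigma>. \<sigma> \<subseteq> V \<and> (\<forall>x\<in>\<sigma>. \<forall>y\<in>\<sigma>. x \<noteq> y \<longrightarrow> {x, y} \<in> E)}"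

definition chain_scale :: "'k::field \<Rightarrow> (nat set \<Rightarrow> 'k) \<Rightarrow> (nat set \<Rightarrow> 'k)" where
  "chain_scale a c = (\<lambda>\<sigma>. a * c \<sigma>)"

text \<open>Simplicial chains with k vertices, i.e. of dimension k-1 (k = 0 is the empty face,
  giving augmented / reduced chains).\<close>
definition chains :: "'k::field itself \<Rightarrow> nat set \<Rightarrow> nat set set \<Rightarrow> nat \<Rightarrow> (nat set \<Rightarrow> 'k) set" where
  "chains _ V E k = {c. \<forall>\<sigma>. c \<sigma> \<noteq> 0 \<longrightarrow> \<sigma> \<in> clique_faces V E \<and> card \<sigma> = k}"

text \<open>Simplicial boundary map with respect to the natural order on vertices:
  the coefficient of tau in the boundary of c is the sum over v of
  (-1)^(position of v in tau plus v) times c(tau plus v).\<close>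
definition bd :: "nat set \<Rightarrow> (nat set \<Rightarrow> 'k::field) \<Rightarrow> (nat set \<Rightarrow> 'k)" where
  "bd V c = (\<lambda>\<tau>. \<Sum>v\<in>V - \<tau>. (-1) ^ card {u\<in>\<tau>. u < v} * c (insert v \<tau>))"

text \<open>dim of reduced homology in degree k-1: dim ker(bd on C_k) - dim im(bd on C_(k+1)).\<close>
definition reduced_betti :: "'k::field itself \<Rightarrow> nat set \<Rightarrow> nat set set \<Rightarrow> nat \<Rightarrow> nat" where
  "reduced_betti K V E k =
     vector_space.dim (chain_scale :: 'k \<Rightarrow> _) {c \<in> chains K V E k. bd V c = 0}
     - vector_space.dim (chain_scale :: 'k \<Rightarrow> _) (bd V ` chains K V E (Suc k))"

text \<open>Total reduced Betti number of cl(G), summing over degrees i = k-1 \<ge> -1.\<close>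
definition total_betti :: "'k::field itself \<Rightarrow> nat set \<Rightarrow> nat set set \<Rightarrow> nat" where
  "total_betti K V E = (\<Sum>k\<le>card V. reduced_betti K V E k)"

text \<open>b_H(n): max over graphs on at most n vertices (w.l.o.g. vertices in 0..n-1)
  with no induced copy of H.\<close>
definition bH :: "'k::field itself \<Rightarrow> nat set \<Rightarrow> nat set set \<Rightarrow> nat \<Rightarrow> nat" where
  "bH K VH EH n = Sup {total_betti K V E | V E. V \<subseteq> {..<n} \<and> simple_graph V E \<and>
                         \<not> induced_sub VH EH V E}"

definition cH :: "'k::field itself \<Rightarrow> nat set \<Rightarrow> nat set set \<Rightarrow> real" where
  "cH K VH EH = lim (\<lambda>n. root n (real (bH K VH EH n)))"

definition K5inf_V :: "nat set" where "K5inf_V = UNIV"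
definition K5inf_E :: "nat set set" where
  "K5inf_E = {{u, v} | u v. u div 5 \<noteq> v div 5}"

definition complete_multipartite :: "nat set \<Rightarrow> nat set set \<Rightarrow> nat list \<Rightarrow> bool" where
  "complete_multipartite V E ps \<longleftrightarrow> simple_graph V E \<and>
     (\<exists>f :: nat \<Rightarrow> nat. f ` V = {..<length ps} \<and>
        (\<forall>j<length ps. card {v\<in>V. f v = j} = ps ! j) \<and>
        E = {{u, v} | u v. u \<in> V \<and> v \<in> V \<and> f u \<noteq> f v})"

definition Gamma4 :: real where
  "Gamma4 = (THE x. 1 \<le> x \<and> x \<le> 2 \<and> x ^ 8 - x ^ 3 - x ^ 2 - x - 1 = 0)"

end

theory Submission
  imports Defs
begin

text \<open>
  Let \<open>F\<close> be the complement of \<open>G\<close>, so that the clique complex of \<open>G\<close> is the independence complex of \<open>F\<close>,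
  and let \<open>\<beta>\<close> be the total reduced Betti number. Splitting the boundary matrix along the faces that
  contain a vertex \<open>w\<close> gives \<open>\<beta>(F) \<le> \<beta>(F - w) + \<beta>(F - N[w])\<close>, and \<open>\<beta>(F) = 0\<close> if \<open>F\<close> has an isolated
  vertex. Hence, for the neighbours \<open>w\<^sub>1, \<dots>, w\<^sub>d\<close> of a vertex in any order, \<open>\<beta>(F)\<close> is at most the sum of the
  \<open>\<beta>(F - {w\<^sub>1, \<dots>, w\<^sub>i\<^sub>-\<^sub>1} - N[w\<^sub>i])\<close>. Applied to a vertex of minimum degree this recursion alone gives the
  rates \<open>4\<^sup>1\<^sup>/\<^sup>5\<close> for all graphs, \<open>3\<^sup>1\<^sup>/\<^sup>4\<close> if \<open>F\<close> has no \<open>K\<^sub>5\<close>, \<open>2\<^sup>1\<^sup>/\<^sup>3\<close> if it has no \<open>K\<^sub>4\<close> and \<open>\<Gamma>\<^sub>4\<close> if it has no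
  triangle; only the case without \<open>K\<^sub>4\<close> needs a long case analysis of the neighbourhood.

  If \<open>G\<close> avoids a complete multipartite graph with \<open>m\<close> parts of size at most \<open>i\<close>, then \<open>F\<close> does not contain
  \<open>m\<close> pairwise non-adjacent copies of \<open>K\<^sub>i\<close>. Branching on vertices of large degree costs an arbitrarily small
  rate, and in a graph of bounded degree the deletion of boundedly many vertices destroys all copies
  of \<open>K\<^sub>i\<close>; so only the size of the largest part matters.

  A join multiplies total Betti numbers, so that the limit exists for edgeless \<open>H\<close> by Fekete's lemma and
  is bounded below by any single example: edgeless graphs, and for \<open>i = 3\<close> the complement of a
  triangle-free graph on 14 vertices with reduced Euler characteristic \<open>\<plusminus>8\<close>.
\<close>

section \<open>Linear algebra of chains\<close>

text \<open>Write y = 1/x for the rate x to be proved. Relative to x^|S|, a branch that loses k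
  vertices costs y^k, and the induction closes once the costs add up to at most 1. At a vertex of
  minimum degree d each of d branches loses d+1 vertices, which gives the rate d^(1/(d+1)), attained
  by disjoint copies of K_(d+1): this is the origin of 4^(1/5), 3^(1/4) and 2^(1/3), for d = 4, 3,
  2. Excluding K_(d+1) does not exclude the degree d, so the count for such degrees must be
  improved. An earlier neighbour not adjacent to the current one is an additional loss, and a degree
  above the minimum is one too. If these do not suffice, a vertex left with degree at most two
  inside a branch yields a further saving, which vanishes only if its component there is a triangle.
  Such a triangle component restricts the neighbourhoods so much that another order of branching, a
  configuration already treated, or a contradiction with K_4-freeness or with the degrees
  remains.\<close>

lemma (in vector_space) dim_le_of_subset_finite_span:
  assumes "V \<subseteq> W" "W \<subseteq> span B" "finite B"
  shows "dim V \<le> dim W"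
proof -
  obtain C where C: "C \<subseteq> V" "independent C" "V \<subseteq> span C" "card C = dim V"
    by (rule basis_exists)
  obtain D where D: "D \<subseteq> W" "independent D" "W \<subseteq> span D" "card D = dim W"
    by (rule basis_exists)
  have "finite D"
    using independent_span_bound[OF assms(3) D(2)] D(1) assms(2) by blast
  then have "card C \<le> card D"
    using independent_span_bound[OF _ C(2)] C(1) D(3) assms(1) by blast
  then show ?thesis using C D by simp
qed

text \<open>The space of all functions on vertex sets is infinite-dimensional, and dimensions behave
  well only below a finite spanning set; hence the form for a subspace \<open>U\<close> in the span
  of a finite \<open>B\<close>. A basis \<open>C\<close> of the kernel is extended to a basis
  \<open>D\<close> of \<open>U\<close>, and the images of \<open>D - C\<close> form a basis of the
  image.\<close>

lemma (in vector_space_pair) rank_nullity: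
  assumes f: "Vector_Spaces.linear s1 s2 f" and U: "vs1.subspace U" "U \<subseteq> vs1.span B" "finite B"
  shows "vs1.dim U = vs1.dim {x\<in>U. f x = 0} + vs2.dim (f ` U)"
proof -
  let ?Z = "{x\<in>U. f x = 0}"
  obtain C where C: "C \<subseteq> ?Z" "vs1.independent C" "?Z \<subseteq> vs1.span C" "card C = vs1.dim ?Z"
    by (rule vs1.basis_exists)
  obtain D where D: "C \<subseteq> D" "D \<subseteq> U" "vs1.independent D" "U \<subseteq> vs1.span D"
    using vs1.maximal_independent_subset_extend[of C U] C by blast
  have finD: "finite D"
    using vs1.independent_span_bound[OF U(3) D(3)] D(2) U(2) by blast
  have spanD: "vs1.span D = U"
    using D(2,4) U(1) vs1.span_minimal by blast
  \<comment> \<open>A kernel element lies in the span of \<open>C\<close>. If it also lies in the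
    span of \<open>D - C\<close>, its coordinates over \<open>D\<close> are supported on two
    disjoint sets, so all vanish.\<close>
  have inj0: "x = 0" if x: "x \<in> vs1.span (D - C)" and fx: "f x = 0" for x
  proof -
    have "x \<in> U" using x spanD vs1.span_mono[of "D - C" D] by blast
    with fx C(3) have xC: "x \<in> vs1.span C" by blast
    have "vs1.representation D x = vs1.representation C x"
      "vs1.representation D x = vs1.representation (D - C) x"
      by (rule vs1.representation_extend[OF D(3) xC D(1)])
        (rule vs1.representation_extend[OF D(3) x Diff_subset])
    then have "vs1.representation C x = (\<lambda>_. 0)"
      using vs1.representation_ne_zero[of C x] vs1.representation_ne_zero[of "D - C" x]
      by (metis DiffD2)
    then show ?thesis
      using vs1.sum_nonzero_representation_eq[OF C(2) xC] by simp
  qed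
  interpret F: Vector_Spaces.linear s1 s2 f by (fact f)
  have inj: "inj_on f (vs1.span (D - C))"
  proof (rule inj_onI)
    fix a b assume a: "a \<in> vs1.span (D - C)" and b: "b \<in> vs1.span (D - C)" and "f a = f b"
    then have "a - b = 0"
      using inj0[of "a - b"] by (simp add: vs1.span_diff F.diff)
    then show "a = b" by simp
  qed
  have ind: "vs2.independent (f ` (D - C))"
    using linear_independent_injective_image[OF f _ inj] D(3) vs1.independent_mono by blast
  have "f ` U \<subseteq> vs2.span (f ` (D - C))"
  proof
    fix z assume "z \<in> f ` U"
    then have "z \<in> f ` vs1.span D" using spanD by simp
    then have "z \<in> vs2.span (f ` D)" using F.span_image by simp
    moreover have "vs2.span (f ` D) \<subseteq> vs2.span (f ` (D - C))"
    proof (rule vs2.span_minimal)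
      show "f ` D \<subseteq> vs2.span (f ` (D - C))"
      proof
        fix w assume "w \<in> f ` D"
        then obtain d where d: "d \<in> D" "w = f d" by blast
        show "w \<in> vs2.span (f ` (D - C))"
        proof (cases "d \<in> C")
          case True
          then have "w = 0" using C(1) d by auto
          then show ?thesis by (simp add: vs2.span_zero)
        next
          case False
          then show ?thesis using d by (simp add: vs2.span_base)
        qed
      qed
    qed simp
    ultimately show "z \<in> vs2.span (f ` (D - C))" by blast
  qed
  then have "card (f ` (D - C)) = vs2.dim (f ` U)"
    using vs2.basis_card_eq_dim[of "f ` (D - C)" "f ` U"] ind D(2) by blast
  moreover have "card (f ` (D - C)) = card (D - C)"
    by (meson card_image inj inj_on_subset vs1.span_superset)
  moreover have "card D = vs1.dim U"
    using vs1.basis_card_eq_dim D by blast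
  moreover have "card D = card C + card (D - C)"
    using D(1) finD by (metis card_Diff_subset card_mono finite_subset le_add_diff_inverse)
  ultimately show ?thesis using C(4) by simp
qed

section \<open>Chains supported on a finite set of faces\<close>

interpretation cvs: vector_space "chain_scale :: 'k::field \<Rightarrow> (nat set \<Rightarrow> 'k) \<Rightarrow> (nat set \<Rightarrow> 'k)"
  by unfold_locales (auto simp: chain_scale_def fun_eq_iff algebra_simps)

interpretation chain_pair: vector_space_pair
  "chain_scale :: 'k::field \<Rightarrow> (nat set \<Rightarrow> 'k) \<Rightarrow> (nat set \<Rightarrow> 'k)"
  "chain_scale :: 'k::field \<Rightarrow> (nat set \<Rightarrow> 'k) \<Rightarrow> (nat set \<Rightarrow> 'k)"
  by unfold_locales

abbreviation chain_linear :: "((nat set \<Rightarrow> 'k::field) \<Rightarrow> (nat set \<Rightarrow> 'k)) \<Rightarrow> bool" where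
  "chain_linear f \<equiv> Vector_Spaces.linear chain_scale chain_scale f"

definition supp_in :: "nat set set \<Rightarrow> (nat set \<Rightarrow> 'k::field) set" where
  "supp_in X = {c. \<forall>\<sigma>. c \<sigma> \<noteq> 0 \<longrightarrow> \<sigma> \<in> X}"

definition unit_chain :: "nat set \<Rightarrow> nat set \<Rightarrow> 'k::field" where
  "unit_chain \<sigma> = (\<lambda>\<tau>. if \<tau> = \<sigma> then 1 else 0)"

lemma chain_linearI:
  assumes "\<And>a b. f (a + b) = f a + f b" "\<And>r a. f (chain_scale r a) = chain_scale r (f a)"
  shows "chain_linear f"
  using assms by unfold_locales

lemma chain_linear_bd: "chain_linear (bd V)"
  by (rule chain_linearI)
     (auto simp: bd_def chain_scale_def fun_eq_iff sum.distrib sum_distrib_left algebra_simps)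

lemma subspace_supp_in: "cvs.subspace (supp_in X)"
  by (rule cvs.subspaceI) (auto simp: supp_in_def chain_scale_def, metis add_0)

lemma sum_fun_apply: "(\<Sum>i\<in>A. f i) x = (\<Sum>i\<in>A. f i x)"
  for f :: "'i \<Rightarrow> 'b \<Rightarrow> 'c::comm_monoid_add"
  by (induction A rule: infinite_finite_induct) auto

lemma supp_in_expand:
  assumes "finite X" "c \<in> supp_in X"
  shows "c = (\<Sum>\<sigma>\<in>X. chain_scale (c \<sigma>) (unit_chain \<sigma>))"
proof
  fix \<tau>
  have "(\<Sum>\<sigma>\<in>X. chain_scale (c \<sigma>) (unit_chain \<sigma>)) \<tau> = (\<Sum>\<sigma>\<in>X. if \<tau> = \<sigma> then c \<sigma> else 0)"
    unfolding sum_fun_apply chain_scale_def unit_chain_def by (intro sum.cong) auto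
  also have "\<dots> = c \<tau>"
    using assms by (auto simp: supp_in_def)
  finally show "c \<tau> = (\<Sum>\<sigma>\<in>X. chain_scale (c \<sigma>) (unit_chain \<sigma>)) \<tau>" by simp
qed

lemma inj_unit_chain: "inj (unit_chain :: nat set \<Rightarrow> nat set \<Rightarrow> 'k::field)"
proof (rule injI)
  fix a b :: "nat set" assume "(unit_chain a :: nat set \<Rightarrow> 'k) = unit_chain b"
  from fun_cong[OF this, of a] show "a = b" by (auto simp: unit_chain_def split: if_splits)
qed

lemma independent_unit_chains:
  assumes "finite X"
  shows "cvs.independent (unit_chain ` X :: (nat set \<Rightarrow> 'k::field) set)"
proof (rule cvs.independent_if_scalars_zero)
  show "finite (unit_chain ` X :: (nat set \<Rightarrow> 'k) set)" using assms by simp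
next
  fix f :: "(nat set \<Rightarrow> 'k) \<Rightarrow> 'k" and x :: "nat set \<Rightarrow> 'k"
  assume s: "(\<Sum>x\<in>unit_chain ` X. chain_scale (f x) x) = 0" and x: "x \<in> unit_chain ` X"
  then obtain \<tau> where t: "\<tau> \<in> X" "x = unit_chain \<tau>" by blast
  have "(\<Sum>\<sigma>\<in>X. chain_scale (f (unit_chain \<sigma>)) (unit_chain \<sigma>)) = (0 :: nat set \<Rightarrow> 'k)"
    using s by (subst (asm) sum.reindex) (auto intro: inj_on_subset[OF inj_unit_chain])
  then have "(\<Sum>\<sigma>\<in>X. chain_scale (f (unit_chain \<sigma>)) (unit_chain \<sigma>) \<tau>) = 0"
    by (metis sum_fun_apply zero_fun_apply)
  moreover have "chain_scale (f (unit_chain \<sigma>)) (unit_chain \<sigma>) \<tau> = (if \<tau> = \<sigma> then f (unit_chain \<sigma>) else 0)"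
    for \<sigma> by (simp add: chain_scale_def unit_chain_def)
  ultimately show "f x = 0" using t assms by simp
qed

lemma unit_chain_in_supp: "\<sigma> \<in> X \<Longrightarrow> unit_chain \<sigma> \<in> supp_in X"
  by (auto simp: unit_chain_def supp_in_def split: if_splits)

lemma supp_in_span:
  assumes "finite X" shows "supp_in X \<subseteq> cvs.span (unit_chain ` X)"
proof
  fix c :: "nat set \<Rightarrow> 'a" assume c: "c \<in> supp_in X"
  show "c \<in> cvs.span (unit_chain ` X)"
    by (subst supp_in_expand[OF assms c])
       (intro cvs.span_sum cvs.span_scale cvs.span_base imageI)
qed

lemma dim_supp_in:
  assumes "finite X" shows "cvs.dim (supp_in X :: (nat set \<Rightarrow> 'k::field) set) = card X"
proof -
  have "card (unit_chain ` X :: (nat set \<Rightarrow> 'k) set) = cvs.dim (supp_in X :: (nat set \<Rightarrow> 'k) set)"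
    using supp_in_span[OF assms] independent_unit_chains[OF assms]
    by (intro cvs.basis_card_eq_dim) (auto intro: unit_chain_in_supp)
  then show ?thesis
    using card_image[OF inj_on_subset[OF inj_unit_chain subset_UNIV]] by metis
qed

lemma dim_mono_supp_in:
  assumes "finite X" "A \<subseteq> B" "B \<subseteq> supp_in X"
  shows "cvs.dim A \<le> cvs.dim B"
  using cvs.dim_le_of_subset_finite_span[OF assms(2)] supp_in_span[OF assms(1)] assms(1,3)
  by (meson finite_imageI order_trans)

lemma rank_nullity_supp_in:
  assumes "finite X" "cvs.subspace U" "U \<subseteq> supp_in X" "chain_linear f"
  shows "cvs.dim U = cvs.dim {c\<in>U. f c = 0} + cvs.dim (f ` U)"
  using chain_pair.rank_nullity[OF assms(4,2)] supp_in_span[OF assms(1)] assms(1,3)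
  by (meson finite_imageI order_trans)

section \<open>Boundary ranks and vertex deletion\<close>

definition kfaces :: "nat set \<Rightarrow> nat set set \<Rightarrow> nat \<Rightarrow> nat set set" where
  "kfaces V E k = {\<sigma> \<in> clique_faces V E. card \<sigma> = k}"

definition esign :: "nat set \<Rightarrow> nat \<Rightarrow> 'k::field" where
  "esign \<tau> v = (-1) ^ card {u\<in>\<tau>. u < v}"

definition bd_rank :: "'k::field itself \<Rightarrow> nat set \<Rightarrow> nat set set \<Rightarrow> nat \<Rightarrow> nat" where
  "bd_rank K V E k = cvs.dim (bd V ` chains K V E (Suc k))"

lemma chains_eq: "chains K V E k = supp_in (kfaces V E k)"
  by (auto simp: chains_def supp_in_def kfaces_def)

lemma bd_eq: "bd V c = (\<lambda>\<tau>. \<Sum>v\<in>V - \<tau>. esign \<tau> v * c (insert v \<tau>))"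
  by (simp add: bd_def esign_def)

text \<open>A new vertex below \<open>v\<close> shifts the position of \<open>v\<close> by one. This
  sign change makes the boundary square to zero and governs the passage to links.\<close>

lemma esign_insert:
  assumes "w \<notin> \<tau>"
  shows "esign (insert w \<tau>) v = (if w < v then - esign \<tau> v else (esign \<tau> v :: 'k::field))"
proof (cases "w < v")
  case True
  have "{u \<in> insert w \<tau>. u < v} = insert w {u\<in>\<tau>. u < v}" using True by auto
  moreover have "finite {u\<in>\<tau>. u < v}" by (rule finite_subset[of _ "{..<v}"]) auto
  ultimately show ?thesis using True assms by (simp add: esign_def)
next
  case False
  then have "{u \<in> insert w \<tau>. u < v} = {u\<in>\<tau>. u < v}" by auto
  then show ?thesis using False by (simp add: esign_def)
qed

lemma esign_self: "esign (insert v \<tau>) v = esign \<tau> v"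
  unfolding esign_def by (rule arg_cong[of _ _ "\<lambda>A. (-1) ^ card A"]) auto

lemma esign_square [simp]: "esign \<tau> v * esign \<tau> v = (1 :: 'k::field)"
  by (simp add: esign_def flip: power_add mult_2)

lemma finite_clique_faces: "finite V \<Longrightarrow> finite (clique_faces V E)"
  by (rule finite_subset[of _ "Pow V"]) (auto simp: clique_faces_def)

lemma finite_kfaces: "finite V \<Longrightarrow> finite (kfaces V E k)"
  by (simp add: kfaces_def finite_clique_faces)

lemma clique_faces_subset_closed:
  "\<sigma> \<in> clique_faces V E \<Longrightarrow> \<tau> \<subseteq> \<sigma> \<Longrightarrow> \<tau> \<in> clique_faces V E"
  by (auto simp: clique_faces_def)

lemma bd_chains:
  assumes "finite V" "c \<in> chains K V E (Suc k)"
  shows "bd V c \<in> chains K V E k"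
proof -
  have "\<tau> \<in> kfaces V E k" if nz: "bd V c \<tau> \<noteq> 0" for \<tau>
  proof -
    have "\<exists>v\<in>V - \<tau>. c (insert v \<tau>) \<noteq> 0"
      using nz unfolding bd_eq by (metis (mono_tags, lifting) mult_zero_right sum.neutral)
    then obtain v where v: "v \<in> V - \<tau>" "c (insert v \<tau>) \<noteq> 0" by blast
    then have f: "insert v \<tau> \<in> clique_faces V E" "card (insert v \<tau>) = Suc k"
      using assms(2) by (auto simp: chains_eq supp_in_def kfaces_def)
    then have "finite \<tau>" by (metis card_ge_0_finite finite_insert zero_less_Suc)
    with f v have "card \<tau> = k" by simp
    with clique_faces_subset_closed[OF f(1), of \<tau>] show ?thesis
      by (auto simp: kfaces_def)
  qed
  then show ?thesis by (auto simp: chains_eq supp_in_def)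
qed

lemma bd_bd: 
  assumes "finite V" shows "bd V (bd V c) = 0"
proof
  fix \<tau>
  define W where "W = V - \<tau>"
  define g where "g v u = esign \<tau> v * esign (insert v \<tau>) u * c (insert u (insert v \<tau>))" for v u
  have fin: "finite W" using assms by (simp add: W_def)
  have "bd V (bd V c) \<tau> = (\<Sum>v\<in>W. \<Sum>u\<in>W - {v}. g v u)"
    unfolding bd_eq W_def g_def
    by (auto simp: sum_distrib_left mult.assoc intro!: sum.cong)
  also have "\<dots> = (\<Sum>(v,u)\<in>(SIGMA v:W. W - {v}). g v u)"
    using fin by (subst sum.Sigma) auto
  \<comment> \<open>Ordered pairs of new vertices are split by their order. The terms
    \<open>g v u\<close> and \<open>g u v\<close> cancel, because inserting the smaller vertex first
    flips the sign of the larger one, but not conversely.\<close>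
  also have "(SIGMA v:W. W - {v}) = {(v,u). v \<in> W \<and> u \<in> W \<and> v < u} \<union> {(v,u). v \<in> W \<and> u \<in> W \<and> u < v}"
    by auto
  also have "(\<Sum>(v,u)\<in>\<dots>. g v u) = (\<Sum>(v,u)\<in>{(v,u). v \<in> W \<and> u \<in> W \<and> v < u}. g v u)
      + (\<Sum>(v,u)\<in>{(v,u). v \<in> W \<and> u \<in> W \<and> u < v}. g v u)"
    by (rule sum.union_disjoint) (auto intro: finite_subset[OF _ finite_cartesian_product[OF fin fin]])
  also have "(\<Sum>(v,u)\<in>{(v,u). v \<in> W \<and> u \<in> W \<and> u < v}. g v u)
      = (\<Sum>(v,u)\<in>{(v,u). v \<in> W \<and> u \<in> W \<and> v < u}. g u v)"
    by (rule sum.reindex_bij_witness[of _ prod.swap prod.swap]) auto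
  also have "(\<Sum>(v,u)\<in>{(v,u). v \<in> W \<and> u \<in> W \<and> v < u}. g v u) + \<dots>
      = (\<Sum>(v,u)\<in>{(v,u). v \<in> W \<and> u \<in> W \<and> v < u}. g v u + g u v)"
    by (simp add: sum.distrib case_prod_unfold)
  also have "\<dots> = 0"
    by (intro sum.neutral) (auto simp: g_def W_def esign_insert insert_commute)
  finally show "bd V (bd V c) \<tau> = 0 \<tau>" by simp
qed

lemma subspace_bd_image: "cvs.subspace (bd V ` chains K V E k)"
  using chain_linear_bd[of V] subspace_supp_in unfolding chains_eq
  by (rule chain_pair.linear_subspace_image)

lemma bd_rank_nullity:
  assumes "finite V"
  shows "cvs.dim {c \<in> chains K V E (Suc k). bd V c = 0} + bd_rank K V E k = card (kfaces V E (Suc k))"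
proof -
  have "cvs.dim (chains K V E (Suc k)) = cvs.dim {c \<in> chains K V E (Suc k). bd V c = 0}
      + cvs.dim (bd V ` chains K V E (Suc k))"
    unfolding chains_eq
    by (rule rank_nullity_supp_in[OF finite_kfaces[OF assms] subspace_supp_in order_refl chain_linear_bd])
  then show ?thesis
    by (simp add: bd_rank_def chains_eq dim_supp_in finite_kfaces assms)
qed

lemma kfaces_0: "kfaces V E 0 \<subseteq> {{}}" if "finite V"
  using that by (auto simp: kfaces_def clique_faces_def dest: finite_subset)

lemma dim_cycles_0:
  assumes "finite V"
  shows "cvs.dim {c \<in> chains K V E 0. bd V c = 0} = card (kfaces V E 0)"
proof -
  have "bd V c = 0" if "c \<in> chains K V E 0" for c
    using that kfaces_0[OF assms, of E] by (fastforce simp: bd_eq chains_eq supp_in_def intro!: sum.neutral)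
  then have "{c \<in> chains K V E 0. bd V c = 0} = chains K V E 0" by blast
  then show ?thesis by (simp add: chains_eq dim_supp_in finite_kfaces assms)
qed

text \<open>\<open>bd_rank K V E k\<close> is the rank of the boundary map into chains with
  \<open>k\<close> vertices. Boundaries are cycles, so the subtraction of natural numbers in
  \<open>reduced_betti\<close> does not truncate and the identity holds over the integers.\<close>

lemma reduced_betti_eq:
  assumes "finite V"
  shows "int (reduced_betti K V E k) = int (card (kfaces V E k)) - int (bd_rank K V E k)
           - (case k of 0 \<Rightarrow> 0 | Suc j \<Rightarrow> int (bd_rank K V E j))"
proof -
  have "bd V ` chains K V E (Suc k) \<subseteq> {c \<in> chains K V E k. bd V c = 0}"
    using bd_chains[OF assms] bd_bd[OF assms] by blast
  then have "bd_rank K V E k \<le> cvs.dim {c \<in> chains K V E k. bd V c = 0}"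
    unfolding bd_rank_def
    by (rule dim_mono_supp_in[OF finite_kfaces[OF assms]]) (auto simp: chains_eq)
  moreover have "int (cvs.dim {c \<in> chains K V E k. bd V c = 0}) = int (card (kfaces V E k))
      - (case k of 0 \<Rightarrow> 0 | Suc j \<Rightarrow> int (bd_rank K V E j))"
  proof (cases k)
    case (Suc j)
    then show ?thesis using bd_rank_nullity[OF assms, of K E j] by simp
  qed (simp add: dim_cycles_0[OF assms, of K E])
  ultimately show ?thesis by (simp add: reduced_betti_def bd_rank_def of_nat_diff)
qed

lemma kfaces_large: "finite V \<Longrightarrow> card V < k \<Longrightarrow> kfaces V E k = {}"
  by (auto simp: kfaces_def clique_faces_def dest: card_mono)

lemma supp_in_empty: "supp_in {} = {0}"
  by (auto simp: supp_in_def fun_eq_iff)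

lemma bd_rank_large: "finite V \<Longrightarrow> card V \<le> k \<Longrightarrow> bd_rank K V E k = 0"
proof -
  assume a: "finite V" "card V \<le> k"
  then have "chains K V E (Suc k) = {0}"
    by (simp add: chains_eq kfaces_large supp_in_empty)
  then have "bd V ` chains K V E (Suc k) \<subseteq> supp_in {}"
    by (auto simp: bd_eq supp_in_def)
  from dim_mono_supp_in[OF finite.emptyI this order_refl] show ?thesis
    by (simp add: bd_rank_def dim_supp_in)
qed

lemma sum_card_kfaces:
  assumes "finite V" "card V \<le> M" shows "(\<Sum>k\<le>M. card (kfaces V E k)) = card (clique_faces V E)"
proof -
  have "clique_faces V E = (\<Union>k\<in>{..M}. kfaces V E k)"
    using assms by (auto simp: kfaces_def clique_faces_def dest: card_mono intro: order_trans)
  then show ?thesis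
    by (simp add: card_UN_disjoint finite_kfaces assms) (subst card_UN_disjoint; auto simp: kfaces_def finite_clique_faces assms)
qed

lemma sum_shift_pred: "(\<Sum>k\<le>M. case k of 0 \<Rightarrow> 0 | Suc j \<Rightarrow> f j) = (\<Sum>k<M. f k)"
  for f :: "nat \<Rightarrow> int"
  by (induction M) auto

text \<open>Each rank is subtracted twice, once for the lost cycles and once for the boundaries. The
  limit \<open>M\<close> stays free so that a complex, its deletion and its link can be compared
  over matching ranges of degrees.\<close>

lemma total_betti_eq:
  assumes "finite V" "card V \<le> M"
  shows "int (total_betti K V E) = int (card (clique_faces V E)) - 2 * (\<Sum>k<M. int (bd_rank K V E k))"
proof -
  define n where "n = card V"
  have r: "(\<Sum>k<M. int (bd_rank K V E k)) = (\<Sum>k<n. int (bd_rank K V E k))"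
    using assms by (intro sum.mono_neutral_right) (auto simp: n_def bd_rank_large)
  have "int (total_betti K V E) = (\<Sum>k\<le>n. int (reduced_betti K V E k))"
    by (simp add: total_betti_def n_def)
  also have "\<dots> = (\<Sum>k\<le>n. int (card (kfaces V E k))) - (\<Sum>k\<le>n. int (bd_rank K V E k))
     - (\<Sum>k\<le>n. case k of 0 \<Rightarrow> 0 | Suc j \<Rightarrow> int (bd_rank K V E j))"
    by (simp add: reduced_betti_eq[OF assms(1)] sum_subtractf)
  also have "(\<Sum>k\<le>n. int (bd_rank K V E k)) = (\<Sum>k<n. int (bd_rank K V E k))"
    using assms by (intro sum.mono_neutral_right) (auto simp: n_def bd_rank_large)
  also have "(\<Sum>k\<le>n. int (card (kfaces V E k))) = int (card (clique_faces V E))"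
    using sum_card_kfaces[OF assms(1), of n E] by (simp add: n_def flip: of_nat_sum)
  finally show ?thesis by (simp add: sum_shift_pred r)
qed

lemma alternating_telescope:
  "(\<Sum>k\<le>M. (-1)^k * ((case k of 0 \<Rightarrow> 0 | Suc j \<Rightarrow> f j) + f k)) = (-1)^M * f M"
  for f :: "nat \<Rightarrow> int"
  by (induction M) (auto simp: algebra_simps)

text \<open>Euler-Poincare: in the alternating sum the two ranks in each Betti number telescope
  away. A count of faces thus becomes a lower bound over every field.\<close>

lemma euler_char_le_total_betti:
  assumes "finite V"
  shows "\<bar>\<Sum>\<sigma>\<in>clique_faces V E. (-1) ^ card \<sigma>\<bar> \<le> int (total_betti K V E)"
proof -
  define n where "n = card V"
  have "(\<Sum>\<sigma>\<in>clique_faces V E. (-1) ^ card \<sigma> :: int)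
      = (\<Sum>k\<le>n. \<Sum>\<sigma>\<in>{\<sigma>\<in>clique_faces V E. card \<sigma> = k}. (-1) ^ card \<sigma>)"
    using assms by (intro sum.group[symmetric])
      (auto simp: finite_clique_faces n_def clique_faces_def intro: card_mono)
  also have "\<dots> = (\<Sum>k\<le>n. (-1)^k * int (card (kfaces V E k)))"
    by (intro sum.cong) (auto simp: kfaces_def)
  also have "\<dots> = (\<Sum>k\<le>n. (-1)^k * int (reduced_betti K V E k))
      + (\<Sum>k\<le>n. (-1)^k * ((case k of 0 \<Rightarrow> 0 | Suc j \<Rightarrow> int (bd_rank K V E j)) + int (bd_rank K V E k)))"
    by (simp add: reduced_betti_eq[OF assms] flip: sum.distrib) (simp add: algebra_simps)
  also have "\<dots> = (\<Sum>k\<le>n. (-1)^k * int (reduced_betti K V E k))"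
    unfolding alternating_telescope by (simp add: n_def bd_rank_large assms)
  finally have "\<bar>\<Sum>\<sigma>\<in>clique_faces V E. (-1) ^ card \<sigma>\<bar> \<le> (\<Sum>k\<le>n. \<bar>(-1)^k * int (reduced_betti K V E k)\<bar>)"
    by (simp add: sum_abs)
  also have "\<dots> = int (total_betti K V E)"
    by (simp add: total_betti_def n_def abs_mult)
  finally show ?thesis .
qed

section \<open>Deletion and link of a vertex; cones\<close>

definition link_verts :: "nat set \<Rightarrow> nat set set \<Rightarrow> nat \<Rightarrow> nat set" where
  "link_verts V E w = {u \<in> V - {w}. {u, w} \<in> E}"

text \<open>In a clique complex the link of \<open>w\<close> is again the clique complex of an
  induced subgraph, the one on the neighbours of \<open>w\<close>. So the recursion never leaves
  clique complexes.\<close>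

lemma clique_faces_insert:
  assumes "w \<in> V" "w \<notin> \<tau>"
  shows "insert w \<tau> \<in> clique_faces V E \<longleftrightarrow> \<tau> \<in> clique_faces (link_verts V E w) E"
  using assms by (auto simp: clique_faces_def link_verts_def insert_commute)

lemma clique_faces_delete: "w \<notin> \<tau> \<Longrightarrow> \<tau> \<in> clique_faces V E \<longleftrightarrow> \<tau> \<in> clique_faces (V - {w}) E"
  by (auto simp: clique_faces_def)

lemma link_face_nmem: "\<tau> \<in> clique_faces (link_verts V E w) E \<Longrightarrow> w \<notin> \<tau>"
  by (auto simp: clique_faces_def link_verts_def)

lemma clique_faces_split:
  assumes "w \<in> V"
  shows "clique_faces V E = clique_faces (V - {w}) E \<union> insert w ` clique_faces (link_verts V E w) E"
proof (intro set_eqI)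
  fix \<sigma>
  show "\<sigma> \<in> clique_faces V E \<longleftrightarrow>
    \<sigma> \<in> clique_faces (V - {w}) E \<union> insert w ` clique_faces (link_verts V E w) E"
  proof (cases "w \<in> \<sigma>")
    case True
    then have s: "insert w (\<sigma> - {w}) = \<sigma>" by auto
    have iff: "\<sigma> \<in> clique_faces V E \<longleftrightarrow> \<sigma> - {w} \<in> clique_faces (link_verts V E w) E"
      using clique_faces_insert[OF assms, of "\<sigma> - {w}" E] unfolding s by simp
    have "\<sigma> \<notin> clique_faces (V - {w}) E" using True by (auto simp: clique_faces_def)
    moreover have "\<sigma> - {w} \<in> clique_faces (link_verts V E w) E \<longleftrightarrow> \<sigma> \<in> insert w ` clique_faces (link_verts V E w) E"
    proof
      assume "\<sigma> - {w} \<in> clique_faces (link_verts V E w) E"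
      then have "insert w (\<sigma> - {w}) \<in> insert w ` clique_faces (link_verts V E w) E" by (rule imageI)
      then show "\<sigma> \<in> insert w ` clique_faces (link_verts V E w) E" unfolding s .
    next
      assume "\<sigma> \<in> insert w ` clique_faces (link_verts V E w) E"
      then obtain \<tau> where t: "\<sigma> = insert w \<tau>" "\<tau> \<in> clique_faces (link_verts V E w) E" by (rule imageE)
      then have "\<sigma> - {w} = \<tau>" using link_face_nmem[OF t(2)] by simp
      then show "\<sigma> - {w} \<in> clique_faces (link_verts V E w) E" using t(2) by simp
    qed
    ultimately show ?thesis unfolding iff Un_iff by simp
  next
    case False
    then show ?thesis using clique_faces_delete[OF False] by auto
  qed
qed

lemma card_clique_faces_split:
  assumes "finite V" "w \<in> V"
  shows "card (clique_faces V E) = card (clique_faces (V - {w}) E) + card (clique_faces (link_verts V E w) E)"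
proof -
  have "inj_on (insert w) (clique_faces (link_verts V E w) E)"
    using link_face_nmem by (metis inj_onI insert_ident)
  moreover have "clique_faces (V - {w}) E \<inter> insert w ` clique_faces (link_verts V E w) E = {}"
    by (auto simp: clique_faces_def)
  ultimately show ?thesis
    using assms by (subst clique_faces_split[OF assms(2)])
      (subst card_Un_disjoint, auto simp: card_image finite_clique_faces link_verts_def)
qed

text \<open>The sign turns the boundary of the ambient complex into the boundary of the link of \<open>w\<close>, for an
  arbitrary position of \<open>w\<close> in the vertex order.\<close>
definition link_map :: "nat \<Rightarrow> (nat set \<Rightarrow> 'k::field) \<Rightarrow> (nat set \<Rightarrow> 'k)" where
  "link_map w c = (\<lambda>\<tau>. if w \<in> \<tau> then 0 else (-1) ^ card {u\<in>\<tau>. w < u} * c (insert w \<tau>))"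

lemma chain_linear_link_map: "chain_linear (link_map w)"
  by (rule chain_linearI) (auto simp: link_map_def chain_scale_def fun_eq_iff algebra_simps)

text \<open>Inserting \<open>v\<close> above \<open>w\<close> changes both the sign in
  \<open>link_map\<close> and the sign of \<open>v\<close> in the presence of \<open>w\<close>; the
  two changes cancel.\<close>

lemma link_map_bd:
  assumes "finite V" "w \<in> V" "c \<in> chains K V E k"
  shows "link_map w (bd V c) = bd (link_verts V E w) (link_map w c)"
proof
  fix \<tau>
  have c0: "c \<sigma> = 0" if "\<sigma> \<notin> clique_faces V E" for \<sigma>
    using assms(3) that by (auto simp: chains_def)
  show "link_map w (bd V c) \<tau> = bd (link_verts V E w) (link_map w c) \<tau>"
  proof (cases "w \<in> \<tau> \<or> infinite \<tau>")
    case True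
    then show ?thesis
    proof
      assume "infinite \<tau>"
      then have "insert v \<tau> \<notin> clique_faces V E" "insert w (insert v \<tau>) \<notin> clique_faces V E" "insert v (insert w \<tau>) \<notin> clique_faces V E" for v
        using assms(1) by (auto simp: clique_faces_def dest: finite_subset)
      then show ?thesis by (auto simp: link_map_def bd_eq c0 intro!: sum.neutral)
    qed (auto simp: link_map_def bd_eq)
  next
    case False
    then have w: "w \<notin> \<tau>" and fin: "finite \<tau>" by auto
    define e where "e = (\<lambda>\<tau>. (-1) ^ card {u\<in>\<tau>. w < u} :: 'a)"
    have ee: "e (insert v \<tau>) = (if w < v then - e \<tau> else e \<tau>)" if "v \<notin> \<tau>" for v
    proof (cases "w < v")
      case True
      then have "{u \<in> insert v \<tau>. w < u} = insert v {u\<in>\<tau>. w < u}" by auto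
      then show ?thesis using True that fin by (simp add: e_def)
    next
      case False
      then have "{u \<in> insert v \<tau>. w < u} = {u\<in>\<tau>. w < u}" by auto
      then show ?thesis using False by (simp add: e_def)
    qed
    have "link_map w (bd V c) \<tau> = (\<Sum>v\<in>V - insert w \<tau>. e \<tau> * (esign (insert w \<tau>) v * c (insert v (insert w \<tau>))))"
      using w by (simp add: link_map_def bd_eq sum_distrib_left e_def)
    also have "\<dots> = (\<Sum>v\<in>V - insert w \<tau>. esign \<tau> v * (e (insert v \<tau>) * c (insert w (insert v \<tau>))))"
    proof (intro sum.cong refl)
      fix v assume "v \<in> V - insert w \<tau>"
      then have "v \<notin> \<tau>" by simp
      show "e \<tau> * (esign (insert w \<tau>) v * c (insert v (insert w \<tau>)))
          = esign \<tau> v * (e (insert v \<tau>) * c (insert w (insert v \<tau>)))"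
        unfolding ee[OF \<open>v \<notin> \<tau>\<close>] esign_insert[OF w] insert_commute[of w v] by simp
    qed
    also have "\<dots> = (\<Sum>v\<in>link_verts V E w - \<tau>. esign \<tau> v * (e (insert v \<tau>) * c (insert w (insert v \<tau>))))"
    proof (intro sum.mono_neutral_right ballI)
      fix v assume v: "v \<in> V - insert w \<tau> - (link_verts V E w - \<tau>)"
      then have "v \<notin> link_verts V E w" by auto
      then have "insert w (insert v \<tau>) \<notin> clique_faces V E"
        using v clique_faces_insert[of w V "insert v \<tau>" E] assms(2) w by (auto simp: clique_faces_def)
      then show "esign \<tau> v * (e (insert v \<tau>) * c (insert w (insert v \<tau>))) = 0" by (simp add: c0)
    qed (use assms in \<open>auto simp: link_verts_def\<close>)
    also have "\<dots> = bd (link_verts V E w) (link_map w c) \<tau>"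
      unfolding bd_eq by (intro sum.cong) (use w in \<open>auto simp: link_map_def link_verts_def e_def\<close>)
    finally show ?thesis .
  qed
qed

lemma link_map_chains:
  assumes "finite V" "w \<in> V"
  shows "link_map w ` chains K V E (Suc k) = chains K (link_verts V E w) E k"
proof
  show "link_map w ` chains K V E (Suc k) \<subseteq> chains K (link_verts V E w) E k"
  proof
    fix d assume "d \<in> link_map w ` chains K V E (Suc k)"
    then obtain c where c: "c \<in> chains K V E (Suc k)" "d = link_map w c" by blast
    have "\<tau> \<in> clique_faces (link_verts V E w) E \<and> card \<tau> = k" if "d \<tau> \<noteq> 0" for \<tau>
    proof -
      have "w \<notin> \<tau>" "c (insert w \<tau>) \<noteq> 0" using that c(2) by (auto simp: link_map_def split: if_splits)
      then have "insert w \<tau> \<in> clique_faces V E" "card (insert w \<tau>) = Suc k"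
        using c(1) by (auto simp: chains_def)
      moreover from this(2) have "finite \<tau>" by (metis card_ge_0_finite finite_insert zero_less_Suc)
      ultimately show ?thesis using clique_faces_insert[OF assms(2) \<open>w \<notin> \<tau>\<close>] \<open>w \<notin> \<tau>\<close> by auto
    qed
    then show "d \<in> chains K (link_verts V E w) E k" by (auto simp: chains_def)
  qed
next
  show "chains K (link_verts V E w) E k \<subseteq> link_map w ` chains K V E (Suc k)"
  proof
    fix d assume d: "d \<in> chains K (link_verts V E w) E k"
    define c where "c = (\<lambda>\<sigma>. if w \<in> \<sigma> then (-1) ^ card {u\<in>\<sigma> - {w}. w < u} * d (\<sigma> - {w}) else 0)"
    have d0: "d \<tau> \<noteq> 0 \<Longrightarrow> \<tau> \<in> clique_faces (link_verts V E w) E \<and> card \<tau> = k" for \<tau>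
      using d by (auto simp: chains_def)
    have "c \<in> chains K V E (Suc k)"
    proof -
      have "\<sigma> \<in> clique_faces V E \<and> card \<sigma> = Suc k" if "c \<sigma> \<noteq> 0" for \<sigma>
      proof -
        have w: "w \<in> \<sigma>" "d (\<sigma> - {w}) \<noteq> 0" using that by (auto simp: c_def split: if_splits)
        then have f: "\<sigma> - {w} \<in> clique_faces (link_verts V E w) E" "card (\<sigma> - {w}) = k" using d0 by auto
        have "finite (\<sigma> - {w})" using f(1) assms(1)
          by (auto simp: clique_faces_def link_verts_def dest: finite_subset)
        then show ?thesis
          using f w clique_faces_insert[OF assms(2), of "\<sigma> - {w}" E]
          by (metis DiffD2 card.insert insertI1 insert_Diff)
      qed
      then show ?thesis by (auto simp: chains_def)
    qed
    moreover have "link_map w c = d"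
    proof
      fix \<tau>
      show "link_map w c \<tau> = d \<tau>"
      proof (cases "w \<in> \<tau>")
        case True
        then show ?thesis using d0[of \<tau>] link_face_nmem by (auto simp: link_map_def)
      next
        case False
        then have "insert w \<tau> - {w} = \<tau>" by auto
        then show ?thesis using False
          by (simp add: link_map_def c_def flip: mult.assoc power_add mult_2)
      qed
    qed
    ultimately show "d \<in> link_map w ` chains K V E (Suc k)" by blast
  qed
qed

lemma bd_restrict:
  assumes "finite V" "c \<in> chains K W E k" "W \<subseteq> V"
  shows "bd V c = bd W c"
proof
  fix \<tau>
  have "c (insert v \<tau>) = 0" if "v \<notin> W" for v
    using that assms(2) by (auto simp: chains_def clique_faces_def)
  then show "bd V c \<tau> = bd W c \<tau>"
    unfolding bd_eq using assms by (intro sum.mono_neutral_right) auto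
qed

lemma clique_faces_mono: "W \<subseteq> V \<Longrightarrow> clique_faces W E \<subseteq> clique_faces V E"
  by (auto simp: clique_faces_def)

lemma chains_mono: "W \<subseteq> V \<Longrightarrow> chains K W E k \<subseteq> chains K V E k"
  using clique_faces_mono by (fastforce simp: chains_def)

lemma bd_image_supp: "finite V \<Longrightarrow> bd V ` chains K V E (Suc k) \<subseteq> supp_in (kfaces V E k)"
  using bd_chains chains_eq by blast

text \<open>Sorting the faces by whether they contain \<open>w\<close> makes the boundary matrix
  block triangular, and the rank is at least the sum of the ranks of the diagonal blocks. Formally,
  rank-nullity is applied to \<open>link_map w\<close> on the space of boundaries: its kernel
  contains the boundaries of the deletion, and its image consists of the boundaries of the link, one
  degree lower.\<close>

lemma bd_rank_split:
  assumes "finite V" "w \<in> V"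
  shows "bd_rank K V E k \<ge> bd_rank K (V - {w}) E k + (case k of 0 \<Rightarrow> 0 | Suc j \<Rightarrow> bd_rank K (link_verts V E w) E j)"
proof -
  let ?A = "bd V ` chains K V E (Suc k)"
  have eq: "cvs.dim ?A = cvs.dim {c\<in>?A. link_map w c = 0} + cvs.dim (link_map w ` ?A)"
    by (rule rank_nullity_supp_in[OF finite_kfaces[OF assms(1)] subspace_bd_image bd_image_supp[OF assms(1)]
          chain_linear_link_map])
  have "bd (V - {w}) ` chains K (V - {w}) E (Suc k) \<subseteq> {c\<in>?A. link_map w c = 0}"
  proof
    fix d assume "d \<in> bd (V - {w}) ` chains K (V - {w}) E (Suc k)"
    then obtain c where c: "c \<in> chains K (V - {w}) E (Suc k)" "d = bd (V - {w}) c" by blast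
    have "d = bd V c" using bd_restrict[OF assms(1) c(1)] c(2) by auto
    moreover have "c \<in> chains K V E (Suc k)" using chains_mono[of "V - {w}" V] c(1) by blast
    moreover have "d \<in> chains K (V - {w}) E k" using bd_chains c assms(1) by blast
    then have "d (insert w \<tau>) = 0" for \<tau> by (auto simp: chains_def clique_faces_def)
    ultimately show "d \<in> {c\<in>?A. link_map w c = 0}" by (auto simp: link_map_def)
  qed
  then have 1: "bd_rank K (V - {w}) E k \<le> cvs.dim {c\<in>?A. link_map w c = 0}"
    unfolding bd_rank_def using bd_image_supp[OF assms(1), of K E k]
    by (intro dim_mono_supp_in[OF finite_kfaces[OF assms(1), of E k]]) auto
  have 2: "cvs.dim (link_map w ` ?A) = bd_rank K (link_verts V E w) E j" if "k = Suc j" for j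
  proof -
    have "link_map w ` ?A = (\<lambda>c. bd (link_verts V E w) (link_map w c)) ` chains K V E (Suc k)"
      using link_map_bd[OF assms] by (auto simp: image_image intro!: image_cong)
    also have "\<dots> = bd (link_verts V E w) ` chains K (link_verts V E w) E k"
      unfolding link_map_chains[OF assms, of K E k, symmetric] image_image ..
    finally show ?thesis using that by (simp add: bd_rank_def)
  qed
  show ?thesis using eq 1 2 by (cases k) (auto simp: bd_rank_def[of K V])
qed

lemma link_verts_subset: "link_verts V E w \<subseteq> V" by (auto simp: link_verts_def)

text \<open>Numbers of faces add up exactly while ranks are superadditive, so by
  \<open>total_betti_eq\<close> the Betti numbers are subadditive.\<close>

theorem total_betti_delete_link:
  assumes "finite V" "w \<in> V"
  shows "total_betti K V E \<le> total_betti K (V - {w}) E + total_betti K (link_verts V E w) E"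
proof -
  define M where "M = Suc (card V)"
  have fin: "finite (V - {w})" "finite (link_verts V E w)" using assms by (auto simp: link_verts_def)
  have cl: "card (link_verts V E w) < M" "card (V - {w}) < M"
    using card_mono[OF assms(1) link_verts_subset] card_mono[OF assms(1), of "V - {w}"]
    by (auto simp: M_def less_Suc_eq_le)
  have "(\<Sum>k<M. int (bd_rank K V E k)) \<ge>
     (\<Sum>k<M. int (bd_rank K (V - {w}) E k) + (case k of 0 \<Rightarrow> 0 | Suc j \<Rightarrow> int (bd_rank K (link_verts V E w) E j)))"
    using bd_rank_split[OF assms, of K E]
    by (intro sum_mono) (fastforce split: nat.splits simp flip: of_nat_add)
  also have "(\<Sum>k<M. int (bd_rank K (V - {w}) E k) + (case k of 0 \<Rightarrow> 0 | Suc j \<Rightarrow> int (bd_rank K (link_verts V E w) E j)))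
      = (\<Sum>k<M. int (bd_rank K (V - {w}) E k)) + (\<Sum>k<card V. int (bd_rank K (link_verts V E w) E k))"
    by (simp add: sum.distrib M_def lessThan_Suc_atMost sum_shift_pred)
  finally show ?thesis
    using total_betti_eq[OF assms(1), of M K E] total_betti_eq[OF fin(1), of M K E]
      total_betti_eq[OF fin(2), of "card V" K E] card_clique_faces_split[OF assms, of E] cl
    by (simp add: M_def)
qed

text \<open>Every chain on faces avoiding \<open>w\<close> is, up to faces containing
  \<open>w\<close>, the boundary of its cone with apex \<open>w\<close>. Hence each rank is at least
  the number of faces of that size avoiding \<open>w\<close>. These faces are half of all faces, and
  \<open>total_betti_eq\<close> leaves 0.\<close>

theorem total_betti_cone:
  assumes "finite V" "w \<in> V" "link_verts V E w = V - {w}"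
  shows "total_betti K V E = 0"
proof -
  define M where "M = Suc (card V)"
  have "bd_rank K V E k \<ge> card (kfaces (V - {w}) E k)" for k
  proof -
    let ?A = "bd V ` chains K V E (Suc k)"
    define r where "r = (\<lambda>c :: nat set \<Rightarrow> 'a. \<lambda>\<tau>. if w \<in> \<tau> then 0 else c \<tau>)"
    have lin: "chain_linear r"
      by (rule chain_linearI) (auto simp: r_def chain_scale_def fun_eq_iff)
    have "cvs.dim ?A = cvs.dim {c\<in>?A. r c = 0} + cvs.dim (r ` ?A)"
      by (rule rank_nullity_supp_in[OF finite_kfaces[OF assms(1)] subspace_bd_image bd_image_supp[OF assms(1)] lin])
    moreover have "(supp_in (kfaces (V - {w}) E k) :: (nat set \<Rightarrow> 'a) set) \<subseteq> r ` ?A"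
    proof
      fix d :: "nat set \<Rightarrow> 'a" assume d: "d \<in> supp_in (kfaces (V - {w}) E k)"
      define c where "c = (\<lambda>\<sigma>. if w \<in> \<sigma> then esign (\<sigma> - {w}) w * d (\<sigma> - {w}) else 0)"
      have d0: "d \<tau> \<noteq> 0 \<Longrightarrow> \<tau> \<in> clique_faces (V - {w}) E \<and> card \<tau> = k" for \<tau>
        using d by (auto simp: supp_in_def kfaces_def)
      have "c \<in> chains K V E (Suc k)"
      proof -
        have "\<sigma> \<in> clique_faces V E \<and> card \<sigma> = Suc k" if "c \<sigma> \<noteq> 0" for \<sigma>
        proof -
          have w: "w \<in> \<sigma>" "d (\<sigma> - {w}) \<noteq> 0" using that by (auto simp: c_def split: if_splits)
          then have f: "\<sigma> - {w} \<in> clique_faces (V - {w}) E" "card (\<sigma> - {w}) = k" using d0 by auto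
          have "finite (\<sigma> - {w})" using f(1) assms(1)
            by (auto simp: clique_faces_def dest: finite_subset)
          then show ?thesis
            using f w clique_faces_insert[OF assms(2), of "\<sigma> - {w}" E] assms(3)
            by (metis DiffD2 card.insert insertI1 insert_Diff)
        qed
        then show ?thesis by (auto simp: chains_def)
      qed
      moreover have "r (bd V c) = d"
      proof
        fix \<tau>
        show "r (bd V c) \<tau> = d \<tau>"
        proof (cases "w \<in> \<tau>")
          case True
          then show ?thesis using d0[of \<tau>] by (auto simp: r_def clique_faces_def)
        next
          case False
          have "bd V c \<tau> = (\<Sum>v\<in>{w}. esign \<tau> v * c (insert v \<tau>))"
            unfolding bd_eq using assms False by (intro sum.mono_neutral_right) (auto simp: c_def)
          also have "\<dots> = d \<tau>" using False by (simp add: c_def flip: mult.assoc)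
          finally show ?thesis using False by (simp add: r_def)
        qed
      qed
      ultimately show "d \<in> r ` ?A" by blast
    qed
    moreover have "r ` ?A \<subseteq> supp_in (kfaces V E k)"
      using bd_image_supp[OF assms(1), of K E k] by (fastforce simp: r_def supp_in_def)
    ultimately show ?thesis
      using dim_mono_supp_in[OF finite_kfaces[OF assms(1), of E k], of "supp_in (kfaces (V - {w}) E k)" "r ` ?A"]
      by (simp add: bd_rank_def dim_supp_in finite_kfaces assms(1))
  qed
  then have "(\<Sum>k<M. int (bd_rank K V E k)) \<ge> (\<Sum>k<M. int (card (kfaces (V - {w}) E k)))"
    by (intro sum_mono) simp
  also have "(\<Sum>k<M. int (card (kfaces (V - {w}) E k))) = int (card (clique_faces (V - {w}) E))"
    using sum_card_kfaces[of "V - {w}" "card V" E] assms(1) card_mono[OF assms(1), of "V - {w}"]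
    by (simp add: M_def lessThan_Suc_atMost flip: of_nat_sum)
  finally show ?thesis
    using total_betti_eq[OF assms(1), of M K E] card_clique_faces_split[OF assms(1,2), of E] assms(3)
    by (simp add: M_def)
qed

lemma total_betti_empty: "total_betti K {} E = 1"
proof -
  have "clique_faces {} E = {{}}" by (auto simp: clique_faces_def)
  then show ?thesis using total_betti_eq[of "{}" 0 K E] by simp
qed

section \<open>Homology of joins\<close>

definition cobd :: "(nat set \<Rightarrow> 'k::field) \<Rightarrow> nat set \<Rightarrow> 'k" where
  "cobd p \<sigma> = (\<Sum>v\<in>\<sigma>. esign \<sigma> v * p (\<sigma> - {v}))"

text \<open>Cycles and cocycles dual to each other certify independent homology classes, and unlike a basis of
  the homology they can be multiplied over the two sides of a join.\<close>
definition dual_system ::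
  "'k::field itself \<Rightarrow> nat set \<Rightarrow> nat set set \<Rightarrow> 'i set \<Rightarrow> ('i \<Rightarrow> nat) \<Rightarrow>
     ('i \<Rightarrow> nat set \<Rightarrow> 'k) \<Rightarrow> ('i \<Rightarrow> nat set \<Rightarrow> 'k) \<Rightarrow> bool" where
  "dual_system K V E I dg z p \<longleftrightarrow> finite I \<and>
     (\<forall>i\<in>I. z i \<in> chains K V E (dg i) \<and> bd V (z i) = 0 \<and>
        p i \<in> chains K V E (dg i) \<and> (\<forall>\<sigma>\<in>clique_faces V E. cobd (p i) \<sigma> = 0)) \<and>
     (\<forall>i\<in>I. \<forall>j\<in>I. (\<Sum>\<sigma>\<in>clique_faces V E. p i \<sigma> * z j \<sigma>) = (if i = j then 1 else 0))"

lemma face_finite: "finite V \<Longrightarrow> \<sigma> \<in> clique_faces V E \<Longrightarrow> finite \<sigma>"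
  by (auto simp: clique_faces_def dest: finite_subset)

text \<open>Both sides sum over incidences of a face with one of its vertices; passing from \<tau>
  to \<open>insert v \<tau>\<close> matches them.\<close>

lemma bd_cobd_adjoint:
  assumes "finite V" "c \<in> chains K V E k"
  shows "(\<Sum>\<tau>\<in>clique_faces V E. p \<tau> * bd V c \<tau>) = (\<Sum>\<sigma>\<in>clique_faces V E. cobd p \<sigma> * c \<sigma>)"
proof -
  let ?X = "clique_faces V E"
  let ?A = "{(\<tau>, v). \<tau> \<in> ?X \<and> v \<in> V - \<tau> \<and> insert v \<tau> \<in> ?X}"
  let ?B = "{(\<sigma>, v). \<sigma> \<in> ?X \<and> v \<in> \<sigma>}"
  have fin: "finite ?X" by (simp add: finite_clique_faces assms)
  have "(\<Sum>\<tau>\<in>?X. p \<tau> * bd V c \<tau>)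
      = (\<Sum>\<tau>\<in>?X. \<Sum>v\<in>V - \<tau>. esign \<tau> v * p \<tau> * c (insert v \<tau>))"
    by (simp add: bd_eq sum_distrib_left mult_ac)
  also have "\<dots> = (\<Sum>(\<tau>, v)\<in>(SIGMA \<tau>:?X. V - \<tau>). esign \<tau> v * p \<tau> * c (insert v \<tau>))"
    using fin assms by (subst sum.Sigma) auto
  also have "\<dots> = (\<Sum>(\<tau>, v)\<in>?A. esign \<tau> v * p \<tau> * c (insert v \<tau>))"
  proof (rule sum.mono_neutral_right)
    show "finite (SIGMA \<tau>:?X. V - \<tau>)" using fin assms by auto
    show "\<forall>x\<in>(SIGMA \<tau>:?X. V - \<tau>) - ?A. (case x of (\<tau>, v) \<Rightarrow> esign \<tau> v * p \<tau> * c (insert v \<tau>)) = 0"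
      using assms(2) by (auto simp: chains_def)
  qed auto
  also have "\<dots> = (\<Sum>(\<sigma>, v)\<in>?B. esign \<sigma> v * p (\<sigma> - {v}) * c \<sigma>)"
  proof (rule sum.reindex_bij_witness[of _ "\<lambda>(\<sigma>, v). (\<sigma> - {v}, v)" "\<lambda>(\<tau>, v). (insert v \<tau>, v)"])
    fix a assume "a \<in> ?B"
    then show "(case a of (\<sigma>, v) \<Rightarrow> (\<sigma> - {v}, v)) \<in> ?A"
      by (auto simp: insert_absorb clique_faces_def)
  qed (auto simp: insert_absorb esign_self)
  also have "?B = (SIGMA \<sigma>:?X. \<sigma>)" by auto
  also have "(\<Sum>(\<sigma>, v)\<in>\<dots>. esign \<sigma> v * p (\<sigma> - {v}) * c \<sigma>)
      = (\<Sum>\<sigma>\<in>?X. \<Sum>v\<in>\<sigma>. esign \<sigma> v * p (\<sigma> - {v}) * c \<sigma>)"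
    using fin face_finite[OF assms(1)] by (subst sum.Sigma) auto
  finally show ?thesis by (simp add: cobd_def sum_distrib_right)
qed

text \<open>The cocycle \<open>p i\<close> annihilates all boundaries and all other cycles of the
  system, but not \<open>z i\<close>. So the cycles can be added to a basis of the boundaries one at
  a time without losing independence.\<close>

lemma card_dual_system_degree:
  assumes fin: "finite V" and ds: "dual_system K V E I dg z p"
  shows "card {i\<in>I. dg i = k} \<le> reduced_betti K V E k"
proof -
  let ?X = "clique_faces V E" and ?Z = "{c \<in> chains K V E k. bd V c = 0}" and ?B = "bd V ` chains K V E (Suc k)"
  let ?I = "{i\<in>I. dg i = k}"
  obtain Bs where Bs: "Bs \<subseteq> ?B" "cvs.independent Bs" "?B \<subseteq> cvs.span Bs" "card Bs = cvs.dim ?B"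
    by (rule cvs.basis_exists)
  have fB: "finite Bs"
  proof -
    have "Bs \<subseteq> cvs.span (unit_chain ` kfaces V E k)"
      using Bs(1) bd_image_supp[OF fin, of K E k] supp_in_span[OF finite_kfaces[OF fin, of E k]] by blast
    then show ?thesis
      using cvs.independent_span_bound[OF _ Bs(2)] finite_kfaces[OF fin] by blast
  qed
  have ann_B: "(\<Sum>\<sigma>\<in>?X. p i \<sigma> * b \<sigma>) = 0" if i: "i \<in> I" and b: "b \<in> Bs" for i b
  proof -
    obtain c where "c \<in> chains K V E (Suc k)" "b = bd V c" using b Bs(1) by blast
    then show ?thesis
      using bd_cobd_adjoint[OF fin, of c K E "Suc k" "p i"] ds i by (simp add: dual_system_def)
  qed
  have main: "cvs.independent (Bs \<union> z ` J) \<and> card (Bs \<union> z ` J) = card Bs + card J"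
    if "finite J" "J \<subseteq> ?I" for J
    using that
  proof (induction J rule: finite_induct)
    case empty
    then show ?case using Bs by simp
  next
    case (insert i J)
    let ?S = "{w. (\<Sum>\<sigma>\<in>?X. p i \<sigma> * w \<sigma>) = 0}"
    have i: "i \<in> I" using insert by auto
    have "cvs.subspace ?S"
    proof (rule cvs.subspaceI)
      fix c x assume "x \<in> ?S"
      moreover have "(\<Sum>\<sigma>\<in>?X. p i \<sigma> * (c * x \<sigma>)) = c * (\<Sum>\<sigma>\<in>?X. p i \<sigma> * x \<sigma>)"
        by (simp add: sum_distrib_left mult.left_commute)
      ultimately show "chain_scale c x \<in> ?S" by (simp add: chain_scale_def)
    qed (auto simp: distrib_left sum.distrib)
    moreover have "Bs \<union> z ` J \<subseteq> ?S"
    proof -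
      have "(\<Sum>\<sigma>\<in>?X. p i \<sigma> * z j \<sigma>) = 0" if "j \<in> J" for j
      proof -
        have "j \<in> I" "i \<noteq> j" using that insert by auto
        then show ?thesis using ds i by (auto simp: dual_system_def)
      qed
      then show ?thesis using ann_B[OF i] by auto
    qed
    ultimately have "cvs.span (Bs \<union> z ` J) \<subseteq> ?S" using cvs.span_minimal by blast
    moreover have "z i \<notin> ?S" using ds i by (simp add: dual_system_def)
    ultimately have n: "z i \<notin> cvs.span (Bs \<union> z ` J)" by blast
    have IH: "cvs.independent (Bs \<union> z ` J)" "card (Bs \<union> z ` J) = card Bs + card J"
      using insert by auto
    have "z i \<notin> Bs \<union> z ` J" by (rule contra_subsetD[OF cvs.span_superset n])
    then show ?case
      using cvs.independent_insertI[OF n IH(1)] IH(2) insert(1,2) fB by simp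
  qed
  have fI: "finite ?I" using ds by (simp add: dual_system_def)
  have "Bs \<union> z ` ?I \<subseteq> ?Z"
  proof (rule Un_least)
    have "?B \<subseteq> ?Z" using bd_chains[OF fin] bd_bd[OF fin] by blast
    with Bs(1) show "Bs \<subseteq> ?Z" by (rule order_trans)
    show "z ` ?I \<subseteq> ?Z" using ds by (auto simp: dual_system_def)
  qed
  then have "cvs.dim (Bs \<union> z ` ?I) \<le> cvs.dim ?Z"
    by (rule dim_mono_supp_in[OF finite_kfaces[OF fin, of E k]]) (auto simp: chains_eq)
  then have "card Bs + card ?I \<le> cvs.dim ?Z"
    using main[OF fI order_refl] cvs.dim_eq_card_independent[of "Bs \<union> z ` ?I"] by simp
  then show ?thesis by (simp add: reduced_betti_def Bs(4))
qed

theorem card_dual_system: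
  assumes fin: "finite V" and ds: "dual_system K V E I dg z p"
  shows "card I \<le> total_betti K V E"
proof -
  have "dg i \<le> card V" if "i \<in> I" for i
  proof -
    have "(\<Sum>\<sigma>\<in>clique_faces V E. p i \<sigma> * z i \<sigma>) \<noteq> 0" using ds that by (simp add: dual_system_def)
    then obtain \<sigma> where "z i \<sigma> \<noteq> 0" by (metis (no_types, lifting) mult_zero_right sum.neutral)
    then have "\<sigma> \<subseteq> V" "card \<sigma> = dg i"
      using ds that by (auto simp: dual_system_def chains_def clique_faces_def)
    then show ?thesis using card_mono[OF fin] by metis
  qed
  then have "I = (\<Union>k\<in>{..card V}. {i\<in>I. dg i = k})" by auto
  then have "card I \<le> (\<Sum>k\<le>card V. card {i\<in>I. dg i = k})"
    using card_UN_le[of "{..card V}" "\<lambda>k. {i\<in>I. dg i = k}"] by simp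
  also have "\<dots> \<le> total_betti K V E"
    unfolding total_betti_def by (intro sum_mono card_dual_system_degree[OF fin ds])
  finally show ?thesis .
qed

text \<open>A basis of the boundaries is extended to a basis \<open>D\<close> of the cycles. The
  added elements represent homology, and the coordinate functionals on \<open>D\<close>, extended to
  all chains, are the dual cocycles; they are closed because they vanish on boundaries.\<close>

lemma dual_basis_degree:
  fixes K :: "'k::field itself"
  assumes fin: "finite V"
  shows "\<exists>C (p :: (nat set \<Rightarrow> 'k) \<Rightarrow> nat set \<Rightarrow> 'k). finite C \<and> card C = reduced_betti K V E k \<and>
     (\<forall>c\<in>C. c \<in> chains K V E k \<and> bd V c = 0 \<and> p c \<in> chains K V E k \<and>
        (\<forall>\<sigma>\<in>clique_faces V E. cobd (p c) \<sigma> = 0)) \<and>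
     (\<forall>c\<in>C. \<forall>d\<in>C. (\<Sum>\<sigma>\<in>clique_faces V E. p c \<sigma> * d \<sigma>) = (if c = d then 1 else 0))"
proof -
  let ?X = "clique_faces V E" and ?Z = "{c \<in> chains K V E k. bd V c = 0}" and ?B = "bd V ` chains K V E (Suc k)"
  interpret fn: vector_space_pair "chain_scale :: 'k \<Rightarrow> _" "(*) :: 'k \<Rightarrow> 'k \<Rightarrow> 'k"
    by unfold_locales (auto simp: algebra_simps)
  obtain Bs where Bs: "Bs \<subseteq> ?B" "cvs.independent Bs" "?B \<subseteq> cvs.span Bs" "card Bs = cvs.dim ?B"
    by (rule cvs.basis_exists)
  have BZ: "?B \<subseteq> ?Z" using bd_chains[OF fin] bd_bd[OF fin] by blast
  obtain D where D: "Bs \<subseteq> D" "D \<subseteq> ?Z" "cvs.independent D" "?Z \<subseteq> cvs.span D"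
    by (rule cvs.maximal_independent_subset_extend[OF order_trans[OF Bs(1) BZ] Bs(2)])
  have fD: "finite D"
  proof -
    have "D \<subseteq> cvs.span (unit_chain ` kfaces V E k)"
      using D(2) supp_in_span[OF finite_kfaces[OF fin, of E k]] by (auto simp: chains_eq)
    then show ?thesis
      using cvs.independent_span_bound[OF _ D(3)] finite_kfaces[OF fin] by blast
  qed
  have "card D = cvs.dim ?Z" using cvs.basis_card_eq_dim[OF D(2,4,3)] .
  then have cC: "card (D - Bs) = reduced_betti K V E k"
    using Bs(4) D(1) fD by (simp add: reduced_betti_def card_Diff_subset finite_subset)
  have "\<exists>g. Vector_Spaces.linear (chain_scale :: 'k \<Rightarrow> _) ((*) :: 'k \<Rightarrow> 'k \<Rightarrow> 'k) g \<and>
      (\<forall>d\<in>D. g d = (if d = c then 1 else 0))" for c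
    using fn.linear_independent_extend[OF D(3), of "\<lambda>d. if d = c then 1 else 0"] by blast
  then obtain g where g: "\<And>c. Vector_Spaces.linear (chain_scale :: 'k \<Rightarrow> _) ((*) :: 'k \<Rightarrow> 'k \<Rightarrow> 'k) (g c)"
    "\<And>c d. d \<in> D \<Longrightarrow> g c d = (if d = c then 1 else 0)" by metis
  \<comment> \<open>A functional on chains becomes a cochain through its values on single
    faces.\<close>
  define p where "p c \<sigma> = (if \<sigma> \<in> kfaces V E k then g c (unit_chain \<sigma>) else 0)" for c \<sigma>
  have gp: "g c w = (\<Sum>\<sigma>\<in>?X. p c \<sigma> * w \<sigma>)" if "w \<in> chains K V E k" for c w
  proof -
    have "w = (\<Sum>\<sigma>\<in>kfaces V E k. chain_scale (w \<sigma>) (unit_chain \<sigma>))"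
      using supp_in_expand[OF finite_kfaces[OF fin]] that by (auto simp: chains_eq)
    then have "g c w = g c (\<Sum>\<sigma>\<in>kfaces V E k. chain_scale (w \<sigma>) (unit_chain \<sigma>))" by simp
    also have "\<dots> = (\<Sum>\<sigma>\<in>kfaces V E k. w \<sigma> * g c (unit_chain \<sigma>))"
      by (simp add: fn.linear_sum[OF g(1)] fn.linear_scale[OF g(1)])
    also have "\<dots> = (\<Sum>\<sigma>\<in>?X. p c \<sigma> * w \<sigma>)"
      by (rule sum.mono_neutral_cong_left)
        (auto simp: finite_clique_faces fin p_def kfaces_def)
    finally show ?thesis .
  qed
  have co: "cobd (p c) \<sigma> = 0" if c: "c \<in> D - Bs" and s: "\<sigma> \<in> ?X" for c \<sigma>
  proof (cases "card \<sigma> = Suc k")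
    case False
    have "\<sigma> - {v} \<notin> kfaces V E k" if "v \<in> \<sigma>" for v
      using that False card_Suc_Diff1[OF face_finite[OF fin s] that] by (auto simp: kfaces_def)
    then show ?thesis by (auto simp: cobd_def p_def intro!: sum.neutral)
  next
    case True
    let ?u = "unit_chain \<sigma> :: nat set \<Rightarrow> 'k"
    have u: "?u \<in> chains K V E (Suc k)"
      using s True by (auto simp: chains_eq kfaces_def intro: unit_chain_in_supp)
    have "cobd (p c) \<sigma> = (\<Sum>\<tau>\<in>?X. cobd (p c) \<tau> * ?u \<tau>)"
      using s finite_clique_faces[OF fin, of E] by (simp add: unit_chain_def if_distrib cong: if_cong)
    also have "\<dots> = g c (bd V ?u)"
      using bd_cobd_adjoint[OF fin u, of "p c"] gp[OF bd_chains[OF fin u]] by simp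
    also have "\<dots> = 0"
    proof -
      have "bd V ?u \<in> cvs.span Bs" using Bs(3) u by blast
      moreover have "g c b = 0" if "b \<in> Bs" for b using g(2)[of b c] that D(1) c by auto
      ultimately show ?thesis using fn.linear_eq_0_on_span[OF g(1)] by blast
    qed
    finally show ?thesis .
  qed
  have pair: "(\<Sum>\<sigma>\<in>?X. p c \<sigma> * d \<sigma>) = (if c = d then 1 else 0)" if "c \<in> D - Bs" "d \<in> D - Bs" for c d
    using gp[of d c] g(2)[of d c] that D(2) by auto
  have pc: "p c \<in> chains K V E k" for c by (auto simp: chains_eq supp_in_def p_def)
  show ?thesis
    by (rule exI[of _ "D - Bs"], rule exI[of _ p]) (use cC fD D(2) co pair pc in auto)
qed

text \<open>The systems of all degrees are put together. Chains of different degrees have disjoint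
  supports, so they pair to zero.\<close>

theorem dual_system_exists:
  fixes K :: "'k::field itself"
  assumes fin: "finite V"
  shows "\<exists>I dg z p. dual_system K V E (I :: (nat \<times> (nat set \<Rightarrow> 'k)) set) dg z p \<and> card I = total_betti K V E"
proof -
  define P where "P k C p \<longleftrightarrow> finite C \<and> card C = reduced_betti K V E k \<and>
     (\<forall>c\<in>C. c \<in> chains K V E k \<and> bd V c = 0 \<and> p c \<in> chains K V E k \<and>
        (\<forall>\<sigma>\<in>clique_faces V E. cobd (p c) \<sigma> = 0)) \<and>
     (\<forall>c\<in>C. \<forall>d\<in>C. (\<Sum>\<sigma>\<in>clique_faces V E. p c \<sigma> * d \<sigma>) = (if c = d then 1 else 0))"
    for k C and p :: "(nat set \<Rightarrow> 'k) \<Rightarrow> nat set \<Rightarrow> 'k"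
  have "\<exists>C p. P k C p" for k
    unfolding P_def by (rule dual_basis_degree[OF fin])
  then obtain C p where Pk: "\<And>k. P k (C k) (p k)" by metis
  have C: "finite (C k)" "card (C k) = reduced_betti K V E k"
    "c \<in> C k \<Longrightarrow> c \<in> chains K V E k \<and> bd V c = 0 \<and> p k c \<in> chains K V E k \<and>
        (\<forall>\<sigma>\<in>clique_faces V E. cobd (p k c) \<sigma> = 0)"
    "c \<in> C k \<Longrightarrow> d \<in> C k \<Longrightarrow>
        (\<Sum>\<sigma>\<in>clique_faces V E. p k c \<sigma> * d \<sigma>) = (if c = d then 1 else 0)" for k c d
    using Pk[of k] unfolding P_def by simp_all
  let ?I = "SIGMA k:{..card V}. C k"
  have "dual_system K V E ?I fst snd (\<lambda>(k, c). p k c)"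
    unfolding dual_system_def
  proof (intro conjI ballI)
    fix i j assume i: "i \<in> ?I" and j: "j \<in> ?I"
    obtain k c where ic: "i = (k, c)" "c \<in> C k" using i by auto
    obtain l d where jd: "j = (l, d)" "d \<in> C l" using j by auto
    show "(\<Sum>\<sigma>\<in>clique_faces V E. (case i of (k, c) \<Rightarrow> p k c) \<sigma> * snd j \<sigma>) = (if i = j then 1 else 0)"
    proof (cases "k = l")
      case True
      then show ?thesis using C(4)[of c k d] ic jd by auto
    next
      case False
      have "p k c \<sigma> * d \<sigma> = 0" for \<sigma>
        using C(3)[OF ic(2)] C(3)[OF jd(2)] False by (auto simp: chains_def)
      then show ?thesis using ic jd False by (simp only: split fst_conv snd_conv sum.neutral_const) auto
    qed
  qed (use C in auto)
  moreover have "card ?I = total_betti K V E"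
    by (subst card_SigmaI) (auto simp: C total_betti_def)
  ultimately show ?thesis by blast
qed

text \<open>The signs depend on the vertex order, so an order-preserving relabelling carries chains
  over without sign changes. The inequality comes from transporting a dual system.\<close>

lemma total_betti_relabel:
  assumes fin: "finite V" and mono: "\<And>u v. u \<in> V \<Longrightarrow> v \<in> V \<Longrightarrow> u < v \<Longrightarrow> g u < (g v :: nat)"
    and E': "\<And>u v. u \<in> V \<Longrightarrow> v \<in> V \<Longrightarrow> {g u, g v} \<in> E' \<longleftrightarrow> {u, v} \<in> E"
  shows "total_betti K V E \<le> total_betti K (g ` V) E'"
proof -
  have inj: "inj_on g V" using mono by (metis inj_onI linorder_neqE_nat less_irrefl)
  have less_iff: "g u < g v \<longleftrightarrow> u < v" if "u \<in> V" "v \<in> V" for u v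
    using mono that by (metis linorder_neqE_nat less_asym less_irrefl)
  define h where "h = inv_into V g"
  have hg: "h (g v) = v" if "v \<in> V" for v using inj that by (simp add: h_def)
  have hi: "h ` g ` \<sigma> = \<sigma>" if "\<sigma> \<subseteq> V" for \<sigma> using hg that by (force simp: image_image)
  have cf: "clique_faces (g ` V) E' = (`) g ` clique_faces V E"
  proof (intro equalityI subsetI)
    fix \<tau> assume t: "\<tau> \<in> clique_faces (g ` V) E'"
    then obtain \<sigma> where s: "\<sigma> \<subseteq> V" "\<tau> = g ` \<sigma>" by (auto simp: clique_faces_def subset_image_iff)
    have "\<sigma> \<in> clique_faces V E"
      unfolding clique_faces_def
    proof (intro CollectI conjI ballI impI s(1))
      fix x y assume "x \<in> \<sigma>" "y \<in> \<sigma>" "x \<noteq> y"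
      moreover from this have "g x \<noteq> g y" using inj s(1) by (auto dest: inj_onD)
      ultimately show "{x, y} \<in> E" using t s E'[of x y] by (auto simp: clique_faces_def)
    qed
    then show "\<tau> \<in> (`) g ` clique_faces V E" using s by blast
  next
    fix \<tau> assume "\<tau> \<in> (`) g ` clique_faces V E"
    then obtain \<sigma> where s: "\<sigma> \<in> clique_faces V E" "\<tau> = g ` \<sigma>" by (rule imageE)
    then have sV: "\<sigma> \<subseteq> V" by (simp add: clique_faces_def)
    show "\<tau> \<in> clique_faces (g ` V) E'"
      unfolding clique_faces_def s(2)
    proof (intro CollectI conjI ballI impI image_mono sV)
      fix x y assume "x \<in> g ` \<sigma>" "y \<in> g ` \<sigma>" "x \<noteq> y"
      then obtain u v where "u \<in> \<sigma>" "v \<in> \<sigma>" "x = g u" "y = g v" "u \<noteq> v" by auto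
      then show "{x, y} \<in> E'" using E'[of u v] s(1) sV by (auto simp: clique_faces_def)
    qed
  qed
  have es: "esign (g ` \<tau>) (g v) = (esign \<tau> v :: 'a)" if "\<tau> \<subseteq> V" "v \<in> V" for \<tau> v
  proof -
    have "{u \<in> g ` \<tau>. u < g v} = g ` {u \<in> \<tau>. u < v}" using less_iff that by auto
    moreover have "inj_on g {u \<in> \<tau>. u < v}" using inj that(1) by (auto intro: inj_on_subset)
    ultimately show ?thesis by (simp add: esign_def card_image)
  qed
  obtain I dg z p where ds: "dual_system K V E (I :: (nat \<times> (nat set \<Rightarrow> 'a)) set) dg z p"
    and cI: "card I = total_betti K V E"
    using dual_system_exists[OF fin, of K E] by blast
  define L where "L c \<sigma> = (if \<sigma> \<subseteq> g ` V then c (h ` \<sigma>) else 0)" for c :: "nat set \<Rightarrow> 'a" and \<sigma>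
  have Lg: "L c (g ` \<sigma>) = c \<sigma>" if "\<sigma> \<subseteq> V" for c \<sigma>
    using that hi[OF that] by (auto simp: L_def)
  have Lch: "L c \<in> chains K (g ` V) E' k" if "c \<in> chains K V E k" for c k
  proof -
    have "\<sigma> \<in> clique_faces (g ` V) E' \<and> card \<sigma> = k" if nz: "L c \<sigma> \<noteq> 0" for \<sigma>
    proof -
      obtain \<tau> where t: "\<tau> \<subseteq> V" "\<sigma> = g ` \<tau>" using nz by (auto simp: L_def subset_image_iff split: if_splits)
      then have "c \<tau> \<noteq> 0" using nz Lg by simp
      then have "\<tau> \<in> clique_faces V E" "card \<tau> = k" using \<open>c \<in> chains K V E k\<close> by (auto simp: chains_def)
      then show ?thesis using t cf inj by (auto simp: card_image inj_on_subset)
    qed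
    then show ?thesis by (auto simp: chains_def)
  qed
  have Lbd: "bd (g ` V) (L c) = 0" if "bd V c = 0" for c
  proof
    fix \<tau>
    show "bd (g ` V) (L c) \<tau> = 0 \<tau>"
    proof (cases "\<tau> \<subseteq> g ` V")
      case False
      then show ?thesis by (auto simp: bd_eq L_def intro!: sum.neutral)
    next
      case True
      then obtain \<sigma> where s: "\<sigma> \<subseteq> V" "\<tau> = g ` \<sigma>" by (auto simp: subset_image_iff)
      have "g ` V - \<tau> = g ` (V - \<sigma>)" using s inj by (auto dest: inj_onD)
      then have "bd (g ` V) (L c) \<tau> = (\<Sum>v\<in>V - \<sigma>. esign \<tau> (g v) * L c (insert (g v) \<tau>))"
        unfolding bd_eq using inj by (simp add: sum.reindex inj_on_subset[OF inj])
      also have "\<dots> = (\<Sum>v\<in>V - \<sigma>. esign \<sigma> v * c (insert v \<sigma>))"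
      proof (intro sum.cong refl)
        fix v assume v: "v \<in> V - \<sigma>"
        show "esign \<tau> (g v) * L c (insert (g v) \<tau>) = esign \<sigma> v * c (insert v \<sigma>)"
          using es[OF s(1), of v] Lg[of "insert v \<sigma>" c] s v by simp
      qed
      also have "\<dots> = bd V c \<sigma>" by (simp add: bd_eq)
      finally show ?thesis using that by simp
    qed
  qed
  have Lco: "cobd (L q) (g ` \<sigma>) = cobd q \<sigma>" if "\<sigma> \<subseteq> V" for q \<sigma>
  proof -
    have "cobd (L q) (g ` \<sigma>) = (\<Sum>v\<in>\<sigma>. esign (g ` \<sigma>) (g v) * L q (g ` \<sigma> - {g v}))"
      unfolding cobd_def using inj_on_subset[OF inj that] by (simp add: sum.reindex)
    also have "\<dots> = cobd q \<sigma>"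
      unfolding cobd_def
    proof (intro sum.cong refl)
      fix v assume v: "v \<in> \<sigma>"
      have "g ` \<sigma> - {g v} = g ` (\<sigma> - {v})" using v that inj by (auto dest: inj_onD)
      then show "esign (g ` \<sigma>) (g v) * L q (g ` \<sigma> - {g v}) = esign \<sigma> v * q (\<sigma> - {v})"
        using es[OF that subsetD[OF that v]] Lg[OF order_trans[OF Diff_subset that], of q "{v}"] by simp
    qed
    finally show ?thesis .
  qed
  have fs: "\<sigma> \<subseteq> V" if "\<sigma> \<in> clique_faces V E" for \<sigma> using that by (auto simp: clique_faces_def)
  have injim: "inj_on ((`) g) (clique_faces V E)"
    using hi fs by (metis inj_onI)
  have "dual_system K (g ` V) E' I dg (\<lambda>i. L (z i)) (\<lambda>i. L (p i))"
    unfolding dual_system_def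
  proof (intro conjI ballI)
    fix i j assume ij: "i \<in> I" "j \<in> I"
    have "(\<Sum>\<sigma>\<in>clique_faces (g ` V) E'. L (p i) \<sigma> * L (z j) \<sigma>) = (\<Sum>\<sigma>\<in>clique_faces V E. p i \<sigma> * z j \<sigma>)"
      unfolding cf sum.reindex[OF injim] by (intro sum.cong) (auto simp: Lg fs)
    then show "(\<Sum>\<sigma>\<in>clique_faces (g ` V) E'. L (p i) \<sigma> * L (z j) \<sigma>) = (if i = j then 1 else 0)"
      using ds ij by (simp add: dual_system_def)
  qed (use ds Lch Lbd Lco fs cf in \<open>auto simp: dual_system_def\<close>)
  then have "card I \<le> total_betti K (g ` V) E'" using card_dual_system fin by blast
  then show ?thesis using cI by simp
qed

text \<open>One half of the Kuenneth formula: products of cycles are cycles, products of cocycles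
  are cocycles, and the pairing is multiplicative, so two dual systems multiply. Placing
  \<open>V1\<close> below \<open>V2\<close> reduces all signs to the sign of the Leibniz
  rule.\<close>

theorem total_betti_join:
  assumes fin: "finite V1" "finite V2" and less: "\<And>u v. u \<in> V1 \<Longrightarrow> v \<in> V2 \<Longrightarrow> u < v"
    and E: "\<And>u v. u \<in> V1 \<Longrightarrow> v \<in> V2 \<Longrightarrow> {u, v} \<in> E"
  shows "total_betti K V1 E * total_betti K V2 E \<le> total_betti K (V1 \<union> V2) E"
proof -
  let ?V = "V1 \<union> V2"
  have disj: "V1 \<inter> V2 = {}" using less by blast
  have cf: "\<sigma> \<in> clique_faces ?V E \<longleftrightarrow> \<sigma> \<subseteq> ?V \<and> \<sigma> \<inter> V1 \<in> clique_faces V1 E \<and> \<sigma> \<inter> V2 \<in> clique_faces V2 E" for \<sigma>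
  proof (intro iffI conjI; (elim conjE)?)
    assume s: "\<sigma> \<subseteq> ?V" "\<sigma> \<inter> V1 \<in> clique_faces V1 E" "\<sigma> \<inter> V2 \<in> clique_faces V2 E"
    show "\<sigma> \<in> clique_faces ?V E"
      unfolding clique_faces_def
    proof (intro CollectI conjI ballI impI s(1))
      fix x y assume xy: "x \<in> \<sigma>" "y \<in> \<sigma>" "x \<noteq> y"
      consider "x \<in> V1" "y \<in> V1" | "x \<in> V2" "y \<in> V2" | "x \<in> V1" "y \<in> V2" | "x \<in> V2" "y \<in> V1"
        using xy s(1) by blast
      then show "{x, y} \<in> E"
        using s(2,3) xy E[of x y] E[of y x] by cases (auto simp: clique_faces_def insert_commute)
    qed
  qed (auto simp: clique_faces_def)
  obtain I dg z p where ds: "dual_system K V1 E (I :: (nat \<times> (nat set \<Rightarrow> 'a)) set) dg z p"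
    and cI: "card I = total_betti K V1 E"
    using dual_system_exists[OF fin(1), of K E] by blast
  obtain J dh w q where dt: "dual_system K V2 E (J :: (nat \<times> (nat set \<Rightarrow> 'a)) set) dh w q"
    and cJ: "card J = total_betti K V2 E"
    using dual_system_exists[OF fin(2), of K E] by blast
  \<comment> \<open>The guard is needed because the traces on \<open>V1\<close> and
    \<open>V2\<close> do not see vertices outside their union.\<close>
  define X where "X a b \<sigma> = (if \<sigma> \<subseteq> ?V then a (\<sigma> \<inter> V1) * b (\<sigma> \<inter> V2) else 0)"
    for a b :: "nat set \<Rightarrow> 'a" and \<sigma>
  have es1: "esign \<tau> v = (esign (\<tau> \<inter> V1) v :: 'a)" if "\<tau> \<subseteq> ?V" "v \<in> V1" for \<tau> v
  proof -
    have "{u\<in>\<tau>. u < v} = {u\<in>\<tau> \<inter> V1. u < v}" using that less by (auto dest: less_asym)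
    then show ?thesis by (simp add: esign_def)
  qed
  have es2: "esign \<tau> v = (-1) ^ card (\<tau> \<inter> V1) * (esign (\<tau> \<inter> V2) v :: 'a)" if "\<tau> \<subseteq> ?V" "v \<in> V2" for \<tau> v
  proof -
    have "{u\<in>\<tau>. u < v} = (\<tau> \<inter> V1) \<union> {u\<in>\<tau> \<inter> V2. u < v}" using that less by auto
    moreover have "card ((\<tau> \<inter> V1) \<union> {u\<in>\<tau> \<inter> V2. u < v}) = card (\<tau> \<inter> V1) + card {u\<in>\<tau> \<inter> V2. u < v}"
      using fin disj by (intro card_Un_disjoint) (auto intro: finite_subset[of _ V2])
    ultimately show ?thesis by (simp add: esign_def power_add)
  qed
  have Xch: "X a b \<in> chains K ?V E (k + l)" if a: "a \<in> chains K V1 E k" and b: "b \<in> chains K V2 E l" for a b k l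
  proof -
    have "\<sigma> \<in> clique_faces ?V E \<and> card \<sigma> = k + l" if nz: "X a b \<sigma> \<noteq> 0" for \<sigma>
    proof -
      have s: "\<sigma> \<subseteq> ?V" "a (\<sigma> \<inter> V1) \<noteq> 0" "b (\<sigma> \<inter> V2) \<noteq> 0" using nz by (auto simp: X_def split: if_splits)
      have f: "\<sigma> \<inter> V1 \<in> clique_faces V1 E" "\<sigma> \<inter> V2 \<in> clique_faces V2 E" "card (\<sigma> \<inter> V1) = k" "card (\<sigma> \<inter> V2) = l"
        using a b s by (auto simp: chains_def)
      have "\<sigma> = (\<sigma> \<inter> V1) \<union> (\<sigma> \<inter> V2)" using s(1) by blast
      moreover have "card ((\<sigma> \<inter> V1) \<union> (\<sigma> \<inter> V2)) = card (\<sigma> \<inter> V1) + card (\<sigma> \<inter> V2)"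
        using fin disj by (intro card_Un_disjoint) auto
      ultimately show ?thesis using f s(1) cf by simp
    qed
    then show ?thesis by (auto simp: chains_def)
  qed
  have Xbd: "bd ?V (X a b) = 0" if a: "bd V1 a = 0" and b: "bd V2 b = 0" for a b
  proof
    fix \<tau>
    show "bd ?V (X a b) \<tau> = 0 \<tau>"
    proof (cases "\<tau> \<subseteq> ?V")
      case False
      then show ?thesis by (auto simp: bd_eq X_def intro!: sum.neutral)
    next
      case True
      let ?t1 = "\<tau> \<inter> V1" and ?t2 = "\<tau> \<inter> V2"
      have "bd ?V (X a b) \<tau> = (\<Sum>v\<in>(V1 - ?t1) \<union> (V2 - ?t2). esign \<tau> v * X a b (insert v \<tau>))"
        unfolding bd_eq using disj by (intro sum.cong) auto
      also have "\<dots> = (\<Sum>v\<in>V1 - ?t1. esign \<tau> v * X a b (insert v \<tau>)) + (\<Sum>v\<in>V2 - ?t2. esign \<tau> v * X a b (insert v \<tau>))"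
        using fin disj by (intro sum.union_disjoint) auto
      also have "(\<Sum>v\<in>V1 - ?t1. esign \<tau> v * X a b (insert v \<tau>)) = (\<Sum>v\<in>V1 - ?t1. esign ?t1 v * a (insert v ?t1) * b ?t2)"
      proof (intro sum.cong refl)
        fix v assume v: "v \<in> V1 - ?t1"
        then have "insert v \<tau> \<inter> V1 = insert v ?t1" "insert v \<tau> \<inter> V2 = ?t2" using disj by auto
        then show "esign \<tau> v * X a b (insert v \<tau>) = esign ?t1 v * a (insert v ?t1) * b ?t2"
          using es1[OF True, of v] v True by (simp add: X_def)
      qed
      also have "\<dots> = bd V1 a ?t1 * b ?t2" by (simp add: bd_eq sum_distrib_right)
      also have "(\<Sum>v\<in>V2 - ?t2. esign \<tau> v * X a b (insert v \<tau>))
          = (\<Sum>v\<in>V2 - ?t2. (-1) ^ card ?t1 * a ?t1 * (esign ?t2 v * b (insert v ?t2)))"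
      proof (intro sum.cong refl)
        fix v assume v: "v \<in> V2 - ?t2"
        then have "insert v \<tau> \<inter> V2 = insert v ?t2" "insert v \<tau> \<inter> V1 = ?t1" using disj by auto
        then show "esign \<tau> v * X a b (insert v \<tau>) = (-1) ^ card ?t1 * a ?t1 * (esign ?t2 v * b (insert v ?t2))"
          using es2[OF True, of v] v True by (simp add: X_def)
      qed
      also have "\<dots> = (-1) ^ card ?t1 * a ?t1 * bd V2 b ?t2" by (simp add: bd_eq sum_distrib_left)
      finally show ?thesis using a b by simp
    qed
  qed
  have Xco: "cobd (X a b) \<sigma> = 0"
    if a: "\<forall>\<sigma>\<in>clique_faces V1 E. cobd a \<sigma> = 0" and b: "\<forall>\<sigma>\<in>clique_faces V2 E. cobd b \<sigma> = 0"
      and s: "\<sigma> \<in> clique_faces ?V E" for a b \<sigma>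
  proof -
    let ?s1 = "\<sigma> \<inter> V1" and ?s2 = "\<sigma> \<inter> V2"
    have sV: "\<sigma> \<subseteq> ?V" "?s1 \<in> clique_faces V1 E" "?s2 \<in> clique_faces V2 E" using s cf by auto
    have "cobd (X a b) \<sigma> = (\<Sum>v\<in>?s1 \<union> ?s2. esign \<sigma> v * X a b (\<sigma> - {v}))"
      unfolding cobd_def using sV by (intro sum.cong) auto
    also have "\<dots> = (\<Sum>v\<in>?s1. esign \<sigma> v * X a b (\<sigma> - {v})) + (\<Sum>v\<in>?s2. esign \<sigma> v * X a b (\<sigma> - {v}))"
      using fin disj by (intro sum.union_disjoint) auto
    also have "(\<Sum>v\<in>?s1. esign \<sigma> v * X a b (\<sigma> - {v})) = (\<Sum>v\<in>?s1. esign ?s1 v * a (?s1 - {v}) * b ?s2)"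
    proof (intro sum.cong refl)
      fix v assume v: "v \<in> ?s1"
      then have "(\<sigma> - {v}) \<inter> V1 = ?s1 - {v}" "(\<sigma> - {v}) \<inter> V2 = ?s2" using disj by auto
      then show "esign \<sigma> v * X a b (\<sigma> - {v}) = esign ?s1 v * a (?s1 - {v}) * b ?s2"
        using es1[OF sV(1), of v] v sV(1) by (auto simp: X_def)
    qed
    also have "\<dots> = cobd a ?s1 * b ?s2" by (simp add: cobd_def sum_distrib_right)
    also have "(\<Sum>v\<in>?s2. esign \<sigma> v * X a b (\<sigma> - {v}))
        = (\<Sum>v\<in>?s2. (-1) ^ card ?s1 * a ?s1 * (esign ?s2 v * b (?s2 - {v})))"
    proof (intro sum.cong refl)
      fix v assume v: "v \<in> ?s2"
      then have "(\<sigma> - {v}) \<inter> V1 = ?s1" "(\<sigma> - {v}) \<inter> V2 = ?s2 - {v}" using disj by auto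
      then show "esign \<sigma> v * X a b (\<sigma> - {v}) = (-1) ^ card ?s1 * a ?s1 * (esign ?s2 v * b (?s2 - {v}))"
        using es2[OF sV(1), of v] v sV(1) by (auto simp: X_def)
    qed
    also have "\<dots> = (-1) ^ card ?s1 * a ?s1 * cobd b ?s2" by (simp add: cobd_def sum_distrib_left)
    finally show ?thesis using a b sV by simp
  qed
  have Xpair: "(\<Sum>\<sigma>\<in>clique_faces ?V E. X a b \<sigma> * X c d \<sigma>)
      = (\<Sum>\<sigma>\<in>clique_faces V1 E. a \<sigma> * c \<sigma>) * (\<Sum>\<sigma>\<in>clique_faces V2 E. b \<sigma> * d \<sigma>)" for a b c d
  proof -
    have "(\<Sum>\<sigma>\<in>clique_faces V1 E. a \<sigma> * c \<sigma>) * (\<Sum>\<sigma>\<in>clique_faces V2 E. b \<sigma> * d \<sigma>)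
       = (\<Sum>(s, t)\<in>clique_faces V1 E \<times> clique_faces V2 E. (a s * c s) * (b t * d t))"
      by (simp add: sum_product sum.cartesian_product)
    also have "\<dots> = (\<Sum>\<sigma>\<in>clique_faces ?V E. X a b \<sigma> * X c d \<sigma>)"
    proof (rule sum.reindex_bij_witness[of _ "\<lambda>\<sigma>. (\<sigma> \<inter> V1, \<sigma> \<inter> V2)" "\<lambda>(s, t). s \<union> t"])
      fix st assume "st \<in> clique_faces V1 E \<times> clique_faces V2 E"
      then obtain s t where st: "st = (s, t)" "s \<in> clique_faces V1 E" "t \<in> clique_faces V2 E" by auto
      then have sub: "s \<subseteq> V1" "t \<subseteq> V2" by (auto simp: clique_faces_def)
      then have i: "(s \<union> t) \<inter> V1 = s" "(s \<union> t) \<inter> V2 = t" using disj by auto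
      show "(case st of (s, t) \<Rightarrow> s \<union> t) \<in> clique_faces ?V E" using st i cf sub by auto
      show "(\<lambda>\<sigma>. (\<sigma> \<inter> V1, \<sigma> \<inter> V2)) (case st of (s, t) \<Rightarrow> s \<union> t) = st" using st i by simp
      show "X a b (case st of (s, t) \<Rightarrow> s \<union> t) * X c d (case st of (s, t) \<Rightarrow> s \<union> t)
         = (case st of (s, t) \<Rightarrow> (a s * c s) * (b t * d t))"
        using st i sub by (auto simp: X_def)
    qed (auto simp: cf)
    finally show ?thesis by simp
  qed
  have "dual_system K ?V E (I \<times> J) (\<lambda>(i, j). dg i + dh j) (\<lambda>(i, j). X (z i) (w j)) (\<lambda>(i, j). X (p i) (q j))"
    unfolding dual_system_def
  proof (intro conjI ballI)
    fix x y assume "x \<in> I \<times> J" "y \<in> I \<times> J"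
    then obtain i j k l where xy: "x = (i, j)" "y = (k, l)" "i \<in> I" "j \<in> J" "k \<in> I" "l \<in> J" by auto
    show "(\<Sum>\<sigma>\<in>clique_faces ?V E. (case x of (i, j) \<Rightarrow> X (p i) (q j)) \<sigma> * (case y of (i, j) \<Rightarrow> X (z i) (w j)) \<sigma>)
        = (if x = y then 1 else 0)"
      using ds dt xy by (auto simp: Xpair dual_system_def)
  qed (use ds dt Xch Xbd Xco in \<open>auto simp: dual_system_def\<close>)
  then have "card (I \<times> J) \<le> total_betti K ?V E"
    using card_dual_system[of ?V K E] fin by blast
  then show ?thesis using cI cJ by (simp add: card_cartesian_product)
qed

lemma total_betti_cong_edges:
  assumes "\<And>u v. u \<in> V \<Longrightarrow> v \<in> V \<Longrightarrow> u \<noteq> v \<Longrightarrow> {u, v} \<in> E \<longleftrightarrow> {u, v} \<in> E'"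
  shows "total_betti K V E = total_betti K V E'"
proof -
  have "clique_faces V E = clique_faces V E'" using assms by (fastforce simp: clique_faces_def)
  then show ?thesis by (simp add: total_betti_def reduced_betti_def chains_def)
qed

section \<open>The branching recursion\<close>

text \<open>\<open>adj\<close> stands for adjacency in the complement graph and \<open>b\<close> for
  the total Betti number of the clique complex. The combinatorial estimates rest on these few
  properties alone and are kept free of homology.\<close>

locale branching =
  fixes adj :: "'a \<Rightarrow> 'a \<Rightarrow> bool" and b :: "'a set \<Rightarrow> nat"
  assumes adj_sym: "adj u v \<Longrightarrow> adj v u"
    and adj_irrefl: "\<not> adj u u"
    and b_empty: "b {} = 1"
    and b_delete: "finite S \<Longrightarrow> w \<in> S \<Longrightarrow> b S \<le> b (S - {w}) + b (S - insert w {u. adj w u})"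
    and b_isolated: "finite S \<Longrightarrow> v \<in> S \<Longrightarrow> (\<And>u. u \<in> S \<Longrightarrow> \<not> adj v u) \<Longrightarrow> b S = 0"
begin

definition NN :: "'a \<Rightarrow> 'a set" where "NN w = insert w {u. adj w u}"

definition nb :: "'a set \<Rightarrow> 'a \<Rightarrow> 'a set" where "nb S v = {u \<in> S. adj v u}"

definition deg :: "'a set \<Rightarrow> 'a \<Rightarrow> nat" where "deg S v = card (nb S v)"

lemma adj_commute: "adj u v \<longleftrightarrow> adj v u" using adj_sym by blast

lemma in_NN [simp]: "u \<in> NN w \<longleftrightarrow> u = w \<or> adj w u" by (auto simp: NN_def)

lemma in_nb [simp]: "u \<in> nb S v \<longleftrightarrow> u \<in> S \<and> adj v u" by (auto simp: nb_def)

lemma finite_nb: "finite S \<Longrightarrow> finite (nb S v)" by (simp add: nb_def)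

text \<open>The idle \<open>S - {}\<close> keeps every branch in the shape
  \<open>S - R - NN w\<close>, to which the counting lemmas apply.\<close>

lemma branch1: "finite S \<Longrightarrow> w \<in> S \<Longrightarrow> b S \<le> b (S - {w}) + b (S - {} - NN w)"
  using b_delete by (simp add: NN_def)

lemma branch1': "finite S \<Longrightarrow> w \<in> S \<Longrightarrow> w \<notin> R \<Longrightarrow> b (S - R) \<le> b (S - insert w R) + b (S - R - NN w)"
proof -
  assume a: "finite S" "w \<in> S" "w \<notin> R"
  have e: "S - R - {w} = S - insert w R" by auto
  show ?thesis using branch1[of "S - R" w] a unfolding e by simp
qed

lemma isolated': "finite S \<Longrightarrow> v \<in> S \<Longrightarrow> v \<notin> R \<Longrightarrow> nb S v \<subseteq> R \<Longrightarrow> b (S - R) = 0"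
  by (rule b_isolated[of _ v]) auto

text \<open>\<open>R\<close> collects the neighbours of \<open>v\<close> deleted so far. After the
  last one \<open>v\<close> is isolated, and that remainder contributes 0.\<close>

lemma expand_list:
  assumes "finite S" "v \<in> S" "v \<notin> set ws" "set ws \<subseteq> S" "distinct ws" "nb S v \<subseteq> R \<union> set ws" "v \<notin> R" "R \<inter> set ws = {}"
    and "\<And>R' w. w \<in> set ws \<Longrightarrow> real (b (S - R' - NN w)) \<le> t"
  shows "real (b (S - R)) \<le> real (length ws) * t"
  using assms(3-)
proof (induction ws arbitrary: R)
  case Nil
  then show ?case using isolated'[OF assms(1,2), of R] by simp
next
  case (Cons w ws)
  have "b (S - R) \<le> b (S - insert w R) + b (S - R - NN w)"
    using branch1'[OF assms(1), of w R] Cons.prems by auto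
  moreover have "real (b (S - insert w R)) \<le> real (length ws) * t"
    using Cons.prems by (intro Cons.IH) auto
  moreover have "real (b (S - R - NN w)) \<le> t" using Cons.prems by auto
  ultimately show ?case by (simp add: algebra_simps)
qed

lemma expand1:
  assumes "finite S" "v \<in> S" "nb S v = {w1}"
  shows "b S \<le> b (S - {} - NN w1)"
proof -
  have "w1 \<in> S" "w1 \<noteq> v" using assms(3) adj_irrefl by (auto simp: nb_def)
  then show ?thesis
    using branch1'[OF assms(1), of w1 "{}"] isolated'[OF assms(1,2), of "{w1}"] assms(3) by auto
qed

lemma nbD:
  assumes "nb S v = A" "w \<in> A" shows "w \<in> S" "w \<noteq> v" "adj v w" "adj w v"
  using assms adj_irrefl adj_sym by auto

text \<open>Here and in the longer versions the order of the neighbours is free: the branch at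
  \<open>w2\<close> also misses \<open>w1\<close>, which is an additional loss exactly if the two
  are not adjacent.\<close>

lemma expand2:
  assumes fin: "finite S" and v: "v \<in> S" and w: "nb S v = {w1, w2}" and d: "distinct [w1, w2]"
  shows "b S \<le> b (S - {} - NN w1) + b (S - {w1} - NN w2)"
proof -
  note nw = nbD[OF w]
  have b1: "b (S - {w1}) \<le> b (S - {w2, w1}) + b (S - {w1} - NN w2)"
    by (rule branch1'[OF fin]) (use nw(1)[of w2] d in auto)
  have b0: "b (S - {}) \<le> b (S - {w1}) + b (S - {} - NN w1)"
    by (rule branch1'[OF fin]) (use nw(1)[of w1] d in auto)
  have z: "b (S - {w2, w1}) = 0"
    by (rule isolated'[OF fin v]) (use nw(2) in \<open>force simp: w\<close>)+
  have e1: "{w2, w1} = {w1, w2}" by (simp add: insert_commute)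
  show ?thesis using b1 b0 z unfolding e1 by simp
qed

lemma expand3:
  assumes fin: "finite S" and v: "v \<in> S" and w: "nb S v = {w1, w2, w3}" and d: "distinct [w1, w2, w3]"
  shows "b S \<le> b (S - {} - NN w1) + b (S - {w1} - NN w2) + b (S - {w1, w2} - NN w3)"
proof -
  note nw = nbD[OF w]
  have b2: "b (S - {w1, w2}) \<le> b (S - {w3, w1, w2}) + b (S - {w1, w2} - NN w3)"
    by (rule branch1'[OF fin]) (use nw(1)[of w3] d in auto)
  have b1: "b (S - {w1}) \<le> b (S - {w2, w1}) + b (S - {w1} - NN w2)"
    by (rule branch1'[OF fin]) (use nw(1)[of w2] d in auto)
  have b0: "b (S - {}) \<le> b (S - {w1}) + b (S - {} - NN w1)"
    by (rule branch1'[OF fin]) (use nw(1)[of w1] d in auto)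
  have z: "b (S - {w3, w1, w2}) = 0"
    by (rule isolated'[OF fin v]) (use nw(2) in \<open>force simp: w\<close>)+
  have e2: "{w3, w1, w2} = {w1, w2, w3}" by (simp add: insert_commute)
  have e1: "{w2, w1} = {w1, w2}" by (simp add: insert_commute)
  show ?thesis using b2 b1 b0 z unfolding e2 e1 by simp
qed

lemma expand4:
  assumes fin: "finite S" and v: "v \<in> S" and w: "nb S v = {w1, w2, w3, w4}" and d: "distinct [w1, w2, w3, w4]"
  shows "b S \<le> b (S - {} - NN w1) + b (S - {w1} - NN w2) + b (S - {w1, w2} - NN w3) + b (S - {w1, w2, w3} - NN w4)"
proof -
  note nw = nbD[OF w]
  have b3: "b (S - {w1, w2, w3}) \<le> b (S - {w4, w1, w2, w3}) + b (S - {w1, w2, w3} - NN w4)"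
    by (rule branch1'[OF fin]) (use nw(1)[of w4] d in auto)
  have b2: "b (S - {w1, w2}) \<le> b (S - {w3, w1, w2}) + b (S - {w1, w2} - NN w3)"
    by (rule branch1'[OF fin]) (use nw(1)[of w3] d in auto)
  have b1: "b (S - {w1}) \<le> b (S - {w2, w1}) + b (S - {w1} - NN w2)"
    by (rule branch1'[OF fin]) (use nw(1)[of w2] d in auto)
  have b0: "b (S - {}) \<le> b (S - {w1}) + b (S - {} - NN w1)"
    by (rule branch1'[OF fin]) (use nw(1)[of w1] d in auto)
  have z: "b (S - {w4, w1, w2, w3}) = 0"
    by (rule isolated'[OF fin v]) (use nw(2) in \<open>force simp: w\<close>)+
  have e3: "{w4, w1, w2, w3} = {w1, w2, w3, w4}" by (simp add: insert_commute)
  have e2: "{w3, w1, w2} = {w1, w2, w3}" by (simp add: insert_commute)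
  have e1: "{w2, w1} = {w1, w2}" by (simp add: insert_commute)
  show ?thesis using b3 b2 b1 b0 z unfolding e3 e2 e1 by simp
qed

lemma expand5:
  assumes fin: "finite S" and v: "v \<in> S" and w: "nb S v = {w1, w2, w3, w4, w5}" and d: "distinct [w1, w2, w3, w4, w5]"
  shows "b S \<le> b (S - {} - NN w1) + b (S - {w1} - NN w2) + b (S - {w1, w2} - NN w3) + b (S - {w1, w2, w3} - NN w4) + b (S - {w1, w2, w3, w4} - NN w5)"
proof -
  note nw = nbD[OF w]
  have b4: "b (S - {w1, w2, w3, w4}) \<le> b (S - {w5, w1, w2, w3, w4}) + b (S - {w1, w2, w3, w4} - NN w5)"
    by (rule branch1'[OF fin]) (use nw(1)[of w5] d in auto)
  have b3: "b (S - {w1, w2, w3}) \<le> b (S - {w4, w1, w2, w3}) + b (S - {w1, w2, w3} - NN w4)"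
    by (rule branch1'[OF fin]) (use nw(1)[of w4] d in auto)
  have b2: "b (S - {w1, w2}) \<le> b (S - {w3, w1, w2}) + b (S - {w1, w2} - NN w3)"
    by (rule branch1'[OF fin]) (use nw(1)[of w3] d in auto)
  have b1: "b (S - {w1}) \<le> b (S - {w2, w1}) + b (S - {w1} - NN w2)"
    by (rule branch1'[OF fin]) (use nw(1)[of w2] d in auto)
  have b0: "b (S - {}) \<le> b (S - {w1}) + b (S - {} - NN w1)"
    by (rule branch1'[OF fin]) (use nw(1)[of w1] d in auto)
  have z: "b (S - {w5, w1, w2, w3, w4}) = 0"
    by (rule isolated'[OF fin v]) (use nw(2) in \<open>force simp: w\<close>)+
  have e4: "{w5, w1, w2, w3, w4} = {w1, w2, w3, w4, w5}" by (simp add: insert_commute)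
  have e3: "{w4, w1, w2, w3} = {w1, w2, w3, w4}" by (simp add: insert_commute)
  have e2: "{w3, w1, w2} = {w1, w2, w3}" by (simp add: insert_commute)
  have e1: "{w2, w1} = {w1, w2}" by (simp add: insert_commute)
  show ?thesis using b4 b3 b2 b1 b0 z unfolding e4 e3 e2 e1 by simp
qed

lemma deg_drop:
  assumes "finite S" "T \<subseteq> S" "B \<subseteq> nb S u" "B \<inter> T = {}"
  shows "deg T u + card B \<le> deg S u"
proof -
  have "card (nb T u \<union> B) = card (nb T u) + card B"
    using assms finite_subset[OF assms(2,1)] finite_subset[OF assms(3)]
    by (intro card_Un_disjoint) (auto simp: finite_nb)
  moreover have "card (nb T u \<union> B) \<le> card (nb S u)"
    using assms by (intro card_mono finite_nb) auto
  ultimately show ?thesis by (simp add: deg_def)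
qed

text \<open>The connected component of \<open>u\<close> in \<open>T\<close> is a triangle: the extremal case of the bound \<open>2\<^sup>1\<^sup>/\<^sup>3\<close>, in which a
  vertex of degree two brings no gain.\<close>
definition isotri :: "'a set \<Rightarrow> 'a \<Rightarrow> bool" where
  "isotri T u \<longleftrightarrow> (\<exists>a c. a \<noteq> c \<and> adj a c \<and> nb T u = {a, c} \<and> nb T a = {u, c} \<and> nb T c = {u, a})"

end

section \<open>Counting lost vertices at a fixed growth rate\<close>

locale rate = branching adj b for adj :: "'a \<Rightarrow> 'a \<Rightarrow> bool" and b :: "'a set \<Rightarrow> nat" +
  fixes x y :: real
  assumes x1: "1 \<le> x" and xy: "x * y = 1"
begin

text \<open>The induction hypothesis below \<open>S\<close>.\<close>
definition ok :: "'a set \<Rightarrow> bool" where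
  "ok S \<longleftrightarrow> finite S \<and> (\<forall>T. T \<subset> S \<longrightarrow> real (b T) \<le> x ^ card T)"

lemma ok_finite: "ok S \<Longrightarrow> finite S" by (simp add: ok_def)

lemma ok_subset: "ok S \<Longrightarrow> T \<subseteq> S \<Longrightarrow> ok T"
  by (auto simp: ok_def dest: finite_subset)

lemma ok_bound: "ok S \<Longrightarrow> T \<subset> S \<Longrightarrow> real (b T) \<le> x ^ card T" by (simp add: ok_def)

lemma y_pos: "0 < y" using x1 xy by (metis less_le_trans mult_pos_pos zero_less_mult_pos zero_less_one)

lemma y_le1: "y \<le> 1" using x1 xy y_pos by (metis mult_left_le_one_le mult.commute linear mult_le_cancel_left_pos mult_1_right less_le_trans zero_less_one)

lemma x_power_pos: "0 < x ^ n" using x1 by simp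

lemma pow_cut:
  assumes "finite S" "T \<subseteq> S" "Q \<subseteq> S" "Q \<inter> T = {}" "k \<le> card Q"
  shows "x ^ card T \<le> y ^ k * x ^ card S"
proof -
  have "card T + card Q \<le> card S"
    using assms by (metis card_Un_disjoint card_mono finite_subset inf_commute sup_least)
  then have "card T + k \<le> card S" using assms by simp
  then have "x ^ (card T + k) \<le> x ^ card S" using x1 by (rule power_increasing)
  then have "y ^ k * x ^ (card T + k) \<le> y ^ k * x ^ card S" using y_pos by simp
  moreover have "y ^ k * x ^ (card T + k) = x ^ card T * (x * y) ^ k"
    by (simp add: power_add power_mult_distrib)
  ultimately show ?thesis by (simp add: xy)
qed

text \<open>The vertices certainly lost are \<open>w\<close>, at least \<open>d\<close> neighbours
  of it, and the deleted vertices in \<open>Q\<close>, which lie outside the closed neighbourhood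
  and so are not counted twice.\<close>

lemma pow_cut_nn:
  assumes "finite S" "w \<in> S" "d \<le> deg S w" "Q \<subseteq> S" "Q \<subseteq> R" "Q \<inter> NN w = {}" "k \<le> 1 + d + card Q"
  shows "x ^ card (S - R - NN w) \<le> y ^ k * x ^ card S"
proof (rule pow_cut[where Q = "insert w (nb S w) \<union> Q"])
  have "card (insert w (nb S w) \<union> Q) = card (insert w (nb S w)) + card Q"
    using assms finite_subset[OF assms(4,1)] by (intro card_Un_disjoint) (auto simp: finite_nb)
  moreover have "card (insert w (nb S w)) = 1 + deg S w"
    using assms(1) adj_irrefl by (subst card_insert_disjoint) (auto simp: finite_nb deg_def)
  ultimately show "k \<le> card (insert w (nb S w) \<union> Q)" using assms by simp
qed (use assms in auto)

text \<open>\<open>g\<close> is a saving found inside the branch; it multiplies the cost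
  \<open>y ^ k\<close> of reaching that branch.\<close>

lemma cut_gain:
  assumes "ok S" "w \<in> S" "d \<le> deg S w" "Q \<subseteq> S" "Q \<subseteq> R" "Q \<inter> NN w = {}" "k \<le> 1 + d + card Q"
    and "real (b (S - R - NN w)) \<le> g * x ^ card (S - R - NN w)" "0 \<le> g"
  shows "real (b (S - R - NN w)) \<le> g * y ^ k * x ^ card S"
  using order_trans[OF assms(8) mult_left_mono[OF pow_cut_nn[OF ok_finite[OF assms(1)] assms(2-7)] assms(9)]]
  by (simp add: mult.assoc)

lemma cut:
  assumes "ok S" "w \<in> S" "d \<le> deg S w" "Q \<subseteq> S" "Q \<subseteq> R" "Q \<inter> NN w = {}" "k \<le> 1 + d + card Q"
  shows "real (b (S - R - NN w)) \<le> y ^ k * x ^ card S"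
proof -
  have "S - R - NN w \<subset> S" using assms(2) by auto
  then show ?thesis using cut_gain[OF assms, of 1] ok_bound[OF assms(1)] by simp
qed

text \<open>If \<open>w\<close> is the only neighbour of \<open>u\<close>, only the branch at
  \<open>w\<close> survives, and it loses both vertices.\<close>

lemma leaf:
  assumes "ok T" "u \<in> T" "deg T u \<le> 1"
  shows "real (b T) \<le> y ^ 2 * x ^ card T"
proof (cases "nb T u = {}")
  case True
  then have "b T = 0" using isolated'[OF ok_finite[OF assms(1)] assms(2), of "{}"] by simp
  then show ?thesis using y_pos x_power_pos[of "card T"] by simp
next
  case False
  have "card (nb T u) = 1"
    using assms False finite_nb[OF ok_finite[OF assms(1)], of u] by (simp add: deg_def le_Suc_eq)
  then obtain w where w: "nb T u = {w}" by (auto simp: card_1_singleton_iff)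
  have "w \<in> T" "adj w u" using nbD[OF w] by auto
  then have "1 \<le> deg T w"
    using assms(2) finite_nb[OF ok_finite[OF assms(1)], of w]
    by (auto simp: deg_def Suc_le_eq card_gt_0_iff)
  then have "real (b (T - {} - NN w)) \<le> y ^ 2 * x ^ card T"
    by (intro cut[OF assms(1) \<open>w \<in> T\<close>, where d = 1 and Q = "{}"]) auto
  then show ?thesis using expand1[OF ok_finite[OF assms(1)] assms(2) w] by linarith
qed

lemma deg_ge: "finite S \<Longrightarrow> B \<subseteq> nb S u \<Longrightarrow> card B \<le> deg S u"
  by (simp add: deg_def card_mono finite_nb)

text \<open>The factor \<open>m\<close> allows to combine this gain with a second one inside all branches.\<close>
lemma low_degree_gain:
  assumes T: "ok T" "u \<in> T" "deg T u \<le> 2" "\<not> isotri T u" and y1: "1 \<le> y + y\<^sup>2" and m: "0 \<le> m"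
    and bd: "\<And>w Z. w \<in> T \<Longrightarrow> w \<in> NN u \<Longrightarrow> Z \<subseteq> T \<Longrightarrow> Z \<subseteq> NN u \<Longrightarrow>
       real (b (T - Z - NN w)) \<le> m * x ^ card (T - Z - NN w)"
  shows "real (b T) \<le> m * (y ^ 3 + y ^ 4) * x ^ card T"
proof -
  note fin = ok_finite[OF T(1)]
  have X: "0 < x ^ card T" by (rule x_power_pos)
  have cutm: "real (b (T - Z - NN w)) \<le> m * y ^ k * x ^ card T"
    if "w \<in> T" "w \<in> NN u" "Z \<subseteq> T" "Z \<subseteq> NN u" "d \<le> deg T w" "Q \<subseteq> Z" "Q \<inter> NN w = {}" "k \<le> 1 + d + card Q" for w Z d Q k
    using that bd[OF that(1-4)] by (intro cut_gain[OF T(1), where d = d and Q = Q] m) auto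
  have up: "real (b T) \<le> m * t * x ^ card T \<Longrightarrow> t \<le> y ^ 3 + y ^ 4 \<Longrightarrow> ?thesis" for t
    using X m by (meson mult_left_mono mult_right_mono order_trans less_imp_le)
  \<comment> \<open>So the factor of a leaf is at least as good as the one claimed; this is where
    \<open>1 \<le> y + y\<^sup>2\<close> enters.\<close>
  have y2: "y ^ 2 \<le> y ^ 3 + y ^ 4"
    using mult_left_mono[OF y1, of "y ^ 2"] by (simp add: power2_eq_square algebra_simps power3_eq_cube power4_eq_xxxx)
  have y34: "y ^ 3 \<le> y ^ 3 + y ^ 4" using y_pos by simp
  consider "deg T u = 0" | "deg T u = 1" | "deg T u = 2" using T(3) by linarith
  then show ?thesis
  proof cases
    case 1
    then have "b T = 0" using isolated'[OF fin T(2), of "{}"] finite_nb[OF fin, of u] by (simp add: deg_def)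
    then show ?thesis using m y_pos X by simp
  next
    case 2
    then obtain w where w: "nb T u = {w}" by (auto simp: deg_def card_1_singleton_iff)
    have ww: "w \<in> T" "adj w u" "adj u w" using nbD[OF w] by auto
    have "1 \<le> deg T w" using deg_ge[OF fin, of "{u}" w] ww T(2) by simp
    then have "real (b (T - {} - NN w)) \<le> m * y ^ 2 * x ^ card T"
      using ww by (intro cutm[where d = 1 and Q = "{}"]) auto
    then have "real (b T) \<le> m * y ^ 2 * x ^ card T" using expand1[OF fin T(2) w] by linarith
    then show ?thesis using up[OF _ y2] by simp
  next
    case 3
    then obtain a c where ac: "nb T u = {a, c}" "a \<noteq> c" by (auto simp: deg_def card_2_iff)
    have aT: "a \<in> T" "adj u a" "adj a u" "c \<in> T" "adj u c" "adj c u" using nbD[OF ac(1)] by auto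
    \<comment> \<open>If a neighbour \<open>z\<close> of \<open>u\<close> is a leaf, expanding at
      \<open>z\<close> leaves only the branch at \<open>u\<close>, which loses \<open>u\<close>,
      \<open>a\<close> and \<open>c\<close>.\<close>
    have leafcase: ?thesis if z: "z \<in> {a, c}" "deg T z \<le> 1" for z
    proof -
      have "nb T z = {u}"
      proof -
        have "u \<in> nb T z" using z aT T(2) by auto
        then show ?thesis using z(2) finite_nb[OF fin, of z]
          by (metis One_nat_def card_1_singletonE card_eq_0_iff deg_def empty_iff le_SucE le_zero_eq singletonD)
      qed
      moreover have "z \<in> T" using z aT by auto
      ultimately have "b T \<le> b (T - {} - NN u)" using expand1[OF fin] by blast
      moreover have "real (b (T - {} - NN u)) \<le> m * y ^ 3 * x ^ card T"
        using T(2) 3 by (intro cutm[where d = 2 and Q = "{}"]) auto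
      ultimately have "real (b T) \<le> m * y ^ 3 * x ^ card T" by linarith
      then show ?thesis using up[OF _ y34] by simp
    qed
    show ?thesis
    proof (cases "deg T a \<le> 1 \<or> deg T c \<le> 1")
      case True
      then show ?thesis using leafcase by blast
    next
      case False
      then have d2: "2 \<le> deg T a" "2 \<le> deg T c" by auto
      \<comment> \<open>The second branch must lose four vertices: either \<open>p\<close> is not
        adjacent to \<open>q\<close> and counts in addition, or \<open>q\<close> has a third
        neighbour. If this fails for both orders, \<open>u\<close>, \<open>a\<close> and
        \<open>c\<close> form a triangle component.\<close>
      have key: ?thesis if ord: "nb T u = {p, q}" "p \<noteq> q" "2 \<le> deg T p" "2 \<le> deg T q" "\<not> adj p q \<or> 3 \<le> deg T q" for p q
      proof -
        have pq: "p \<in> T" "adj u p" "q \<in> T" "adj u q" using nbD[OF ord(1)] by auto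
        have "real (b (T - {} - NN p)) \<le> m * y ^ 3 * x ^ card T"
          using pq ord by (intro cutm[where d = 2 and Q = "{}"]) auto
        moreover have "real (b (T - {p} - NN q)) \<le> m * y ^ 4 * x ^ card T"
        proof (cases "adj p q")
          case True
          then show ?thesis using pq ord by (intro cutm[where d = 3 and Q = "{}"]) auto
        next
          case False
          then show ?thesis using pq ord adj_sym[of q p] by (intro cutm[where d = 2 and Q = "{p}"]) auto
        qed
        moreover have "b T \<le> b (T - {} - NN p) + b (T - {p} - NN q)"
          using expand2[OF fin T(2) ord(1)] ord(2) by simp
        ultimately have "real (b T) \<le> m * y ^ 3 * x ^ card T + m * y ^ 4 * x ^ card T" by linarith
        then show ?thesis by (simp add: algebra_simps)
      qed
      show ?thesis
      proof (cases "adj a c")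
        case False
        then show ?thesis using key[OF ac(1) ac(2)] d2 by auto
      next
        case True
        have "3 \<le> deg T a \<or> 3 \<le> deg T c"
        proof (rule ccontr)
          assume "\<not> ?thesis"
          then have "deg T a = 2" "deg T c = 2" using d2 by auto
          moreover have "u \<noteq> a" "u \<noteq> c" using aT adj_irrefl by auto
          ultimately have "nb T a = {u, c}" "nb T c = {u, a}"
            using card_subset_eq[OF finite_nb[OF fin], of "{u, c}" a]
              card_subset_eq[OF finite_nb[OF fin], of "{u, a}" c] aT T(2) True adj_sym[OF True]
            by (auto simp: deg_def)
          then show False using T(4) ac True by (auto simp: isotri_def)
        qed
        then show ?thesis
          using key[of a c] key[of c a] d2 ac by (auto simp: insert_commute)
      qed
    qed
  qed
qed

lemma low_degree:
  assumes T: "ok T" "u \<in> T" "deg T u \<le> 2" "\<not> isotri T u" and y1: "1 \<le> y + y\<^sup>2"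
  shows "real (b T) \<le> (y ^ 3 + y ^ 4) * x ^ card T"
proof -
  have "real (b (T - Z - NN w)) \<le> 1 * x ^ card (T - Z - NN w)" if "w \<in> T" for w Z
  proof -
    have "T - Z - NN w \<subset> T" using that by auto
    then show ?thesis using ok_bound[OF T(1)] by simp
  qed
  from low_degree_gain[OF T y1 _ this] show ?thesis by simp
qed

lemma branch_high_degree:
  assumes "ok S" "v \<in> S" "d \<le> deg S v" "y + y ^ (1 + d) \<le> 1"
  shows "real (b S) \<le> x ^ card S"
proof -
  have "real (b (S - {} - NN v)) \<le> y ^ (1 + d) * x ^ card S"
    using assms by (intro cut[where d = d and Q = "{}"]) auto
  moreover have "real (b (S - {v})) \<le> y ^ 1 * x ^ card S"
  proof -
    have "x ^ card (S - {v}) \<le> y ^ 1 * x ^ card S"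
      using assms ok_finite by (intro pow_cut[where Q = "{v}"]) auto
    moreover have "real (b (S - {v})) \<le> x ^ card (S - {v})"
      using assms by (intro ok_bound) auto
    ultimately show ?thesis by linarith
  qed
  ultimately have "real (b S) \<le> (y + y ^ (1 + d)) * x ^ card S"
    using branch1[OF ok_finite[OF assms(1)] assms(2)] by (simp add: algebra_simps)
  also have "\<dots> \<le> 1 * x ^ card S"
    using assms(4) x_power_pos[of "card S"] by (intro mult_right_mono) auto
  finally show ?thesis by simp
qed

lemma branch_regular:
  assumes "ok S" "v \<in> S" and deg: "\<And>u. u \<in> S \<Longrightarrow> deg S v \<le> deg S u"
    and "real (deg S v) * y ^ (1 + deg S v) \<le> 1"
  shows "real (b S) \<le> x ^ card S"
proof -
  note fin = ok_finite[OF assms(1)]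
  obtain ws where ws: "set ws = nb S v" "distinct ws"
    using finite_distinct_list[OF finite_nb[OF fin]] by blast
  have "real (b (S - {})) \<le> real (length ws) * (y ^ (1 + deg S v) * x ^ card S)"
    using ws assms(2) adj_irrefl
    by (intro expand_list[OF fin assms(2)] cut[OF assms(1), where d = "deg S v" and Q = "{}"])
      (auto intro: deg)
  also have "length ws = deg S v" using ws distinct_card by (fastforce simp: deg_def)
  also have "real (deg S v) * (y ^ (1 + deg S v) * x ^ card S)
      = real (deg S v) * y ^ (1 + deg S v) * x ^ card S" by simp
  also have "\<dots> \<le> 1 * x ^ card S"
    using assms(4) x_power_pos[of "card S"] by (intro mult_right_mono) auto
  finally show ?thesis by simp
qed

text \<open>One induction for all rates: \<open>P\<close> is the hereditary exclusion of a clique,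
  and each step starts at a vertex of minimum degree.\<close>

lemma induct_bound:
  assumes step: "\<And>S v. finite S \<Longrightarrow> P S \<Longrightarrow> ok S \<Longrightarrow> v \<in> S \<Longrightarrow> (\<And>u. u \<in> S \<Longrightarrow> deg S v \<le> deg S u) \<Longrightarrow>
       real (b S) \<le> x ^ card S"
    and her: "\<And>S T. P S \<Longrightarrow> T \<subseteq> S \<Longrightarrow> P T" and "finite S" "P S"
  shows "real (b S) \<le> x ^ card S"
  using assms(3,4)
proof (induction rule: finite_psubset_induct)
  case (psubset A)
  have ok: "ok A" unfolding ok_def using psubset her by blast
  show ?case
  proof (cases "A = {}")
    case True
    then show ?thesis by (simp add: b_empty)
  next
    case False
    obtain v where "v \<in> A" "\<And>u. u \<in> A \<Longrightarrow> deg A v \<le> deg A u"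
      using ex_min_if_finite[of "deg A ` A"] psubset(1) False arg_min_if_finite[OF psubset(1) False, of "deg A"]
      by (metis arg_min_least psubset(1))
    then show ?thesis using step[OF psubset(1) psubset.prems ok] by blast
  qed
qed

end

section \<open>Graphs without large cliques\<close>

text \<open>This says that \<open>d\<close> branches losing \<open>d + 1\<close> vertices each cost
  at most 1 at the rate 4^(1/5). Equality holds at \<open>d = 4\<close>; from there on
  \<open>(5 / 4) ^ 5 < 4\<close> carries the induction.\<close>

lemma fifth_power_le: "d ^ 5 \<le> 4 ^ (d + 1)" for d :: nat
proof (cases "d < 4")
  case True
  then have "d \<in> {0, 1, 2, 3}" by auto
  then show ?thesis by auto
next
  case False
  then have "4 \<le> d" by simp
  then show ?thesis
  proof (induction d rule: dec_induct)
    case (step n)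
    have "(4 * (n + 1)) ^ 5 \<le> (5 * n) ^ 5" using step by (intro power_mono) auto
    then have "(n + 1) ^ 5 \<le> 4 * n ^ 5" by (simp only: power_mult_distrib) simp
    then show ?case using step by simp
  qed simp
qed

text \<open>Equality holds at \<open>d = 3\<close>. The exception \<open>d = 4\<close>, with 256
  against 243, is the one degree at which the absence of K_5 has to be used.\<close>

lemma fourth_power_le: "d \<noteq> 4 \<Longrightarrow> d ^ 4 \<le> 3 ^ (d + 1)" for d :: nat
proof (cases "d < 5")
  case True
  assume "d \<noteq> 4"
  with True have "d \<in> {0, 1, 2, 3}" by auto
  then show ?thesis by auto
next
  case False
  then have "5 \<le> d" by simp
  then show ?thesis
  proof (induction d rule: dec_induct)
    case (step n)
    have "(5 * (n + 1)) ^ 4 \<le> (6 * n) ^ 4" using step by (intro power_mono) auto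
    then have "(n + 1) ^ 4 \<le> 3 * n ^ 4" by (simp only: power_mult_distrib) simp
    then show ?case using step by simp
  qed simp
qed

context rate
begin

lemma branch_regular_root:
  assumes "ok S" "v \<in> S" and "\<And>u. u \<in> S \<Longrightarrow> deg S v \<le> deg S u"
    and yr: "y ^ r = 1 / real m" "m > 0" "r > 0" and d: "deg S v ^ r \<le> m ^ (deg S v + 1)"
  shows "real (b S) \<le> x ^ card S"
proof (rule branch_regular[OF assms(1-3)])
  let ?d = "deg S v"
  have "(real ?d * y ^ (1 + ?d)) ^ r = real ?d ^ r * (y ^ r) ^ (1 + ?d)"
    by (simp add: power_mult_distrib flip: power_mult) (simp add: mult.commute)
  also have "\<dots> = real (?d ^ r) / real (m ^ (?d + 1))"
    by (simp add: yr power_divide)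
  also have "\<dots> \<le> 1" using d yr(2) by (simp only: divide_le_eq_1 of_nat_le_iff) simp
  finally have "(real ?d * y ^ (1 + ?d)) ^ r \<le> 1 ^ r" by simp
  then show "real ?d * y ^ (1 + ?d) \<le> 1"
    using yr(3) y_pos power_le_imp_le_base[of _ "r - 1" 1] by simp
qed

theorem general_bound:
  assumes "y ^ 5 = 1 / 4" "finite S"
  shows "real (b S) \<le> x ^ card S"
proof (rule induct_bound[where P = "\<lambda>_. True"])
  fix S v assume "ok S" "v \<in> S" "\<And>u. u \<in> S \<Longrightarrow> deg S v \<le> deg S u"
  then show "real (b S) \<le> x ^ card S"
    using branch_regular_root[of S v 5 4] assms(1) fifth_power_le by simp
qed (use assms in auto)

lemma four_term_bound:
  assumes "b S \<le> n1 + n2 + n3 + n4"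
    "real n1 \<le> c1 * x ^ card S" "real n2 \<le> c2 * x ^ card S" "real n3 \<le> c3 * x ^ card S" "real n4 \<le> c4 * x ^ card S"
    and "c1 + c2 + c3 + c4 \<le> 1"
  shows "real (b S) \<le> x ^ card S"
proof -
  have "real (b S) \<le> real (n1 + n2 + n3 + n4)" using assms(1) by (simp only: of_nat_le_iff)
  also have "\<dots> \<le> (c1 + c2 + c3 + c4) * x ^ card S" using assms(2-5) by (simp add: algebra_simps)
  also have "\<dots> \<le> 1 * x ^ card S" using assms(6) x_power_pos[of "card S"] by (intro mult_right_mono) auto
  finally show ?thesis by simp
qed

lemma three_term_bound:
  assumes "b S \<le> n1 + n2 + n3"
    "real n1 \<le> c1 * x ^ card S" "real n2 \<le> c2 * x ^ card S" "real n3 \<le> c3 * x ^ card S"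
    and "c1 + c2 + c3 \<le> 1"
  shows "real (b S) \<le> x ^ card S"
  using four_term_bound[of S n1 n2 n3 0 c1 c2 c3 0] assms by simp

lemma five_term_bound:
  assumes "b S \<le> n1 + n2 + n3 + n4 + n5"
    "real n1 \<le> c1 * x ^ card S" "real n2 \<le> c2 * x ^ card S" "real n3 \<le> c3 * x ^ card S"
    "real n4 \<le> c4 * x ^ card S" "real n5 \<le> c5 * x ^ card S"
    and "c1 + c2 + c3 + c4 + c5 \<le> 1"
  shows "real (b S) \<le> x ^ card S"
  using four_term_bound[of S n1 n2 n3 "n4 + n5" c1 c2 c3 "c4 + c5"] assms by (simp add: algebra_simps)

theorem K5_free_bound:
  assumes y4: "y ^ 4 = 1 / 3" and "finite S"
    and free: "\<And>v p q r s. {v, p, q, r, s} \<subseteq> S \<Longrightarrow> adj v p \<Longrightarrow> adj v q \<Longrightarrow> adj v r \<Longrightarrow> adj v s \<Longrightarrow>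
      adj p q \<Longrightarrow> adj p r \<Longrightarrow> adj p s \<Longrightarrow> adj q r \<Longrightarrow> adj q s \<Longrightarrow> adj r s \<Longrightarrow> False"
  shows "real (b S) \<le> x ^ card S"
proof (rule induct_bound[where P = "\<lambda>S. \<forall>v p q r s. {v, p, q, r, s} \<subseteq> S \<longrightarrow> adj v p \<longrightarrow> adj v q \<longrightarrow> adj v r \<longrightarrow> adj v s \<longrightarrow>
      adj p q \<longrightarrow> adj p r \<longrightarrow> adj p s \<longrightarrow> adj q r \<longrightarrow> adj q s \<longrightarrow> adj r s \<longrightarrow> False"])
  fix S v
  assume K: "\<forall>v p q r s. {v, p, q, r, s} \<subseteq> S \<longrightarrow> adj v p \<longrightarrow> adj v q \<longrightarrow> adj v r \<longrightarrow> adj v s \<longrightarrow>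
      adj p q \<longrightarrow> adj p r \<longrightarrow> adj p s \<longrightarrow> adj q r \<longrightarrow> adj q s \<longrightarrow> adj r s \<longrightarrow> False"
    and ok: "ok S" and v: "v \<in> S" and min: "\<And>u. u \<in> S \<Longrightarrow> deg S v \<le> deg S u"
  show "real (b S) \<le> x ^ card S"
  proof (cases "deg S v = 4")
    case False
    then show ?thesis
      using branch_regular_root[OF ok v min, of 4 3] y4 fourth_power_le by simp
  next
    case True
    then obtain p q r s where w: "nb S v = {p, q, r, s}" "distinct [p, q, r, s]"
      by (auto simp: deg_def card_Suc_eq eval_nat_numeral)
    note nw = nbD[OF w(1)]
    \<comment> \<open>Without a K_5 two neighbours of \<open>v\<close> are not adjacent. Listed
      first, they let the second branch lose one vertex more, and
      \<open>3 * y ^ 5 + y ^ 6 \<le> 1\<close>.\<close>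
    have key: ?thesis if a: "nb S v = {a1, a2, a3, a4}" "distinct [a1, a2, a3, a4]" "\<not> adj a1 a2" for a1 a2 a3 a4
    proof (rule four_term_bound[OF expand4[OF ok_finite[OF ok] v a(1,2)]])
      note na = nbD[OF a(1)]
      have d: "4 \<le> deg S a1" "4 \<le> deg S a2" "4 \<le> deg S a3" "4 \<le> deg S a4"
        using min na(1) True by auto
      show "real (b (S - {} - NN a1)) \<le> y ^ 5 * x ^ card S"
        by (rule cut[OF ok, where d = 4 and Q = "{}"]) (use na(1) d in auto)
      show "real (b (S - {a1} - NN a2)) \<le> y ^ 6 * x ^ card S"
        by (rule cut[OF ok, where d = 4 and Q = "{a1}"]) (use na(1) d a in \<open>auto simp: adj_commute\<close>)
      show "real (b (S - {a1, a2} - NN a3)) \<le> y ^ 5 * x ^ card S"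
        by (rule cut[OF ok, where d = 4 and Q = "{}"]) (use na(1) d in auto)
      show "real (b (S - {a1, a2, a3} - NN a4)) \<le> y ^ 5 * x ^ card S"
        by (rule cut[OF ok, where d = 4 and Q = "{}"]) (use na(1) d in auto)
      have y_bounds: "y \<le> 76 / 100"
      proof (rule ccontr)
        assume "\<not> ?thesis"
        then have "(76 / 100) ^ 4 < y ^ 4" by (intro power_strict_mono) auto
        then show False using y4 by (simp add: power_divide)
      qed
      have "y\<^sup>2 \<le> (76 / 100)\<^sup>2" using y_bounds y_pos by (intro power_mono) auto
      moreover have "y ^ 5 = y ^ 4 * y" "y ^ 6 = y ^ 4 * y\<^sup>2" by algebra+
      then have "y ^ 5 = y / 3" "y ^ 6 = y\<^sup>2 / 3" unfolding y4 by simp_all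
      moreover have "(76 / 100 :: real)\<^sup>2 \<le> 58 / 100" by (simp add: power2_eq_square)
      ultimately show "y ^ 5 + y ^ 6 + y ^ 5 + y ^ 5 \<le> 1" using y_bounds by linarith
    qed
    have "\<not> (adj p q \<and> adj p r \<and> adj p s \<and> adj q r \<and> adj q s \<and> adj r s)"
      using K[rule_format, of v p q r s] nw(1,3) v by auto
    then show ?thesis
      using key[of p q r s] key[of p r q s] key[of p s q r] key[of q r p s] key[of q s p r] key[of r s p q] w
      by (auto simp: insert_commute)
  qed
next
  fix S T assume "\<forall>v p q r s. {v, p, q, r, s} \<subseteq> S \<longrightarrow> adj v p \<longrightarrow> adj v q \<longrightarrow> adj v r \<longrightarrow> adj v s \<longrightarrow>
      adj p q \<longrightarrow> adj p r \<longrightarrow> adj p s \<longrightarrow> adj q r \<longrightarrow> adj q s \<longrightarrow> adj r s \<longrightarrow> False" "T \<subseteq> S"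
  then show "\<forall>v p q r s. {v, p, q, r, s} \<subseteq> T \<longrightarrow> adj v p \<longrightarrow> adj v q \<longrightarrow> adj v r \<longrightarrow> adj v s \<longrightarrow>
      adj p q \<longrightarrow> adj p r \<longrightarrow> adj p s \<longrightarrow> adj q r \<longrightarrow> adj q s \<longrightarrow> adj r s \<longrightarrow> False"
    by (meson order_trans)
qed (fact assms(2), use free in blast)

text \<open>\<open>B\<close> consists of neighbours of \<open>u\<close> that are gone in the branch.
  If at most one neighbour is left, \<open>u\<close> saves a further \<open>y ^ 2\<close>.\<close>

lemma cut_leaf:
  assumes "ok S" "w \<in> S" "d \<le> deg S w" "Q \<subseteq> S" "Q \<subseteq> R" "Q \<inter> NN w = {}" "k \<le> 1 + d + card Q"
    and "u \<in> S - R - NN w" "B \<subseteq> nb S u" "B \<subseteq> R \<union> NN w" "deg S u \<le> 1 + card B"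
  shows "real (b (S - R - NN w)) \<le> y ^ (2 + k) * x ^ card S"
proof -
  have "deg (S - R - NN w) u \<le> 1"
    using deg_drop[OF ok_finite[OF assms(1)], of "S - R - NN w" B u] assms(9-11) by fastforce
  from leaf[OF ok_subset[OF assms(1)] assms(8) this]
  show ?thesis unfolding power_add by (intro cut_gain[OF assms(1-7)]) auto
qed

text \<open>The saving given by \<open>low_degree\<close> for a vertex of degree at most two outside
  triangle components.\<close>

definition lam :: real where "lam = y ^ 3 + y ^ 4"

lemma lam_nonneg: "0 \<le> lam" using y_pos by (simp add: lam_def)

lemma deg_cut:
  assumes "ok S" "B \<subseteq> nb S u" "B \<subseteq> R \<union> NN w" "deg S u \<le> j + card B"
  shows "deg (S - R - NN w) u \<le> j"
  using deg_drop[OF ok_finite[OF assms(1)], of "S - R - NN w" B u] assms(2-4) by fastforce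

lemma cut_low:
  assumes "ok S" "w \<in> S" "d \<le> deg S w" "Q \<subseteq> S" "Q \<subseteq> R" "Q \<inter> NN w = {}" "k \<le> 1 + d + card Q"
    and "u \<in> S - R - NN w" "B \<subseteq> nb S u" "B \<subseteq> R \<union> NN w" "deg S u \<le> 2 + card B"
    and "\<not> isotri (S - R - NN w) u" "1 \<le> y + y\<^sup>2"
  shows "real (b (S - R - NN w)) \<le> lam * y ^ k * x ^ card S"
proof -
  have "deg (S - R - NN w) u \<le> 2" using deg_cut[OF assms(1,9,10,11)] .
  from low_degree[OF ok_subset[OF assms(1)] assms(8) this assms(12,13)]
  show ?thesis unfolding lam_def[symmetric] by (intro cut_gain[OF assms(1-7)] lam_nonneg) auto
qed

lemma branch_two:
  assumes "ok S" "v \<in> S" "deg S v = 2" "\<And>u. u \<in> S \<Longrightarrow> 2 \<le> deg S u" "2 * y ^ 3 \<le> 1"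
  shows "real (b S) \<le> x ^ card S"
  using branch_regular[of S v] assms by (simp add: power3_eq_cube)

lemma scaled_bound:
  assumes "real (b S) \<le> c * x ^ card S" "c \<le> 1" shows "real (b S) \<le> x ^ card S"
proof -
  have "c * x ^ card S \<le> 1 * x ^ card S"
    using x_power_pos[of "card S"] by (intro mult_right_mono assms(2)) auto
  then show ?thesis using assms(1) by linarith
qed

text \<open>Among pairwise nonadjacent neighbours each branch also loses all earlier ones, so the
  costs form a geometric progression instead of equal terms.\<close>

lemma expand_independent:
  assumes ok: "ok S" and v: "v \<in> S" and "v \<notin> set ws" "set ws \<subseteq> S" "distinct ws" "nb S v \<subseteq> R \<union> set ws" "v \<notin> R"
    and "R \<subseteq> S" "R \<inter> set ws = {}" and "\<And>u w. u \<in> R \<union> set ws \<Longrightarrow> w \<in> R \<union> set ws \<Longrightarrow> \<not> adj u w"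
    and deg: "\<And>u. u \<in> S \<Longrightarrow> d \<le> deg S u"
  shows "real (b (S - R)) \<le> (\<Sum>j<length ws. y ^ (1 + d + card R + j)) * x ^ card S"
  using assms(3-10)
proof (induction ws arbitrary: R)
  case Nil
  then show ?case using isolated'[OF ok_finite[OF ok] v, of R] by simp
next
  case (Cons w ws)
  have finR: "finite R" using Cons.prems(6) ok_finite[OF ok] finite_subset by blast
  have "b (S - R) \<le> b (S - insert w R) + b (S - R - NN w)"
    using branch1'[OF ok_finite[OF ok], of w R] Cons.prems by auto
  moreover have "real (b (S - insert w R)) \<le> (\<Sum>j<length ws. y ^ (1 + d + card (insert w R) + j)) * x ^ card S"
    using Cons.prems by (intro Cons.IH) auto
  moreover have "card (insert w R) = Suc (card R)" using Cons.prems finR by auto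
  moreover have "real (b (S - R - NN w)) \<le> y ^ (1 + d + card R) * x ^ card S"
    by (rule cut[OF ok, where d = d and Q = R]) (use Cons.prems deg in auto)
  ultimately show ?case
    by (simp add: sum.lessThan_Suc_shift algebra_simps del: sum.lessThan_Suc)
qed

text \<open>Neighbourhoods are independent sets. At minimum degree 4 the progression is
  \<open>y ^ 5 + y ^ 6 + y ^ 7 + y ^ 8\<close>, and setting it equal to 1 defines
  \<open>Gamma4\<close>. At that value only degree 3 overshoots, since
  \<open>y ^ 4 + y ^ 5 + y ^ 6\<close> slightly exceeds 1.\<close>

theorem K3_free_bound:
  assumes ys: "y ^ 5 + y ^ 6 + y ^ 7 + y ^ 8 \<le> 1" and y_bounds: "y \<le> 8046 / 10000" and y1: "1 \<le> y + y\<^sup>2"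
    and "finite S" and free: "\<And>p q r. {p, q, r} \<subseteq> S \<Longrightarrow> adj p q \<Longrightarrow> adj p r \<Longrightarrow> adj q r \<Longrightarrow> False"
  shows "real (b S) \<le> x ^ card S"
proof (rule induct_bound[where P = "\<lambda>S. \<forall>p q r. {p, q, r} \<subseteq> S \<longrightarrow> adj p q \<longrightarrow> adj p r \<longrightarrow> adj q r \<longrightarrow> False"])
  fix S v
  assume K: "\<forall>p q r. {p, q, r} \<subseteq> S \<longrightarrow> adj p q \<longrightarrow> adj p r \<longrightarrow> adj q r \<longrightarrow> False"
    and ok: "ok S" and v: "v \<in> S" and min: "\<And>u. u \<in> S \<Longrightarrow> deg S v \<le> deg S u"
  note fin = ok_finite[OF ok]
  have yk: "y ^ k \<le> (8046 / 10000) ^ k" for k using y_bounds y_pos by (intro power_mono) auto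
  have indep: "\<not> adj p q" if "p \<in> nb S v" "q \<in> nb S v" for p q
    using K v that by (metis empty_subsetI in_nb insert_subset)
  have noiso: "\<not> isotri T u" if "T \<subseteq> S" "u \<in> T" for T u
  proof
    assume "isotri T u"
    then obtain a c where "adj a c" "nb T u = {a, c}" by (auto simp: isotri_def)
    then show False using K that nbD[of T u "{a, c}"] by (metis empty_subsetI insert_iff insert_subset subset_iff)
  qed
  have regular: "real (b S) \<le> (\<Sum>j<deg S v. y ^ (1 + deg S v + j)) * x ^ card S"
  proof -
    obtain ws where ws: "set ws = nb S v" "distinct ws"
      using finite_distinct_list[OF finite_nb[OF fin]] by blast
    have "length ws = deg S v" using ws distinct_card by (fastforce simp: deg_def)
    moreover have "nb S v \<subseteq> S" by (auto simp: nb_def)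
    ultimately show ?thesis
      using expand_independent[OF ok v, of ws "{}" "deg S v"] ws adj_irrefl indep min by auto
  qed
  consider "deg S v \<le> 1" | "deg S v = 2" | "deg S v = 3" | "deg S v = 4" | "deg S v = 5" | "deg S v = 6" | "7 \<le> deg S v"
    by linarith
  then show "real (b S) \<le> x ^ card S"
  proof cases
    case 1
    have "y ^ 2 \<le> 1" using y_le1 y_pos by (simp add: power_le_one)
    with leaf[OF ok v 1] show ?thesis by (rule scaled_bound)
  next
    case 2
    have "y ^ 3 + y ^ 4 \<le> 1" using yk[of 3] yk[of 4] by (simp add: power_divide)
    then show ?thesis
      using scaled_bound[OF low_degree[OF ok v _ noiso[OF order_refl v] y1]] 2 by simp
  next
    case 3
    then obtain p q r where w: "nb S v = {p, q, r}" "distinct [p, q, r]"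
      by (auto simp: deg_def card_Suc_eq eval_nat_numeral)
    \<comment> \<open>Either a neighbour of degree at least 4 is listed first, or all three have
      degree 3. In the latter case the loss of \<open>v\<close> leaves the next neighbour with
      degree at most two, and without triangles nothing spoils the saving.\<close>
    have key: ?thesis if a: "nb S v = {p, q, r}" "distinct [p, q, r]" "4 \<le> deg S p \<or> (deg S p = 3 \<and> deg S q = 3 \<and> deg S r = 3)" for p q r
    proof -
      note na = nbD[OF a(1)]
      have nadj: "\<not> adj p q" "\<not> adj p r" "\<not> adj q r" "\<not> adj q p" "\<not> adj r p" "\<not> adj r q" using indep a(1) by auto
      have d: "3 \<le> deg S p" "3 \<le> deg S q" "3 \<le> deg S r" using min na(1) 3 by auto
      have c3: "real (b (S - {p, q} - NN r)) \<le> y ^ 6 * x ^ card S"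
        by (rule cut[OF ok, where d = 3 and Q = "{p, q}"]) (use na(1) d nadj a in auto)
      note ex = expand3[OF fin v a(1,2)]
      from a(3) show ?thesis
      proof
        assume p4: "4 \<le> deg S p"
        show ?thesis
        proof (rule three_term_bound[OF ex _ _ c3])
          show "real (b (S - {} - NN p)) \<le> y ^ 5 * x ^ card S"
            by (rule cut[OF ok, where d = 4 and Q = "{}"]) (use na(1) p4 in auto)
          show "real (b (S - {p} - NN q)) \<le> y ^ 5 * x ^ card S"
            by (rule cut[OF ok, where d = 3 and Q = "{p}"]) (use na(1) d nadj a in auto)
          show "y ^ 5 + y ^ 5 + y ^ 6 \<le> 1" using yk[of 5] yk[of 6] by (simp add: power_divide)
        qed
      next
        assume d3: "deg S p = 3 \<and> deg S q = 3 \<and> deg S r = 3"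
        have ni: "\<not> isotri (S - {} - NN p) q" "\<not> isotri (S - {p} - NN q) r"
          by (rule noiso; use na(1) nadj a(2) in auto)+
        show ?thesis
        proof (rule three_term_bound[OF ex _ _ c3])
          show "real (b (S - {} - NN p)) \<le> lam * y ^ 4 * x ^ card S"
            by (rule cut_low[OF ok, where d = 3 and Q = "{}" and u = q and B = "{v}"])
              (use na d3 nadj a v y1 ni in auto)
          show "real (b (S - {p} - NN q)) \<le> lam * y ^ 5 * x ^ card S"
            by (rule cut_low[OF ok, where d = 3 and Q = "{p}" and u = r and B = "{v}"])
              (use na d3 nadj a v y1 ni in auto)
          have "lam * y ^ 4 + lam * y ^ 5 + y ^ 6 = y ^ 7 + 2 * y ^ 8 + y ^ 9 + y ^ 6"
            by (simp add: lam_def algebra_simps flip: power_add)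
          then show "lam * y ^ 4 + lam * y ^ 5 + y ^ 6 \<le> 1"
            using yk[of 6] yk[of 7] yk[of 8] yk[of 9] by (simp add: power_divide)
        qed
      qed
    qed
    have d: "3 \<le> deg S p" "3 \<le> deg S q" "3 \<le> deg S r" using min nbD[OF w(1)] 3 by auto
    then show ?thesis
      using key[of p q r] key[of q p r] key[of r p q] w by (fastforce simp: insert_commute)
  next
    case 4
    have "(\<Sum>j<deg S v. y ^ (1 + deg S v + j)) \<le> 1"
      using ys unfolding 4 by (simp add: eval_nat_numeral)
    with regular show ?thesis by (rule scaled_bound)
  next
    case 5
    have "(\<Sum>j<deg S v. y ^ (1 + deg S v + j)) \<le> (\<Sum>j<deg S v. (8046 / 10000) ^ (1 + deg S v + j))"
      by (intro sum_mono yk)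
    also have "\<dots> \<le> 1" unfolding 5 by (simp add: eval_nat_numeral)
    finally show ?thesis by (rule scaled_bound[OF regular])
  next
    case 6
    have "(\<Sum>j<deg S v. y ^ (1 + deg S v + j)) \<le> (\<Sum>j<deg S v. (8046 / 10000) ^ (1 + deg S v + j))"
      by (intro sum_mono yk)
    also have "\<dots> \<le> 1" unfolding 6 by (simp add: eval_nat_numeral)
    finally show ?thesis by (rule scaled_bound[OF regular])
  next
    case 7
    then show ?thesis
      using branch_high_degree[OF ok v 7] y_bounds yk[of 8] by (simp add: power_divide)
  qed
next
  fix S T assume "\<forall>p q r. {p, q, r} \<subseteq> S \<longrightarrow> adj p q \<longrightarrow> adj p r \<longrightarrow> adj q r \<longrightarrow> False" "T \<subseteq> S"
  then show "\<forall>p q r. {p, q, r} \<subseteq> T \<longrightarrow> adj p q \<longrightarrow> adj p r \<longrightarrow> adj q r \<longrightarrow> False" by (meson order_trans)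
qed (use assms in auto)

end

section \<open>Graphs without a complete subgraph on four vertices\<close>

text \<open>Here y is about 0.794. The plain counts \<open>3 * y ^ 4\<close>,
  \<open>4 * y ^ 5\<close> and \<open>5 * y ^ 6\<close> are all near 1.2, so the minimum degrees 3,
  4 and 5 are treated by the shape of the neighbourhood, a triangle-free graph.\<close>

locale rate_K4 = rate adj b x y for adj :: "'a \<Rightarrow> 'a \<Rightarrow> bool" and b :: "'a set \<Rightarrow> nat" and x y :: real +
  assumes y3: "y ^ 3 = 1 / 2"
begin

lemma y_bounds: "y \<le> 794 / 1000" "79 / 100 \<le> y" "y\<^sup>2 \<le> 6305 / 10000"
proof -
  show 1: "y \<le> 794 / 1000"
  proof (rule ccontr)
    assume "\<not> ?thesis"
    then have "(794 / 1000) ^ 3 < y ^ 3" by (intro power_strict_mono) auto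
    then show False using y3 by (simp add: power_divide)
  qed
  show "79 / 100 \<le> y"
  proof (rule ccontr)
    assume "\<not> ?thesis"
    then have "y ^ 3 < (79 / 100) ^ 3" using y_pos by (intro power_strict_mono) auto
    then show False using y3 by (simp add: power_divide)
  qed
  have "y\<^sup>2 \<le> (794 / 1000)\<^sup>2" using 1 y_pos by (intro power_mono) auto
  then show "y\<^sup>2 \<le> 6305 / 10000" by (simp add: power_divide)
qed

lemma y1: "1 \<le> y + y\<^sup>2"
proof -
  have "(79 / 100)\<^sup>2 \<le> y\<^sup>2" using y_bounds(2) by (intro power_mono) auto
  then show ?thesis using y_bounds(2) by (simp add: power_divide)
qed

text \<open>With \<open>y ^ 3 = 1 / 2\<close> every power is a multiple of 1, \<open>y\<close> or
  \<open>y\<^sup>2\<close>, so each comparison of costs becomes linear arithmetic with the rational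
  bounds \<open>y_bounds\<close>.\<close>

lemma y_power_values: "y ^ 4 = y / 2" "y ^ 5 = y\<^sup>2 / 2" "y ^ 6 = 1 / 4" "y ^ 7 = y / 4" "y ^ 8 = y\<^sup>2 / 4" "y ^ 9 = 1 / 8"
proof -
  have "y ^ 4 = y ^ 3 * y" "y ^ 5 = y ^ 3 * y\<^sup>2" "y ^ 6 = y ^ 3 * y ^ 3" "y ^ 7 = y ^ 3 * y ^ 3 * y"
    "y ^ 8 = y ^ 3 * y ^ 3 * y\<^sup>2" "y ^ 9 = y ^ 3 * y ^ 3 * y ^ 3" by algebra+
  then show "y ^ 4 = y / 2" "y ^ 5 = y\<^sup>2 / 2" "y ^ 6 = 1 / 4" "y ^ 7 = y / 4" "y ^ 8 = y\<^sup>2 / 4" "y ^ 9 = 1 / 8"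
    unfolding y3 by simp_all
qed

lemma lam_power_values: "lam * y ^ 4 = y / 4 + y\<^sup>2 / 4" "lam * y ^ 5 = y\<^sup>2 / 4 + 1 / 8" "lam * y ^ 6 = 1 / 8 + y / 8"
  "lam * y ^ 7 = y / 8 + y\<^sup>2 / 8" "lam * lam * y ^ 5 = y\<^sup>2 / 8 + 1 / 8 + y / 16"
proof -
  have l: "lam = 1 / 2 + y / 2" by (simp add: lam_def y3 y_power_values)
  have y: "y * y = y\<^sup>2" "y * y\<^sup>2 = 1 / 2" using y3 by (simp_all add: power2_eq_square power3_eq_cube)
  show "lam * y ^ 4 = y / 4 + y\<^sup>2 / 4" by (simp add: l y_power_values y(1) algebra_simps)
  show 5: "lam * y ^ 5 = y\<^sup>2 / 4 + 1 / 8" by (simp add: l y_power_values y(2) algebra_simps)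
  show "lam * y ^ 6 = 1 / 8 + y / 8" by (simp add: l y_power_values)
  show "lam * y ^ 7 = y / 8 + y\<^sup>2 / 8" by (simp add: l y_power_values y(1) algebra_simps)
  have "lam * lam * y ^ 5 = lam * (y\<^sup>2 / 4 + 1 / 8)" by (simp only: mult.assoc 5)
  then show "lam * lam * y ^ 5 = y\<^sup>2 / 8 + 1 / 8 + y / 16" by (simp add: l y(2) algebra_simps)
qed

lemmas y_powers = y_power_values y3

definition K4free :: "'a set \<Rightarrow> bool" where
  "K4free S \<longleftrightarrow> (\<forall>p\<in>S. \<forall>q\<in>S. \<forall>r\<in>S. \<forall>s\<in>S. adj p q \<longrightarrow> adj p r \<longrightarrow> adj p s \<longrightarrow> adj q r \<longrightarrow> adj q s \<longrightarrow> adj r s \<longrightarrow> False)"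

lemma K4freeD:
  "K4free S \<Longrightarrow> p \<in> S \<Longrightarrow> q \<in> S \<Longrightarrow> r \<in> S \<Longrightarrow> s \<in> S \<Longrightarrow> adj p q \<Longrightarrow> adj p r \<Longrightarrow> adj p s \<Longrightarrow>
    adj q r \<Longrightarrow> adj q s \<Longrightarrow> \<not> adj r s"
  unfolding K4free_def by blast

lemma nadj_sym: "\<not> adj u v \<Longrightarrow> \<not> adj v u" using adj_sym by blast

lemma nb3:
  assumes "nb S v = {p, q, r}"
  shows "p \<in> S" "q \<in> S" "r \<in> S" "adj v p" "adj v q" "adj v r" "adj p v" "adj q v" "adj r v"
    "p \<noteq> v" "q \<noteq> v" "r \<noteq> v" "v \<noteq> p" "v \<noteq> q" "v \<noteq> r"
  using nbD[OF assms] by blast+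

lemma nb4:
  assumes "nb S v = {p, q, r, s}"
  shows "p \<in> S" "q \<in> S" "r \<in> S" "s \<in> S" "adj v p" "adj v q" "adj v r" "adj v s"
    "adj p v" "adj q v" "adj r v" "adj s v" "p \<noteq> v" "q \<noteq> v" "r \<noteq> v" "s \<noteq> v" "v \<noteq> p" "v \<noteq> q" "v \<noteq> r" "v \<noteq> s"
  using nbD[OF assms] by blast+

lemma nb5:
  assumes "nb S v = {p, q, r, s, t}"
  shows "p \<in> S" "q \<in> S" "r \<in> S" "s \<in> S" "t \<in> S" "adj v p" "adj v q" "adj v r" "adj v s" "adj v t"
    "adj p v" "adj q v" "adj r v" "adj s v" "adj t v"
    "p \<noteq> v" "q \<noteq> v" "r \<noteq> v" "s \<noteq> v" "t \<noteq> v" "v \<noteq> p" "v \<noteq> q" "v \<noteq> r" "v \<noteq> s" "v \<noteq> t"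
  using nbD[OF assms] by blast+

subsection \<open>Minimum degree three\<close>

text \<open>\<open>q\<close> is the middle of a path. If one end has degree 3, the branch at the
  other end removes \<open>v\<close> and \<open>q\<close> and makes it a leaf. If both ends have
  degree at least 4, plain counting is enough.\<close>

lemma deg3_two_edges:
  assumes ok: "ok S" and K: "K4free S" and min: "\<And>u. u \<in> S \<Longrightarrow> 3 \<le> deg S u"
    and v: "v \<in> S" and w: "nb S v = {q, p, r}" "distinct [q, p, r]" and e: "adj q p" "adj q r"
  shows "real (b S) \<le> x ^ card S"
proof -
  note fin = ok_finite[OF ok] and nw = nb3[OF w(1)]
  have n: "\<not> adj p r" by (rule K4freeD[OF K v, of q p r]) (simp_all add: nw e)
  have n': "\<not> adj r p" using n adj_sym by blast
  have d: "3 \<le> deg S p" "3 \<le> deg S q" "3 \<le> deg S r" using min nw by auto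
  show ?thesis
  proof (cases "4 \<le> deg S p \<and> 4 \<le> deg S r")
    case True
    show ?thesis
    proof (rule three_term_bound[OF expand3[OF fin v w]])
      show "real (b (S - {} - NN q)) \<le> y ^ 4 * x ^ card S"
        by (rule cut[OF ok, where d = 3 and Q = "{}"]) (use nw d in auto)
      show "real (b (S - {q} - NN p)) \<le> y ^ 5 * x ^ card S"
        by (rule cut[OF ok, where d = 4 and Q = "{}"]) (use nw True in auto)
      show "real (b (S - {q, p} - NN r)) \<le> y ^ 6 * x ^ card S"
        by (rule cut[OF ok, where d = 4 and Q = "{p}"]) (use nw True n n' w in auto)
      show "y ^ 4 + y ^ 5 + y ^ 6 \<le> 1" using y_bounds by (simp add: y_powers)
    qed
  next
    case False
    have key: ?thesis if a: "nb S v = {p, r, q}" "distinct [p, r, q]" "adj q p" "adj q r" "\<not> adj p r" "deg S r = 3"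
      "3 \<le> deg S p" "3 \<le> deg S q" for p r
    proof (rule three_term_bound[OF expand3[OF fin v a(1,2)]])
      note na = nb3[OF a(1)]
      show "real (b (S - {} - NN p)) \<le> y ^ (2 + 4) * x ^ card S"
        by (rule cut_leaf[OF ok, where d = 3 and Q = "{}" and u = r and B = "{v, q}"])
          (use na a a(3,4)[THEN adj_sym] a(5)[THEN nadj_sym] v in auto)
      show "real (b (S - {p} - NN r)) \<le> y ^ 5 * x ^ card S"
        by (rule cut[OF ok, where d = 3 and Q = "{p}"]) (use na a a(5)[THEN nadj_sym] in auto)
      show "real (b (S - {p, r} - NN q)) \<le> y ^ 4 * x ^ card S"
        by (rule cut[OF ok, where d = 3 and Q = "{}"]) (use na a in auto)
      show "y ^ (2 + 4) + y ^ 5 + y ^ 4 \<le> 1" using y_bounds by (simp add: y_powers)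
    qed
    show ?thesis
      using key[of p r] key[of r p] False d w e n n' by (auto simp: insert_commute)
  qed
qed

text \<open>If all three degrees are 3, the branch at \<open>a\<close> leaves \<open>p\<close> with
  degree at most two. Should \<open>p\<close> lie there in a triangle \<open>p\<close>,
  \<open>q\<close>, \<open>z\<close>, then \<open>q\<close> is adjacent to both other neighbours
  \<open>v\<close> and \<open>z\<close> of \<open>p\<close>, and \<open>deg3_two_edges\<close>
  applies at \<open>p\<close>.\<close>

lemma deg3_one_edge:
  assumes ok: "ok S" and K: "K4free S" and min: "\<And>u. u \<in> S \<Longrightarrow> 3 \<le> deg S u"
    and v: "v \<in> S" and w: "nb S v = {a, p, q}" "distinct [a, p, q]" and e: "adj p q" "\<not> adj a p" "\<not> adj a q"
  shows "real (b S) \<le> x ^ card S"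
proof -
  note e' = e e(1)[THEN adj_sym] e(2,3)[THEN nadj_sym]
  note fin = ok_finite[OF ok] and nw = nb3[OF w(1)]
  have d: "3 \<le> deg S p" "3 \<le> deg S q" "3 \<le> deg S a" using min nw by auto
  have gen: ?thesis
    if c: "real (b (S - {} - NN a)) \<le> c1 * x ^ card S" "k1 \<le> deg S p" "k2 \<le> deg S q" "c1 + y ^ (2 + k1) + y ^ (2 + k2) \<le> 1" for c1 k1 k2
  proof (rule three_term_bound[OF expand3[OF fin v w] c(1)])
    show "real (b (S - {a} - NN p)) \<le> y ^ (2 + k1) * x ^ card S"
      by (rule cut[OF ok, where d = k1 and Q = "{a}"]) (use nw c w e' in auto)
    show "real (b (S - {a, p} - NN q)) \<le> y ^ (2 + k2) * x ^ card S"
      by (rule cut[OF ok, where d = k2 and Q = "{a}"]) (use nw c w e' in auto)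
  qed (rule c(4))
  have c1: "real (b (S - {} - NN a)) \<le> y ^ (1 + k) * x ^ card S" if "k \<le> deg S a" for k
    by (rule cut[OF ok, where d = k and Q = "{}"]) (use nw that in auto)
  show ?thesis
  proof (cases "deg S a = 3 \<and> deg S p = 3 \<and> deg S q = 3")
    case False
    then consider "4 \<le> deg S a" | "4 \<le> deg S p" | "4 \<le> deg S q" using d by linarith
    then show ?thesis
      using gen[OF c1[of 4], of 3 3] gen[OF c1[of 3], of 4 3] gen[OF c1[of 3], of 3 4] d y_bounds
      by cases (simp_all add: y_powers)
  next
    case True
    show ?thesis
    proof (cases "isotri (S - {} - NN a) p")
      case False
      have "real (b (S - {} - NN a)) \<le> lam * y ^ 4 * x ^ card S"
        by (rule cut_low[OF ok, where d = 3 and Q = "{}" and u = p and B = "{v}"])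
          (use nw True e' w v y1 False in auto)
      moreover have "lam * y ^ 4 + y ^ (2 + 3) + y ^ (2 + 3) \<le> 1"
        using y_bounds unfolding lam_power_values by (simp add: y_powers)
      ultimately show ?thesis using gen[of "lam * y ^ 4" 3 3] d by blast
    next
      case iso: True
      let ?T = "S - {} - NN a"
      obtain s t where st: "s \<noteq> t" "adj s t" "nb ?T p = {s, t}" using iso unfolding isotri_def by blast
      have qT: "q \<in> nb ?T p" using nw e' w by auto
      then have "q \<in> {s, t}" unfolding st(3) .
      moreover have "{s, t} = {t, s}" by auto
      ultimately obtain z where z: "nb ?T p = {q, z}" "adj q z" using st adj_sym[OF st(2)] by (elim insertE) auto
      have zz: "z \<in> S" "adj p z" "z \<noteq> q" using nbD[OF z(1)] z(2) adj_irrefl by auto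
      have "z \<noteq> v" using nbD[OF z(1), of z] nw by auto
      have "nb S p = {q, v, z}"
      proof (rule card_subset_eq[OF finite_nb[OF fin], symmetric])
        show "{q, v, z} \<subseteq> nb S p" using nw e' zz v by auto
        show "card {q, v, z} = card (nb S p)"
          using True zz \<open>z \<noteq> v\<close> nw by (simp add: deg_def)
      qed
      then show ?thesis
        using deg3_two_edges[OF ok K min, of p q v z] nw zz \<open>z \<noteq> v\<close> z(2) by auto
    qed
  qed
qed

lemma deg3_no_edge:
  assumes ok: "ok S" and min: "\<And>u. u \<in> S \<Longrightarrow> 3 \<le> deg S u"
    and v: "v \<in> S" and w: "nb S v = {a, p, q}" "distinct [a, p, q]" and e: "\<not> adj p q" "\<not> adj a p" "\<not> adj a q"
  shows "real (b S) \<le> x ^ card S"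
proof (rule three_term_bound[OF expand3[OF ok_finite[OF ok] v w]])
  note nw = nb3[OF w(1)]
  have d: "3 \<le> deg S p" "3 \<le> deg S q" "3 \<le> deg S a" using min nw by auto
  show "real (b (S - {} - NN a)) \<le> y ^ 4 * x ^ card S"
    by (rule cut[OF ok, where d = 3 and Q = "{}"]) (use nw d in auto)
  show "real (b (S - {a} - NN p)) \<le> y ^ 5 * x ^ card S"
    by (rule cut[OF ok, where d = 3 and Q = "{a}"]) (use nw d w e e[THEN nadj_sym] in auto)
  show "real (b (S - {a, p} - NN q)) \<le> y ^ 6 * x ^ card S"
    by (rule cut[OF ok, where d = 3 and Q = "{a, p}"]) (use nw d w e e[THEN nadj_sym] in auto)
  show "y ^ 4 + y ^ 5 + y ^ 6 \<le> 1" using y_bounds by (simp add: y_powers)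
qed

lemma deg3:
  assumes ok: "ok S" and K: "K4free S" and v: "v \<in> S" "deg S v = 3" and min: "\<And>u. u \<in> S \<Longrightarrow> 3 \<le> deg S u"
  shows "real (b S) \<le> x ^ card S"
proof -
  obtain p q r where w: "nb S v = {p, q, r}" "distinct [p, q, r]"
    using v(2) by (auto simp: deg_def card_Suc_eq eval_nat_numeral)
  note nw = nb3[OF w(1)]
  have "\<not> adj q r" if "adj p q" "adj p r"
    by (rule K4freeD[OF K v(1), of p q r]) (simp_all add: nw that)
  then show ?thesis
    using deg3_two_edges[OF ok K min v(1), of p q r] deg3_two_edges[OF ok K min v(1), of q p r]
      deg3_two_edges[OF ok K min v(1), of r p q] deg3_one_edge[OF ok K min v(1), of p q r]
      deg3_one_edge[OF ok K min v(1), of q p r] deg3_one_edge[OF ok K min v(1), of r p q]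
      deg3_no_edge[OF ok min v(1), of p q r] w adj_sym[of p q] adj_sym[of q p] adj_sym[of p r] adj_sym[of r p]
      adj_sym[of q r] adj_sym[of r q]
    by (auto simp: insert_commute)
qed

subsection \<open>Minimum degree four\<close>

text \<open>Counting without savings inside branches: \<open>Q2\<close>, \<open>Q3\<close>,
  \<open>Q4\<close> are the earlier neighbours not adjacent to the current one.\<close>

lemma order4:
  assumes ok: "ok S" and v: "v \<in> S" and w: "nb S v = {w1, w2, w3, w4}" "distinct [w1, w2, w3, w4]"
    and k: "k1 \<le> deg S w1" "k2 \<le> deg S w2" "k3 \<le> deg S w3" "k4 \<le> deg S w4"
    and Q: "Q2 \<subseteq> {w1}" "Q3 \<subseteq> {w1, w2}" "Q4 \<subseteq> {w1, w2, w3}"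
      "Q2 \<inter> NN w2 = {}" "Q3 \<inter> NN w3 = {}" "Q4 \<inter> NN w4 = {}"
    and sum: "y ^ (1 + k1) + y ^ (1 + k2 + card Q2) + y ^ (1 + k3 + card Q3) + y ^ (1 + k4 + card Q4) \<le> 1"
  shows "real (b S) \<le> x ^ card S"
proof (rule four_term_bound[OF expand4[OF ok_finite[OF ok] v w] _ _ _ _ sum])
  note nw = nb4[OF w(1)]
  show "real (b (S - {} - NN w1)) \<le> y ^ (1 + k1) * x ^ card S"
    by (rule cut[OF ok, where d = k1 and Q = "{}"]) (use nw k in auto)
  show "real (b (S - {w1} - NN w2)) \<le> y ^ (1 + k2 + card Q2) * x ^ card S"
    by (rule cut[OF ok, where d = k2 and Q = Q2]) (use nw k Q in blast)+
  show "real (b (S - {w1, w2} - NN w3)) \<le> y ^ (1 + k3 + card Q3) * x ^ card S"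
    by (rule cut[OF ok, where d = k3 and Q = Q3]) (use nw k Q in blast)+
  show "real (b (S - {w1, w2, w3} - NN w4)) \<le> y ^ (1 + k4 + card Q4) * x ^ card S"
    by (rule cut[OF ok, where d = k4 and Q = Q4]) (use nw k Q in blast)+
qed

text \<open>If \<open>q\<close> has degree 4, it becomes a leaf once \<open>r\<close> and
  \<open>p\<close> are deleted and the branch at \<open>s\<close> has taken \<open>v\<close>.
  Reversing the path treats \<open>r\<close> in the same way; otherwise both inner vertices have
  degree at least 5.\<close>

lemma deg4_path:
  assumes ok: "ok S" and min: "\<And>u. u \<in> S \<Longrightarrow> 4 \<le> deg S u"
    and v: "v \<in> S" and w: "nb S v = {p, q, r, s}" "distinct [p, q, r, s]"
    and e: "adj p q" "adj q r" "adj r s" "\<not> adj p r" "\<not> adj p s" "\<not> adj q s"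
  shows "real (b S) \<le> x ^ card S"
proof -
  note fin = ok_finite[OF ok]
  have key: ?thesis
    if w: "nb S v = {r, p, s, q}" "distinct [r, p, s, q]"
      and e: "adj p q" "adj q r" "adj r s" "\<not> adj p r" "\<not> adj p s" "\<not> adj q s" and q: "deg S q = 4" for p q r s
  proof (rule four_term_bound[OF expand4[OF fin v w]])
    note nw = nb4[OF w(1)] and e' = e e(1-3)[THEN adj_sym] e(4-6)[THEN nadj_sym]
    have d: "4 \<le> deg S p" "4 \<le> deg S q" "4 \<le> deg S r" "4 \<le> deg S s" using min nw by auto
    show "real (b (S - {} - NN r)) \<le> y ^ 5 * x ^ card S"
      by (rule cut[OF ok, where d = 4 and Q = "{}"]) (use nw d in auto)
    show "real (b (S - {r} - NN p)) \<le> y ^ 6 * x ^ card S"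
      by (rule cut[OF ok, where d = 4 and Q = "{r}"]) (use nw d e' w(2) in auto)
    show "real (b (S - {r, p} - NN s)) \<le> y ^ (2 + 6) * x ^ card S"
      by (rule cut_leaf[OF ok, where d = 4 and Q = "{p}" and u = q and B = "{v, p, r}"])
        (use nw d e' w(2) v q in auto)
    show "real (b (S - {r, p, s} - NN q)) \<le> y ^ 6 * x ^ card S"
      by (rule cut[OF ok, where d = 4 and Q = "{s}"]) (use nw d e' w(2) in auto)
    show "y ^ 5 + y ^ 6 + y ^ (2 + 6) + y ^ 6 \<le> 1" using y_bounds by (simp add: y_powers)
  qed
  note nw = nb4[OF w(1)] and e' = e e(1-3)[THEN adj_sym] e(4-6)[THEN nadj_sym]
  have d: "4 \<le> deg S p" "4 \<le> deg S q" "4 \<le> deg S r" "4 \<le> deg S s" using min nw by auto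
  show ?thesis
  proof (cases "deg S q = 4 \<or> deg S r = 4")
    case True
    then show ?thesis using key[of r p s q] key[of q s p r] w e' by (auto simp: insert_commute)
  next
    case False
    then have "5 \<le> deg S q" "5 \<le> deg S r" using d by auto
    then show ?thesis
      using order4[OF ok v, of r p s q 5 4 4 5 "{r}" "{p}" "{s}"] w d e' y_bounds by (auto simp: y_powers insert_commute)
  qed
qed

text \<open>The two pairs of opposite vertices are handled separately, each at cost
  \<open>y ^ 6 + y ^ 7\<close>: either one vertex of the pair becomes a leaf in the branch at the
  other, or both have degree at least 5.\<close>

lemma deg4_cycle:
  assumes ok: "ok S" and min: "\<And>u. u \<in> S \<Longrightarrow> 4 \<le> deg S u"
    and v: "v \<in> S" and w: "nb S v = {a, p, c, q}" "distinct [a, p, c, q]"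
    and e: "adj a p" "adj p c" "adj c q" "adj q a" "\<not> adj a c" "\<not> adj p q"
  shows "real (b S) \<le> x ^ card S"
proof -
  note fin = ok_finite[OF ok]
  have key: ?thesis
    if w: "nb S v = {a, p, c, q}" "distinct [a, p, c, q]"
      and e: "adj a p" "adj p c" "adj c q" "adj q a" "\<not> adj a c" "\<not> adj p q"
      and D: "deg S c = 4 \<or> (5 \<le> deg S a \<and> 5 \<le> deg S c)" "deg S q = 4 \<or> (5 \<le> deg S p \<and> 5 \<le> deg S q)" for a p c q
  proof -
    note nw = nb4[OF w(1)] and e' = e e(1-4)[THEN adj_sym] e(5,6)[THEN nadj_sym]
    have d: "4 \<le> deg S p" "4 \<le> deg S q" "4 \<le> deg S a" "4 \<le> deg S c" using min nw by auto
    have "\<exists>c1 c3. real (b (S - {} - NN a)) \<le> c1 * x ^ card S \<and> real (b (S - {a, p} - NN c)) \<le> c3 * x ^ card S \<and> c1 + c3 \<le> y ^ 6 + y ^ 7"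
    proof (cases "deg S c = 4")
      case True
      have "real (b (S - {} - NN a)) \<le> y ^ (2 + 5) * x ^ card S"
        by (rule cut_leaf[OF ok, where d = 4 and Q = "{}" and u = c and B = "{v, p, q}"])
          (use nw d e' w(2) v True in auto)
      moreover have "real (b (S - {a, p} - NN c)) \<le> y ^ 6 * x ^ card S"
        by (rule cut[OF ok, where d = 4 and Q = "{a}"]) (use nw d e' w(2) in auto)
      ultimately show ?thesis by (intro exI[of _ "y ^ (2 + 5)"] exI[of _ "y ^ 6"]) simp
    next
      case False
      have "real (b (S - {} - NN a)) \<le> y ^ 6 * x ^ card S"
        by (rule cut[OF ok, where d = 5 and Q = "{}"]) (use nw False D in auto)
      moreover have "real (b (S - {a, p} - NN c)) \<le> y ^ 7 * x ^ card S"
        by (rule cut[OF ok, where d = 5 and Q = "{a}"]) (use nw False D e' w(2) in auto)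
      ultimately show ?thesis by (intro exI[of _ "y ^ 6"] exI[of _ "y ^ 7"]) simp
    qed
    then obtain c1 c3 where c13: "real (b (S - {} - NN a)) \<le> c1 * x ^ card S"
      "real (b (S - {a, p} - NN c)) \<le> c3 * x ^ card S" "c1 + c3 \<le> y ^ 6 + y ^ 7" by blast
    have "\<exists>c2 c4. real (b (S - {a} - NN p)) \<le> c2 * x ^ card S \<and> real (b (S - {a, p, c} - NN q)) \<le> c4 * x ^ card S \<and> c2 + c4 \<le> y ^ 6 + y ^ 7"
    proof (cases "deg S q = 4")
      case True
      have "real (b (S - {a} - NN p)) \<le> y ^ (2 + 5) * x ^ card S"
        by (rule cut_leaf[OF ok, where d = 4 and Q = "{}" and u = q and B = "{v, a, c}"])
          (use nw d e' w(2) v True in auto)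
      moreover have "real (b (S - {a, p, c} - NN q)) \<le> y ^ 6 * x ^ card S"
        by (rule cut[OF ok, where d = 4 and Q = "{p}"]) (use nw d e' w(2) in auto)
      ultimately show ?thesis by (intro exI[of _ "y ^ (2 + 5)"] exI[of _ "y ^ 6"]) simp
    next
      case False
      have "real (b (S - {a} - NN p)) \<le> y ^ 6 * x ^ card S"
        by (rule cut[OF ok, where d = 5 and Q = "{}"]) (use nw False D in auto)
      moreover have "real (b (S - {a, p, c} - NN q)) \<le> y ^ 7 * x ^ card S"
        by (rule cut[OF ok, where d = 5 and Q = "{p}"]) (use nw False D e' w(2) in auto)
      ultimately show ?thesis by (intro exI[of _ "y ^ 6"] exI[of _ "y ^ 7"]) simp
    qed
    then obtain c2 c4 where c24: "real (b (S - {a} - NN p)) \<le> c2 * x ^ card S"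
      "real (b (S - {a, p, c} - NN q)) \<le> c4 * x ^ card S" "c2 + c4 \<le> y ^ 6 + y ^ 7" by blast
    show ?thesis
    proof (rule four_term_bound[OF expand4[OF fin v w] c13(1) c24(1) c13(2) c24(2)])
      show "c1 + c2 + c3 + c4 \<le> 1" using c13(3) c24(3) y_bounds by (simp add: y_powers)
    qed
  qed
  note nw = nb4[OF w(1)] and e' = e e(1-4)[THEN adj_sym] e(5,6)[THEN nadj_sym]
  have d: "4 \<le> deg S p" "4 \<le> deg S q" "4 \<le> deg S a" "4 \<le> deg S c" using min nw by auto
  have D: "(deg S c = 4 \<or> (5 \<le> deg S a \<and> 5 \<le> deg S c)) \<or> (deg S a = 4 \<or> (5 \<le> deg S c \<and> 5 \<le> deg S a))"
    "(deg S q = 4 \<or> (5 \<le> deg S p \<and> 5 \<le> deg S q)) \<or> (deg S p = 4 \<or> (5 \<le> deg S q \<and> 5 \<le> deg S p))"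
    using d by linarith+
  have s: "nb S v = {a, q, c, p}" "nb S v = {c, p, a, q}" "nb S v = {c, q, a, p}" using w(1) by auto
  show ?thesis
    using key[OF w(1), OF w(2)] key[OF s(1)] key[OF s(2)] key[OF s(3)] w(2) e' D by auto
qed

text \<open>The plain count \<open>y ^ 5 + 2 * y ^ 6 + y ^ 7\<close> exceeds 1 by little, so one
  degree above 4 is enough. If all are 4, the branch at \<open>c\<close> leaves \<open>a\<close>
  with degree at most two.\<close>

lemma deg4_path3:
  assumes ok: "ok S" and min: "\<And>u. u \<in> S \<Longrightarrow> 4 \<le> deg S u"
    and v: "v \<in> S" and w: "nb S v = {k, a, m, c}" "distinct [k, a, m, c]"
    and e: "adj a m" "adj m c" "\<not> adj a c" "\<not> adj k a" "\<not> adj k m" "\<not> adj k c"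
  shows "real (b S) \<le> x ^ card S"
proof -
  note fin = ok_finite[OF ok] and nw = nb4[OF w(1)] and e' = e e(1-2)[THEN adj_sym] e(3-6)[THEN nadj_sym]
  have d: "4 \<le> deg S k" "4 \<le> deg S a" "4 \<le> deg S m" "4 \<le> deg S c" using min nw by auto
  note o4 = order4[OF ok v w, where ?Q2.0 = "{k}" and ?Q3.0 = "{k}" and ?Q4.0 = "{k, a}"]
  consider "5 \<le> deg S k" | "5 \<le> deg S a" | "5 \<le> deg S m" | "5 \<le> deg S c"
    | "deg S k = 4" "deg S a = 4" "deg S m = 4" "deg S c = 4" using d by linarith
  then show ?thesis
  proof cases
    case 1
    then show ?thesis using o4[of 5 4 4 4] w(2) d e' y_bounds by (auto simp: y_powers)
  next
    case 2
    then show ?thesis using o4[of 4 5 4 4] w(2) d e' y_bounds by (auto simp: y_powers)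
  next
    case 3
    then show ?thesis using o4[of 4 4 5 4] w(2) d e' y_bounds by (auto simp: y_powers)
  next
    case 4
    then show ?thesis using o4[of 4 4 4 5] w(2) d e' y_bounds by (auto simp: y_powers)
  next
    case D: 5
    let ?T = "S - {k} - NN c"
    show ?thesis
    proof (cases "isotri ?T a")
      case False
      have w': "nb S v = {k, c, m, a}" "distinct [k, c, m, a]" using w by auto
      show ?thesis
      proof (rule four_term_bound[OF expand4[OF fin v w']])
        show "real (b (S - {} - NN k)) \<le> y ^ 5 * x ^ card S"
          by (rule cut[OF ok, where d = 4 and Q = "{}"]) (use nw d in auto)
        show "real (b (S - {k} - NN c)) \<le> lam * y ^ 6 * x ^ card S"
          by (rule cut_low[OF ok, where d = 4 and Q = "{k}" and u = a and B = "{v, m}"])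
            (use nw d e' w(2) v D y1 False in auto)
        show "real (b (S - {k, c} - NN m)) \<le> y ^ 6 * x ^ card S"
          by (rule cut[OF ok, where d = 4 and Q = "{k}"]) (use nw d e' w(2) in auto)
        show "real (b (S - {k, c, m} - NN a)) \<le> y ^ 7 * x ^ card S"
          by (rule cut[OF ok, where d = 4 and Q = "{k, c}"]) (use nw d e' w(2) in auto)
        show "y ^ 5 + lam * y ^ 6 + y ^ 6 + y ^ 7 \<le> 1" using y_bounds unfolding lam_power_values by (simp add: y_powers)
      qed
    next
      case True
      \<comment> \<open>If that saving fails, the order is changed: with \<open>a\<close> deleted
        before the branch at \<open>c\<close>, its triangle partner \<open>a1\<close> becomes a
        leaf.\<close>
      then obtain a1 a2 where a12: "a1 \<noteq> a2" "nb ?T a = {a1, a2}" "nb ?T a1 = {a, a2}"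
        unfolding isotri_def by blast
      have a1: "a1 \<in> S" "a1 \<noteq> k" "a1 \<notin> NN c" "a1 \<noteq> a" "adj a1 a" using nbD[OF a12(2), of a1] by auto
      have "a1 \<noteq> m" using a1(3) e' by auto
      let ?R = "S - {k, a, m} - NN c"
      have aR: "a1 \<in> ?R" using a1 \<open>a1 \<noteq> m\<close> by auto
      have "nb ?R a1 \<subseteq> {a2}" using a12(3) by (auto simp: nb_def)
      then have "deg ?R a1 \<le> 1" unfolding deg_def by (metis card_mono card_1_singleton_iff One_nat_def finite.emptyI finite.insertI)
      then have leafR: "real (b ?R) \<le> y ^ 2 * x ^ card ?R"
        using leaf[OF ok_subset[OF ok] aR] by blast
      show ?thesis
      proof (rule four_term_bound[OF expand4[OF fin v w]])
        show "real (b (S - {} - NN k)) \<le> y ^ 5 * x ^ card S"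
          by (rule cut[OF ok, where d = 4 and Q = "{}"]) (use nw d in auto)
        show "real (b (S - {k} - NN a)) \<le> y ^ 6 * x ^ card S"
          by (rule cut[OF ok, where d = 4 and Q = "{k}"]) (use nw d e' w(2) in auto)
        show "real (b (S - {k, a} - NN m)) \<le> y ^ 6 * x ^ card S"
          by (rule cut[OF ok, where d = 4 and Q = "{k}"]) (use nw d e' w(2) in auto)
        show "real (b (S - {k, a, m} - NN c)) \<le> y ^ 2 * y ^ 7 * x ^ card S"
          by (rule cut_gain[OF ok, where d = 4 and Q = "{k, a}"]) (use nw d e' w leafR in auto)
        have e9: "y ^ 2 * y ^ 7 = y ^ 9" by (simp flip: power_add)
        show "y ^ 5 + y ^ 6 + y ^ 6 + y ^ 2 * y ^ 7 \<le> 1" unfolding e9 using y_bounds by (simp add: y_powers)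
      qed
    qed
  qed
qed

lemma deg4_sparse:
  assumes ok: "ok S" and min: "\<And>u. u \<in> S \<Longrightarrow> 4 \<le> deg S u"
    and v: "v \<in> S" and w: "nb S v = {p, q, r, s}" "distinct [p, q, r, s]"
    and e: "\<not> adj p q" "\<not> adj p r" "\<not> adj p s" "\<not> adj q r" "\<not> adj q s"
  shows "real (b S) \<le> x ^ card S"
proof -
  have d: "4 \<le> deg S p" "4 \<le> deg S q" "4 \<le> deg S r" "4 \<le> deg S s" using min nb4[OF w(1)] by auto
  show ?thesis
    using order4[OF ok v w, of 4 4 4 4 "{p}" "{p, q}" "{p, q}"] w(2) d e e[THEN nadj_sym] y_bounds
    by (auto simp: y_powers)
qed

section \<open>Neighbourhoods of \<open>v\<close> that are stars with centre
  \<open>q\<close>\<close>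

definition star :: "'a set \<Rightarrow> 'a \<Rightarrow> 'a \<Rightarrow> 'a \<Rightarrow> 'a \<Rightarrow> 'a \<Rightarrow> bool" where
  "star S v q p r s \<longleftrightarrow> v \<in> S \<and> nb S v = {q, p, r, s} \<and> distinct [q, p, r, s] \<and>
     adj q p \<and> adj q r \<and> adj q s \<and> \<not> adj p r \<and> \<not> adj p s \<and> \<not> adj r s"

lemma star_swap: "star S v q p r s \<Longrightarrow> star S v q r p s" "star S v q p r s \<Longrightarrow> star S v q p s r"
  using nadj_sym by (auto simp: star_def insert_commute)

lemma starD:
  assumes "star S v q p r s"
  shows "v \<in> S" "nb S v = {q, p, r, s}" "distinct [q, p, r, s]"
    "adj q p" "adj q r" "adj q s" "adj p q" "adj r q" "adj s q"
    "\<not> adj p r" "\<not> adj p s" "\<not> adj r s" "\<not> adj r p" "\<not> adj s p" "\<not> adj s r"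
  using assms adj_sym nadj_sym unfolding star_def by blast+

lemma nb_mem: "nb S u = A \<Longrightarrow> t \<in> S \<Longrightarrow> adj u t \<Longrightarrow> t \<in> A"
  by auto

lemma nb_full:
  assumes "finite S" "nb S z \<subseteq> {a, c, e, f}" "4 \<le> deg S z"
  shows "nb S z = {a, c, e, f}"
proof (rule card_seteq)
  have "card {a, c, e, f} \<le> 4" by (simp add: card_insert_if)
  then show "card {a, c, e, f} \<le> card (nb S z)" using assms(3) by (simp add: deg_def)
qed (use assms in auto)

lemma nb_two_more:
  assumes "finite S" "deg S u = 4" "v \<in> nb S u" "q \<in> nb S u" "v \<noteq> q"
  shows "\<exists>e f. nb S u = {v, q, e, f} \<and> distinct [v, q, e, f]"
proof -
  have "card (nb S u - {v, q}) = 2"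
    using assms finite_nb[OF assms(1), of u] by (simp add: deg_def card_Diff_subset)
  then obtain e f where ef: "nb S u - {v, q} = {e, f}" "e \<noteq> f" by (auto simp: card_2_iff)
  have "e \<in> nb S u - {v, q}" "f \<in> nb S u - {v, q}" unfolding ef(1) by simp_all
  then have "distinct [v, q, e, f]" using assms(5) ef(2) by auto
  moreover have "nb S u = {v, q, e, f}" using ef(1) assms(3,4) by blast
  ultimately show ?thesis by blast
qed

lemma isotri_outer4:
  assumes "finite S" "deg S u = 4" "isotri T u" "T = S - R - NN w"
    "v \<in> nb S u" "q \<in> nb S u" "v \<noteq> q" "v \<notin> T" "q \<notin> T"
  shows "\<exists>e f. nb S u = {v, q, e, f} \<and> distinct [v, q, e, f] \<and> adj e f \<and> e \<in> T \<and> f \<in> T \<and>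
    nb T e = {u, f} \<and> nb T f = {u, e}"
proof -
  obtain e f where ef: "e \<noteq> f" "adj e f" "nb T u = {e, f}" "nb T e = {u, f}" "nb T f = {u, e}"
    using assms(3) unfolding isotri_def by blast
  have m: "e \<in> T" "f \<in> T" "adj u e" "adj u f" using nbD[OF ef(3)] by auto
  have dis: "distinct [v, q, e, f]" using m assms ef(1) by auto
  have "{v, q, e, f} = nb S u"
  proof (rule card_subset_eq[OF finite_nb[OF assms(1)]])
    show "{v, q, e, f} \<subseteq> nb S u" using m assms by auto
    show "card {v, q, e, f} = card (nb S u)" using dis assms(2) by (simp add: deg_def)
  qed
  then show ?thesis using ef m dis by metis
qed

text \<open>A vertex \<open>z\<close> of the triangle component of \<open>r\<close> is not adjacent
  to \<open>v\<close>, so any neighbour of \<open>z\<close> lost in the branch is \<open>q\<close>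
  or one of the outer neighbours \<open>p1\<close>, \<open>p2\<close> of \<open>p\<close>.\<close>

lemma star_outer_nb:
  assumes st: "star S v q p r s" and p: "nb S p = {v, q, p1, p2}"
    and z: "z \<in> S - {q} - NN p" "adj r z" "nb (S - {q} - NN p) z \<subseteq> {r, z'}"
  shows "nb S z \<subseteq> {r, z', q, p1, p2}"
proof
  note stD = starD[OF st]
  fix t assume t: "t \<in> nb S z"
  have "\<not> adj z v"
  proof
    assume "adj z v"
    then have "z \<in> {q, p, r, s}" using nb_mem[OF stD(2)] adj_sym z(1) by blast
    then show False using z(1,2) stD(4-) adj_irrefl by auto
  qed
  show "t \<in> {r, z', q, p1, p2}"
  proof (cases "t \<in> S - {q} - NN p")
    case True
    then show ?thesis using z(3) t by auto
  next
    case False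
    then have "t = q \<or> t = p \<or> adj p t" using t by auto
    moreover have "t \<noteq> p" using t z(1) adj_sym by auto
    moreover have "t \<noteq> v" using t \<open>\<not> adj z v\<close> by auto
    ultimately show ?thesis using nb_mem[OF p, of t] t by auto
  qed
qed

text \<open>If both savings failed, the outer neighbours \<open>r1\<close>, \<open>r2\<close> of
  \<open>r\<close> would have almost no choice of neighbours: were \<open>q\<close> adjacent to
  neither, both would be joined to \<open>p1\<close> and \<open>p2\<close>, giving a K_4. The same
  holds with \<open>p\<close> and \<open>r\<close> exchanged. So \<open>q\<close> gets two further
  neighbours and has degree at least 6.\<close>

lemma star_two_iso:
  assumes ok: "ok S" and K: "K4free S" and min: "\<And>u. u \<in> S \<Longrightarrow> 4 \<le> deg S u"
    and st: "star S v q p r s" and dq: "deg S q \<le> 5" and d: "deg S p = 4" "deg S r = 4"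
    and iso: "isotri (S - {q} - NN p) r" "isotri (S - {q} - NN r) p"
  shows False
proof -
  note fin = ok_finite[OF ok] and stD = starD[OF st] and nw = nb4[OF starD(2)[OF st]]
  let ?T = "S - {q} - NN p" and ?T' = "S - {q} - NN r"
  obtain r1 r2 where r: "nb S r = {v, q, r1, r2}" "distinct [v, q, r1, r2]" "adj r1 r2" "r1 \<in> ?T" "r2 \<in> ?T"
    "nb ?T r1 = {r, r2}" "nb ?T r2 = {r, r1}"
    using isotri_outer4[OF fin d(2) iso(1) refl, of v q] nw stD by auto
  obtain p1 p2 where p: "nb S p = {v, q, p1, p2}" "distinct [v, q, p1, p2]" "adj p1 p2" "p1 \<in> ?T'" "p2 \<in> ?T'"
    "nb ?T' p1 = {p, p2}" "nb ?T' p2 = {p, p1}"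
    using isotri_outer4[OF fin d(1) iso(2) refl, of v q] nw stD by auto
  note nr = nb4[OF r(1)] and np = nb4[OF p(1)]
  have sub: "nb S r1 \<subseteq> {r, r2, q, p1, p2}" "nb S r2 \<subseteq> {r, r1, q, p1, p2}"
    using star_outer_nb[OF st p(1)] r nr by auto
  have sub': "nb S p1 \<subseteq> {p, p2, q, r1, r2}" "nb S p2 \<subseteq> {p, p1, q, r1, r2}"
    using star_outer_nb[OF star_swap(1)[OF st] r(1)] p np by auto
  have "adj q r1 \<or> adj q r2"
  proof (rule ccontr)
    assume n: "\<not> ?thesis"
    then have "nb S r1 \<subseteq> {r, r2, p1, p2}" "nb S r2 \<subseteq> {r, r1, p1, p2}" using sub adj_sym by auto
    then have "nb S r1 = {r, r2, p1, p2}" "nb S r2 = {r, r1, p1, p2}"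
      using nb_full[OF fin] min nr by auto
    then have "adj r1 p1" "adj r1 p2" "adj r2 p1" "adj r2 p2" by (auto simp: set_eq_iff)
    then show False using K4freeD[OF K, of r1 r2 p1 p2] nr np r(3) p(3) by blast
  qed
  then obtain r' where r': "r' \<in> {r1, r2}" "adj q r'" by blast
  have "adj q p1 \<or> adj q p2"
  proof (rule ccontr)
    assume n: "\<not> ?thesis"
    then have "nb S p1 \<subseteq> {p, p2, r1, r2}" "nb S p2 \<subseteq> {p, p1, r1, r2}" using sub' adj_sym by auto
    then have "nb S p1 = {p, p2, r1, r2}" "nb S p2 = {p, p1, r1, r2}"
      using nb_full[OF fin] min np by auto
    then have "adj p1 r1" "adj p1 r2" "adj p2 r1" "adj p2 r2" by (auto simp: set_eq_iff)
    then show False using K4freeD[OF K, of p1 p2 r1 r2] nr np r(3) p(3) by blast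
  qed
  then obtain p' where p': "p' \<in> {p1, p2}" "adj q p'" by blast
  have m: "r' \<in> S" "adj r r'" "\<not> adj p r'" "r' \<noteq> v" "r' \<noteq> p" "p' \<in> S" "adj p p'" "\<not> adj r p'" "p' \<noteq> v" "p' \<noteq> r"
    using r' p' nr np r(2,4,5) p(2,4,5) by auto
  have "{v, p, r, s, r', p'} \<subseteq> nb S q" using m nw stD r' p' by auto
  moreover have "distinct [v, p, r, s, r', p']" using m nw stD adj_irrefl by auto
  ultimately have "6 \<le> deg S q" using deg_ge[OF fin, of "{v, p, r, s, r', p'}" q] by simp
  then show False using dq by simp
qed

lemma star_centre5:
  assumes ok: "ok S" and K: "K4free S" and min: "\<And>u. u \<in> S \<Longrightarrow> 4 \<le> deg S u"
    and st: "star S v q p r s" and dq: "deg S q = 5" and d: "deg S p = 4" "deg S r = 4"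
  shows "real (b S) \<le> x ^ card S"
proof -
  have key: ?thesis
    if st: "star S v q p r s" and d: "deg S p = 4" "deg S r = 4" and iso: "\<not> isotri (S - {q} - NN p) r" for p r
  proof (rule four_term_bound[OF expand4[OF ok_finite[OF ok] starD(1-3)[OF st]]])
    note stD = starD(1,3-)[OF st] and nw = nb4[OF starD(2)[OF st]]
    have ds: "4 \<le> deg S s" using min nw by auto
    show "real (b (S - {} - NN q)) \<le> y ^ 6 * x ^ card S"
      by (rule cut[OF ok, where d = 5 and Q = "{}"]) (use nw dq in auto)
    show "real (b (S - {q} - NN p)) \<le> lam * y ^ 5 * x ^ card S"
      by (rule cut_low[OF ok, where d = 4 and Q = "{}" and u = r and B = "{v, q}"])
        (use nw d stD y1 iso in auto)
    show "real (b (S - {q, p} - NN r)) \<le> y ^ 6 * x ^ card S"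
      by (rule cut[OF ok, where d = 4 and Q = "{p}"]) (use nw d stD in auto)
    show "real (b (S - {q, p, r} - NN s)) \<le> y ^ 7 * x ^ card S"
      by (rule cut[OF ok, where d = 4 and Q = "{p, r}"]) (use nw ds stD in auto)
    show "y ^ 6 + lam * y ^ 5 + y ^ 6 + y ^ 7 \<le> 1" using y_bounds unfolding lam_power_values by (simp add: y_powers)
  qed
  show ?thesis
    using key[OF st d] key[OF star_swap(1)[OF st] d(2,1)] star_two_iso[OF ok K min st _ d] dq by auto
qed

text \<open>One saving in the branch at \<open>s\<close> or at \<open>p\<close> is enough. If none
  occurs, a neighbour of \<open>r1\<close> outside its triangle would be adjacent to both
  \<open>s\<close> and \<open>p\<close>; but the outer neighbours of \<open>p\<close> are not
  adjacent to \<open>s\<close>. Then \<open>r1\<close> has degree at most 2, below the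
  minimum.\<close>

lemma star_leaf5:
  assumes ok: "ok S" and K: "K4free S" and min: "\<And>u. u \<in> S \<Longrightarrow> 4 \<le> deg S u"
    and st: "star S v q s p r" and d: "deg S q = 4" "deg S p = 4" "deg S r = 4" "5 \<le> deg S s"
  shows "real (b S) \<le> x ^ card S"
proof -
  note fin = ok_finite[OF ok] and stD = starD(1,3-)[OF st] and nw = nb4[OF starD(2)[OF st]]
  let ?T1 = "S - {q} - NN s" and ?T2 = "S - {q, s} - NN p"
  have gen: ?thesis
    if c: "real (b ?T1) \<le> c1 * x ^ card S" "real (b ?T2) \<le> c2 * x ^ card S" "y ^ 5 + c1 + c2 + y ^ 7 \<le> 1" for c1 c2
  proof (rule four_term_bound[OF expand4[OF fin starD(1-3)[OF st]] _ c(1,2) _ c(3)])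
    show "real (b (S - {} - NN q)) \<le> y ^ 5 * x ^ card S"
      by (rule cut[OF ok, where d = 4 and Q = "{}"]) (use nw d in auto)
    show "real (b (S - {q, s, p} - NN r)) \<le> y ^ 7 * x ^ card S"
      by (rule cut[OF ok, where d = 4 and Q = "{s, p}"]) (use nw d stD in auto)
  qed
  have b1: "real (b ?T1) \<le> y ^ 6 * x ^ card S"
    by (rule cut[OF ok, where d = 5 and Q = "{}"]) (use nw d in auto)
  have b2: "real (b ?T2) \<le> y ^ 6 * x ^ card S"
    by (rule cut[OF ok, where d = 4 and Q = "{s}"]) (use nw d stD in auto)
  have l1: "y ^ 5 + lam * y ^ 6 + y ^ 6 + y ^ 7 \<le> 1" "y ^ 5 + y ^ 6 + lam * y ^ 6 + y ^ 7 \<le> 1"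
    using y_bounds unfolding lam_power_values by (simp_all add: y_powers)
  show ?thesis
  proof (cases "isotri ?T1 p \<and> isotri ?T1 r \<and> isotri ?T2 r")
    case False
    then consider "\<not> isotri ?T1 p" | "\<not> isotri ?T1 r" | "\<not> isotri ?T2 r" by blast
    then show ?thesis
    proof cases
      case 1
      have "real (b ?T1) \<le> lam * y ^ 6 * x ^ card S"
        by (rule cut_low[OF ok, where d = 5 and Q = "{}" and u = p and B = "{v, q}"])
          (use nw d stD y1 1 in auto)
      then show ?thesis using gen b2 l1 by blast
    next
      case 2
      have "real (b ?T1) \<le> lam * y ^ 6 * x ^ card S"
        by (rule cut_low[OF ok, where d = 5 and Q = "{}" and u = r and B = "{v, q}"])
          (use nw d stD y1 2 in auto)
      then show ?thesis using gen b2 l1 by blast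
    next
      case 3
      have "real (b ?T2) \<le> lam * y ^ 6 * x ^ card S"
        by (rule cut_low[OF ok, where d = 4 and Q = "{s}" and u = r and B = "{v, q}"])
          (use nw d stD y1 3 in auto)
      then show ?thesis using gen b1 l1 by blast
    qed
  next
    case True
    obtain p1 p2 where p: "nb S p = {v, q, p1, p2}" "p1 \<in> ?T1" "p2 \<in> ?T1"
      using isotri_outer4[OF fin d(2) _ refl, of "{q}" s v q] True nw stD by auto
    obtain r1 r2 where r: "nb S r = {v, q, r1, r2}" "distinct [v, q, r1, r2]" "r1 \<in> ?T1" "r2 \<in> ?T1" "nb ?T1 r1 = {r, r2}"
      using isotri_outer4[OF fin d(3) _ refl, of "{q}" s v q] True nw stD by auto
    obtain t1 t2 where t: "nb S r = {v, q, t1, t2}" "distinct [v, q, t1, t2]" "t1 \<in> ?T2" "t2 \<in> ?T2" "nb ?T2 t1 = {r, t2}" "nb ?T2 t2 = {r, t1}"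
      using isotri_outer4[OF fin d(3) _ refl, of "{q, s}" p v q] True nw stD by auto
    have rt: "{r1, r2} = {t1, t2}" using r(1,2) t(1,2) by auto
    then have r1T2: "r1 \<in> ?T2" and nbT2: "nb ?T2 r1 = {r, r2}"
      using t r(2) by (auto simp: doubleton_eq_iff)
    note nr = nb4[OF r(1)] and np = nb4[OF p(1)]
    have q4: "nb S q = {v, s, p, r}"
      using card_subset_eq[OF finite_nb[OF fin], of "{v, s, p, r}" q] nw stD d(1) by (auto simp: deg_def)
    have n: "\<not> adj r1 v" "\<not> adj r1 q"
    proof -
      have x: "r1 \<noteq> q" "r1 \<noteq> s" "r1 \<noteq> p" "r1 \<noteq> r" "r1 \<noteq> v" using r1T2 r(2) nr adj_irrefl by auto
      show "\<not> adj r1 v" using nb_mem[OF starD(2)[OF st] nr(3)] x adj_sym by blast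
      show "\<not> adj r1 q" using nb_mem[OF q4 nr(3)] x adj_sym by blast
    qed
    have "nb S r1 \<subseteq> {r, r2}"
    proof
      fix z assume z: "z \<in> nb S r1"
      show "z \<in> {r, r2}"
      proof (rule ccontr)
        assume nz: "z \<notin> {r, r2}"
        have "z \<notin> ?T1" using nb_mem[OF r(5), of z] z nz by auto
        moreover have "z \<notin> ?T2" using nb_mem[OF nbT2, of z] z nz by auto
        moreover have "z \<noteq> q" "z \<noteq> v" using n z by auto
        moreover have "z \<noteq> s" using z r(3) adj_sym by auto
        moreover have "z \<noteq> p" using z r1T2 adj_sym by auto
        ultimately have "adj s z" "adj p z" "z \<in> S" using z by auto
        then have "z \<in> {p1, p2}" using nb_mem[OF p(1), of z] \<open>z \<noteq> v\<close> \<open>z \<noteq> q\<close> by blast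
        then show False using p(2,3) \<open>adj s z\<close> by auto
      qed
    qed
    then have "deg S r1 \<le> card {r, r2}" unfolding deg_def by (intro card_mono) auto
    also have "\<dots> \<le> 2" by (simp add: card_insert_if)
    finally show ?thesis using min[OF nr(3)] by simp
  qed
qed

text \<open>In the branch at \<open>p\<close> the vertices \<open>v\<close>, \<open>q\<close> and
  the common neighbour \<open>z\<close> are gone, so \<open>r\<close> is a leaf there.\<close>

lemma star_meet:
  assumes ok: "ok S" and min: "\<And>u. u \<in> S \<Longrightarrow> 4 \<le> deg S u"
    and st: "star S v q p r s" and d: "deg S r = 4" and z: "z \<in> nb S p" "z \<in> nb S r" "z \<noteq> v" "z \<noteq> q"
  shows "real (b S) \<le> x ^ card S"
proof (rule four_term_bound[OF expand4[OF ok_finite[OF ok] starD(1-3)[OF st]]])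
  note stD = starD(1,3-)[OF st] and nw = nb4[OF starD(2)[OF st]]
  have ds: "4 \<le> deg S s" "4 \<le> deg S q" "4 \<le> deg S p" using min nw by auto
  show "real (b (S - {} - NN q)) \<le> y ^ 5 * x ^ card S"
    by (rule cut[OF ok, where d = 4 and Q = "{}"]) (use nw ds in auto)
  show "real (b (S - {q} - NN p)) \<le> y ^ (2 + 5) * x ^ card S"
    by (rule cut_leaf[OF ok, where d = 4 and Q = "{}" and u = r and B = "{v, q, z}"])
      (use nw d ds stD z in auto)
  show "real (b (S - {q, p} - NN r)) \<le> y ^ 6 * x ^ card S"
    by (rule cut[OF ok, where d = 4 and Q = "{p}"]) (use nw d stD in auto)
  show "real (b (S - {q, p, r} - NN s)) \<le> y ^ 7 * x ^ card S"
    by (rule cut[OF ok, where d = 4 and Q = "{p, r}"]) (use nw ds stD in auto)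
  show "y ^ 5 + y ^ (2 + 5) + y ^ 6 + y ^ 7 \<le> 1" using y_bounds by (simp add: y_powers)
qed

text \<open>The outer neighbours of \<open>s\<close> are not adjacent, so \<open>s\<close> is in no
  triangle component. They are not shared with \<open>p\<close> or \<open>r\<close> either, so the
  saving at \<open>s\<close> survives the expansion at \<open>r\<close>, and the second branch earns
  \<open>lam\<close> twice.\<close>

lemma star_nonadjacent:
  assumes ok: "ok S" and K: "K4free S" and min: "\<And>u. u \<in> S \<Longrightarrow> 4 \<le> deg S u"
    and st: "star S v q p r s" and d: "deg S q = 4" "deg S p = 4" "deg S r = 4" "deg S s = 4"
    and dis: "\<And>z. z \<in> nb S s \<Longrightarrow> z \<in> nb S p \<or> z \<in> nb S r \<Longrightarrow> z = v \<or> z = q"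
    and s: "nb S s = {v, q, s1, s2}" "\<not> adj s1 s2"
  shows "real (b S) \<le> x ^ card S"
proof -
  note fin = ok_finite[OF ok]
  have key: ?thesis
    if st: "star S v q p r s" and d: "deg S q = 4" "deg S p = 4" "deg S r = 4" and iso: "\<not> isotri (S - {q} - NN p) r"
      and dis: "\<And>z. z \<in> nb S s \<Longrightarrow> z \<in> nb S p \<or> z \<in> nb S r \<Longrightarrow> z = v \<or> z = q" for p r
  proof (rule four_term_bound[OF expand4[OF fin starD(1-3)[OF st]]])
    note stD = starD(1,3-)[OF st] and nw = nb4[OF starD(2)[OF st]]
    have vq: "v \<noteq> q" using nw by auto
    have lowS: "real (b U) \<le> lam * x ^ card U" if U: "U \<subseteq> S" "s \<in> U" "v \<notin> U" "q \<notin> U" for U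
    proof -
      have "deg U s + card {v, q} \<le> deg S s"
        by (rule deg_drop[OF fin U(1)]) (use nb4[OF s(1)] U in auto)
      then have "deg U s \<le> 2" using \<open>deg S s = 4\<close> vq by simp
      moreover have "\<not> isotri U s"
      proof
        assume "isotri U s"
        then obtain e f where ef: "adj e f" "nb U s = {e, f}" unfolding isotri_def by blast
        have "nb U s \<subseteq> {s1, s2}"
        proof
          fix t assume "t \<in> nb U s"
          then show "t \<in> {s1, s2}" using nb_mem[OF s(1), of t] U by auto
        qed
        then have "e \<in> {s1, s2}" "f \<in> {s1, s2}" using ef(2) by auto
        then show False using ef(1) s(2) adj_sym adj_irrefl by auto
      qed
      ultimately show ?thesis
        using low_degree[OF ok_subset[OF ok U(1)] U(2) _ _ y1] by (simp add: lam_def)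
    qed
    show "real (b (S - {} - NN q)) \<le> y ^ 5 * x ^ card S"
      by (rule cut[OF ok, where d = 4 and Q = "{}"]) (use nw d in auto)
    show "real (b (S - {q} - NN p)) \<le> lam * lam * y ^ 5 * x ^ card S"
    proof (rule cut_gain[OF ok, where d = 4 and Q = "{}"])
      let ?T = "S - {q} - NN p"
      have rT: "r \<in> ?T" using nw stD by auto
      have dr: "deg ?T r \<le> 2"
        by (rule deg_cut[OF ok, where B = "{v, q}"]) (use nw stD d in auto)
      have "real (b ?T) \<le> lam * (y ^ 3 + y ^ 4) * x ^ card ?T"
      proof (rule low_degree_gain[OF ok_subset[OF ok] rT dr iso y1 lam_nonneg])
        fix w Z assume w: "w \<in> ?T" "w \<in> NN r" and Z: "Z \<subseteq> ?T" "Z \<subseteq> NN r"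
        have "s \<notin> NN r" using stD by auto
        then have "s \<notin> Z" using Z by blast
        moreover have "s \<notin> NN w"
        proof
          assume "s \<in> NN w"
          then have "w \<noteq> r" "s = w \<or> adj w s" using stD by auto
          moreover have "s \<noteq> w" using w(2) \<open>s \<notin> NN r\<close> by blast
          ultimately have "w \<in> nb S s" "w \<in> nb S r" using w adj_sym by auto
          then have "w = v \<or> w = q" using dis by blast
          then show False using w(1) nw by auto
        qed
        ultimately show "real (b (?T - Z - NN w)) \<le> lam * x ^ card (?T - Z - NN w)"
          by (intro lowS) (use nw stD in auto)
      qed auto
      then show "real (b ?T) \<le> lam * lam * x ^ card ?T" by (simp add: lam_def)
    qed (use nw d lam_nonneg in auto)
    show "real (b (S - {q, p} - NN r)) \<le> lam * y ^ 6 * x ^ card S"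
      by (rule cut_gain[OF ok, where d = 4 and Q = "{p}"], (use nw d stD in auto)[6], rule lowS)
        (use nw stD lam_nonneg in auto)
    show "real (b (S - {q, p, r} - NN s)) \<le> y ^ 7 * x ^ card S"
      by (rule cut[OF ok, where d = 4 and Q = "{p, r}"]) (use nw \<open>deg S s = 4\<close> stD in auto)
    show "y ^ 5 + lam * lam * y ^ 5 + lam * y ^ 6 + y ^ 7 \<le> 1" using y_bounds unfolding lam_power_values by (simp add: y_powers)
  qed
  show ?thesis
    using key[OF st d(1-3)] key[OF star_swap(1)[OF st] d(1,3,2)] star_two_iso[OF ok K min st _ d(2,3)] d(1) dis by auto
qed

text \<open>Stated for a counterexample to the bound. If neither \<open>r1\<close> nor
  \<open>r2\<close> had the neighbourhood claimed, both would keep degree at least 3 in the branch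
  at \<open>p\<close>, and expanding there at \<open>r\<close> would give the factor
  \<open>2 * y ^ 4\<close>. The next branch saves at \<open>s\<close>, since a triangle component of
  \<open>s\<close> would produce a K_4 on \<open>s1\<close>, \<open>s2\<close>, \<open>r1\<close>,
  \<open>r2\<close>.\<close>

lemma star_complete:
  assumes ok: "ok S" and K: "K4free S" and min: "\<And>u. u \<in> S \<Longrightarrow> 4 \<le> deg S u"
    and st: "star S v q p r s" and d: "deg S q = 4" "deg S p = 4" "deg S r = 4" "deg S s = 4"
    and dis: "\<And>z. z \<in> nb S p \<Longrightarrow> z \<in> nb S r \<Longrightarrow> z = v \<or> z = q" "\<And>z. z \<in> nb S p \<Longrightarrow> z \<in> nb S s \<Longrightarrow> z = v \<or> z = q"
      "\<And>z. z \<in> nb S r \<Longrightarrow> z \<in> nb S s \<Longrightarrow> z = v \<or> z = q"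
    and pq: "nb S p = {v, q, p1, p2}" and r: "nb S r = {v, q, r1, r2}" "distinct [v, q, r1, r2]" "adj r1 r2"
    and neg: "\<not> real (b S) \<le> x ^ card S"
  shows "nb S r1 = {r, r2, p1, p2} \<or> nb S r2 = {r, r1, p1, p2}"
proof (rule ccontr)
  assume nc: "\<not> ?thesis"
  note fin = ok_finite[OF ok] and stD = starD(1,3-)[OF st] and nw = nb4[OF starD(2)[OF st]]
    and nr = nb4[OF r(1)] and np = nb4[OF pq]
  let ?T = "S - {q} - NN p" and ?T3 = "S - {q, p} - NN r"
  have q4: "nb S q = {v, p, r, s}"
    using card_subset_eq[OF finite_nb[OF fin], of "{v, p, r, s}" q] nw stD d(1) by (auto simp: deg_def)
  have rT: "z \<in> ?T" "\<not> adj q z" if "z \<in> {r1, r2}" for z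
  proof -
    have z: "z \<in> nb S r" "z \<noteq> v" "z \<noteq> q" "z \<in> S" "adj r z" using that r nr by auto
    then have "z \<notin> nb S p" using dis(1) by blast
    moreover have "z \<noteq> p" using z stD by auto
    ultimately show "z \<in> ?T" using z by auto
    have "z \<noteq> r" "z \<noteq> s" using z stD adj_irrefl by auto
    then show "\<not> adj q z" using nb_mem[OF q4, of z] z \<open>z \<noteq> p\<close> by blast
  qed
  have deg3: "3 \<le> deg ?T z" if z: "z \<in> {r1, r2}" "nb S r = {v, q, z, z'}" "z' \<in> {r1, r2}" "adj z z'"
      "nb S z \<noteq> {r, z', p1, p2}" for z z'
  proof (rule ccontr)
    assume "\<not> 3 \<le> deg ?T z"
    then have "deg ?T z \<le> 2" by simp
    have rin: "r \<in> ?T" using nw stD by auto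
    have "z' \<noteq> r" using nbD[OF z(2), of z'] by auto
    have "{r, z'} \<subseteq> nb ?T z" using rT(1)[OF z(3)] rin z(4) nbD[OF z(2), of z] by auto
    moreover have "card (nb ?T z) \<le> card {r, z'}" using \<open>deg ?T z \<le> 2\<close> \<open>z' \<noteq> r\<close> by (simp add: deg_def)
    ultimately have "nb ?T z = {r, z'}"
      using card_seteq[of "nb ?T z" "{r, z'}"] finite_nb[of ?T z] fin by auto
    then have "nb S z \<subseteq> {r, z', q, p1, p2}"
      using star_outer_nb[OF st pq rT(1)[OF z(1)]] nbD[OF z(2), of z] by auto
    moreover have "\<not> adj z q" using rT(2)[OF z(1)] adj_sym by blast
    ultimately have "nb S z \<subseteq> {r, z', p1, p2}" by auto
    then have "nb S z = {r, z', p1, p2}" using nb_full[OF fin] min rT(1)[OF z(1)] by blast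
    then show False using z(5) by blast
  qed
  have rr: "nb S r = {v, q, r2, r1}" using r(1) by auto
  have d3: "3 \<le> deg ?T r1" "3 \<le> deg ?T r2"
    using deg3[of r1 r2] deg3[of r2 r1] r(1,3) rr nc adj_sym[OF r(3)] by auto
  have iso: "\<not> isotri ?T3 s"
  proof
    assume "isotri ?T3 s"
    then obtain s1 s2 where s: "nb S s = {v, q, s1, s2}" "distinct [v, q, s1, s2]" "adj s1 s2" "s1 \<in> ?T3" "s2 \<in> ?T3"
      "nb ?T3 s1 = {s, s2}" "nb ?T3 s2 = {s, s1}"
      using isotri_outer4[OF fin d(4) _ refl, of "{q, p}" r v q] nw stD by auto
    note ns = nb4[OF s(1)]
    have full: "nb S z = {s, z', r1, r2}" if z: "z \<in> ?T3" "adj s z" "nb ?T3 z = {s, z'}" "z \<noteq> v" for z z'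
    proof -
      have n1: "\<not> adj z q"
      proof
        assume "adj z q"
        then have "z \<in> {v, p, r, s}" using nb_mem[OF q4, of z] z(1) adj_sym by blast
        then show False using z nw adj_irrefl by auto
      qed
      have n2: "\<not> adj z v"
      proof
        assume "adj z v"
        then have "z \<in> {q, p, r, s}" using nb_mem[OF starD(2)[OF st], of z] z(1) adj_sym by blast
        then show False using z nw adj_irrefl by auto
      qed
      have n3: "\<not> adj z p"
      proof
        assume "adj z p"
        then have "z \<in> nb S p" "z \<in> nb S s" using z adj_sym by auto
        then have "z = v \<or> z = q" using dis(2) by blast
        then show False using z by auto
      qed
      have "nb S z \<subseteq> {s, z', r1, r2}"
      proof
        fix t assume t: "t \<in> nb S z"
        show "t \<in> {s, z', r1, r2}"
        proof (cases "t \<in> ?T3")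
          case True
          then show ?thesis using nb_mem[OF z(3), of t] t by auto
        next
          case False
          then have "t = r \<or> adj r t" using t n1 n3 by auto
          moreover have "t \<noteq> r" using t z(1) adj_sym by auto
          moreover have "t \<noteq> v" "t \<noteq> q" using t n1 n2 by auto
          ultimately show ?thesis using nb_mem[OF r(1), of t] t by auto
        qed
      qed
      then show ?thesis using nb_full[OF fin] min z(1) by blast
    qed
    have "nb S s1 = {s, s2, r1, r2}" "nb S s2 = {s, s1, r1, r2}" using full s ns by auto
    then have "adj s1 r1" "adj s1 r2" "adj s2 r1" "adj s2 r2" by (auto simp: set_eq_iff)
    then show False using K4freeD[OF K, of s1 s2 r1 r2] ns nr s(3) r(3) by blast
  qed
  have "real (b S) \<le> x ^ card S"
  proof (rule four_term_bound[OF expand4[OF fin starD(1-3)[OF st]]])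
    show "real (b (S - {} - NN q)) \<le> y ^ 5 * x ^ card S"
      by (rule cut[OF ok, where d = 4 and Q = "{}"]) (use nw d in auto)
    show "real (b ?T) \<le> (2 * y ^ 4) * y ^ 5 * x ^ card S"
    proof (rule cut_gain[OF ok, where d = 4 and Q = "{}"])
      have okT: "ok ?T" by (rule ok_subset[OF ok]) auto
      have rin: "r \<in> ?T" using nw stD by auto
      have nbT: "nb ?T r = {r1, r2}"
      proof (intro equalityI subsetI)
        fix t assume t: "t \<in> nb ?T r"
        then have "t \<in> {v, q, r1, r2}" using nb_mem[OF r(1), of t] by auto
        then show "t \<in> {r1, r2}" using t nw by auto
      next
        fix t assume "t \<in> {r1, r2}"
        then show "t \<in> nb ?T r" using rT(1) nr by auto
      qed
      have "b ?T \<le> b (?T - {} - NN r1) + b (?T - {r1} - NN r2)"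
        by (rule expand2[OF ok_finite[OF okT] rin nbT]) (use r(2) in auto)
      moreover have "real (b (?T - {} - NN r1)) \<le> y ^ 4 * x ^ card ?T"
        by (rule cut[OF okT, where d = 3 and Q = "{}"]) (use rT(1) d3 in auto)
      moreover have "real (b (?T - {r1} - NN r2)) \<le> y ^ 4 * x ^ card ?T"
        by (rule cut[OF okT, where d = 3 and Q = "{}"]) (use rT(1) d3 in auto)
      ultimately show "real (b ?T) \<le> 2 * y ^ 4 * x ^ card ?T" by linarith
    qed (use nw d y_pos in auto)
    show "real (b ?T3) \<le> lam * y ^ 6 * x ^ card S"
      by (rule cut_low[OF ok, where d = 4 and Q = "{p}" and u = s and B = "{v, q}"])
        (use nw d stD y1 iso in auto)
    show "real (b (S - {q, p, r} - NN s)) \<le> y ^ 7 * x ^ card S"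
      by (rule cut[OF ok, where d = 4 and Q = "{p, r}"]) (use nw d stD in auto)
    have e9: "2 * y ^ 4 * y ^ 5 = 2 * y ^ 9" by (simp flip: power_add)
    show "y ^ 5 + 2 * y ^ 4 * y ^ 5 + lam * y ^ 6 + y ^ 7 \<le> 1"
      using y_bounds unfolding lam_power_values e9 by (simp add: y_powers)
  qed
  then show False using neg by blast
qed

text \<open>In a counterexample \<open>star_complete\<close> applies to every ordered pair of
  leaves. Some outer neighbour of \<open>p\<close> is adjacent to both \<open>r1\<close> and
  \<open>r2\<close>, while one of these has no neighbours but \<open>r\<close>, its partner,
  \<open>s1\<close> and \<open>s2\<close>: a contradiction.\<close>

lemma star_all4:
  assumes ok: "ok S" and K: "K4free S" and min: "\<And>u. u \<in> S \<Longrightarrow> 4 \<le> deg S u"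
    and st: "star S v q p r s" and d: "deg S q = 4" "deg S p = 4" "deg S r = 4" "deg S s = 4"
  shows "real (b S) \<le> x ^ card S"
proof (rule ccontr)
  assume neg: "\<not> ?thesis"
  note fin = ok_finite[OF ok] and stD = starD(1,3-)[OF st] and nw = nb4[OF starD(2)[OF st]]
  note st2 = star_swap(1)[OF st] and st3 = star_swap(2)[OF st]
  note st4 = star_swap(2)[OF st2] and st5 = star_swap(1)[OF st3]
  have dis: "z = v \<or> z = q" if "z \<in> nb S p" "z \<in> nb S r" for z
    using star_meet[OF ok min st d(3)] neg that by blast
  have dis2: "z = v \<or> z = q" if "z \<in> nb S p" "z \<in> nb S s" for z
    using star_meet[OF ok min st3 d(4)] neg that by blast
  have dis3: "z = v \<or> z = q" if "z \<in> nb S r" "z \<in> nb S s" for z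
    using star_meet[OF ok min st4 d(4)] neg that by blast
  obtain p1 p2 where p: "nb S p = {v, q, p1, p2}" "distinct [v, q, p1, p2]"
    using nb_two_more[OF fin d(2), of v q] nw stD by auto
  obtain r1 r2 where r: "nb S r = {v, q, r1, r2}" "distinct [v, q, r1, r2]"
    using nb_two_more[OF fin d(3), of v q] nw stD by auto
  obtain s1 s2 where s: "nb S s = {v, q, s1, s2}" "distinct [v, q, s1, s2]"
    using nb_two_more[OF fin d(4), of v q] nw stD by auto
  have as: "adj s1 s2"
    using star_nonadjacent[OF ok K min st d _ s(1)] neg dis2 dis3 by blast
  have ar: "adj r1 r2"
    using star_nonadjacent[OF ok K min st3 d(1,2,4,3) _ r(1)] neg dis dis3 by blast
  have ap: "adj p1 p2"
    using star_nonadjacent[OF ok K min st4 d(1,3,4,2) _ p(1)] neg dis dis2 by blast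
  note st6 = star_swap(2)[OF st5]
  have C2: "nb S r1 = {r, r2, s1, s2} \<or> nb S r2 = {r, r1, s1, s2}"
    by (rule star_complete[OF ok K min st6 d(1,4,3,2) _ _ _ s(1) r ar neg]) (use dis dis2 dis3 in blast)+
  have C3: "nb S p1 = {p, p2, r1, r2} \<or> nb S p2 = {p, p1, r1, r2}"
    by (rule star_complete[OF ok K min st2 d(1,3,2,4) _ _ _ r(1) p ap neg]) (use dis dis2 dis3 in blast)+
  note nr = nb4[OF r(1)] and np = nb4[OF p(1)] and ns = nb4[OF s(1)]
  have "\<exists>z\<in>{p1, p2}. r1 \<in> nb S z \<and> r2 \<in> nb S z"
    using C3 by blast
  then obtain z where z: "z \<in> {p1, p2}" "r1 \<in> nb S z" "r2 \<in> nb S z" by blast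
  have zp: "z \<in> nb S p" "z \<noteq> v" "z \<noteq> q" "z \<in> S" using z(1) np p(2) by auto
  have zr: "z \<in> nb S r1" "z \<in> nb S r2" using z zp(4) adj_sym by auto
  have "z \<noteq> r" using zp(1) stD by auto
  moreover have "z \<notin> nb S r" using dis zp by blast
  then have "z \<noteq> r1" "z \<noteq> r2" using nr by auto
  moreover have "z \<notin> nb S s" using dis2 zp by blast
  then have "z \<noteq> s1" "z \<noteq> s2" using ns by auto
  ultimately show False using C2 zr by blast
qed

lemma deg4_star:
  assumes ok: "ok S" and K: "K4free S" and min: "\<And>u. u \<in> S \<Longrightarrow> 4 \<le> deg S u" and st: "star S v q p r s"
  shows "real (b S) \<le> x ^ card S"
proof -
  have two: ?thesis
    if st: "star S v q p r s" and k: "k1 \<le> deg S q" "k2 \<le> deg S p" "k3 \<le> deg S r"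
      "y ^ (1 + k1) + y ^ (1 + k2) + y ^ (2 + k3) + y ^ 7 \<le> 1" for p r s k1 k2 k3
  proof -
    note stD = starD(3-)[OF st] and nw = nb4[OF starD(2)[OF st]]
    have "card {p, r} = 2" using stD by simp
    then show ?thesis
      using order4[OF ok starD(1-3)[OF st], of k1 k2 k3 4 "{}" "{p}" "{p, r}"] k min nw stD by auto
  qed
  note nw = nb4[OF starD(2)[OF st]]
  have d: "4 \<le> deg S q" "4 \<le> deg S p" "4 \<le> deg S r" "4 \<le> deg S s" using min nw by auto
  note st2 = star_swap(1)[OF st] and st3 = star_swap(2)[OF st]
  note st4 = star_swap(2)[OF st2] and st5 = star_swap(1)[OF st3]
  have n: "y ^ (1 + 5) + y ^ (1 + 5) + y ^ (2 + 4) + y ^ 7 \<le> 1" "y ^ (1 + 4) + y ^ (1 + 5) + y ^ (2 + 5) + y ^ 7 \<le> 1"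
    "y ^ (1 + 6) + y ^ (1 + 4) + y ^ (2 + 4) + y ^ 7 \<le> 1"
    using y_bounds by (simp_all add: y_powers)
  have D: "deg S q = 4 \<or> deg S q = 5 \<or> 6 \<le> deg S q" "deg S p = 4 \<or> 5 \<le> deg S p"
    "deg S r = 4 \<or> 5 \<le> deg S r" "deg S s = 4 \<or> 5 \<le> deg S s" using d by auto
  consider "6 \<le> deg S q" | "deg S q = 5" | "deg S q = 4" using D(1) by blast
  then show ?thesis
  proof cases
    case 1
    then show ?thesis using two[OF st 1 d(2,3) n(3)] by blast
  next
    case 2
    then show ?thesis
      using two[OF st _ _ d(3) n(1)] two[OF st2 _ _ d(2) n(1)] star_centre5[OF ok K min st] D(2,3)
      by (metis order_refl)
  next
    case 3
    consider "5 \<le> deg S p" "5 \<le> deg S r" | "5 \<le> deg S p" "5 \<le> deg S s" | "5 \<le> deg S r" "5 \<le> deg S s"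
      | "5 \<le> deg S p" "deg S r = 4" "deg S s = 4" | "5 \<le> deg S r" "deg S p = 4" "deg S s = 4"
      | "5 \<le> deg S s" "deg S p = 4" "deg S r = 4" | "deg S p = 4" "deg S r = 4" "deg S s = 4"
      using D(2-4) by blast
    then show ?thesis
    proof cases
      case 1 with two[OF st d(1) _ _ n(2)] show ?thesis by simp
    next
      case 2 with two[OF st3 d(1) _ _ n(2)] show ?thesis by simp
    next
      case 3 with two[OF st4 d(1) _ _ n(2)] show ?thesis by simp
    next
      case 4 with star_leaf5[OF ok K min st 3] show ?thesis by blast
    next
      case 5 with star_leaf5[OF ok K min st2 3] show ?thesis by blast
    next
      case 6 with star_leaf5[OF ok K min st5 3] show ?thesis by blast
    next
      case 7 with star_all4[OF ok K min st 3] show ?thesis by blast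
    qed
  qed
qed

text \<open>Again only the case of all degrees 4 is left by plain counting. If \<open>p\<close> lies
  in a triangle component both after the branch at \<open>c\<close> and after the one at
  \<open>q\<close>, its two partners there send all other edges to \<open>a\<close> or to common
  neighbours of \<open>c\<close> and \<open>q\<close>. They are not both adjacent to
  \<open>a\<close>, so two such common neighbours besides \<open>v\<close> exist, and the
  neighbourhood of \<open>c\<close> is a star with centre \<open>q\<close>.\<close>

lemma deg4_matching:
  assumes ok: "ok S" and K: "K4free S" and min: "\<And>u. u \<in> S \<Longrightarrow> 4 \<le> deg S u"
    and v: "v \<in> S" and w: "nb S v = {a, c, p, q}" "distinct [a, c, p, q]"
    and e: "adj a p" "adj c q" "\<not> adj a c" "\<not> adj a q" "\<not> adj p c" "\<not> adj p q"
  shows "real (b S) \<le> x ^ card S"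
proof -
  note fin = ok_finite[OF ok] and nw = nb4[OF w(1)] and e' = e e(1,2)[THEN adj_sym] e(3-6)[THEN nadj_sym]
  have d: "4 \<le> deg S a" "4 \<le> deg S c" "4 \<le> deg S p" "4 \<le> deg S q" using min nw by auto
  note o4 = order4[OF ok v w, where ?Q2.0 = "{a}" and ?Q3.0 = "{c}" and ?Q4.0 = "{a, p}"]
  consider "5 \<le> deg S a" | "5 \<le> deg S c" | "5 \<le> deg S p" | "5 \<le> deg S q"
    | "deg S a = 4" "deg S c = 4" "deg S p = 4" "deg S q = 4" using d by linarith
  then show ?thesis
  proof cases
    case 1
    then show ?thesis using o4[of 5 4 4 4] w(2) d e' y_bounds by (auto simp: y_powers)
  next
    case 2
    then show ?thesis using o4[of 4 5 4 4] w(2) d e' y_bounds by (auto simp: y_powers)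
  next
    case 3
    then show ?thesis using o4[of 4 4 5 4] w(2) d e' y_bounds by (auto simp: y_powers)
  next
    case 4
    then show ?thesis using o4[of 4 4 4 5] w(2) d e' y_bounds by (auto simp: y_powers)
  next
    case D: 5
    have key: ?thesis
      if w: "nb S v = {a, c, p, q}" "distinct [a, c, p, q]" and D: "deg S c = 4" "deg S q = 4"
        and e: "adj c q" "\<not> adj a c" "\<not> adj a q" "\<not> adj p c" "\<not> adj p q" "adj q c" "\<not> adj c a" "\<not> adj q a" "\<not> adj c p" "\<not> adj q p"
        and iso: "\<not> isotri (S - {a} - NN c) p" for c q
    proof (rule four_term_bound[OF expand4[OF fin v w]])
      note nw = nb4[OF w(1)]
      show "real (b (S - {} - NN a)) \<le> y ^ 5 * x ^ card S"
        by (rule cut[OF ok, where d = 4 and Q = "{}"]) (use nw d in auto)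
      show "real (b (S - {a} - NN c)) \<le> lam * y ^ 6 * x ^ card S"
        by (rule cut_low[OF ok, where d = 4 and Q = "{a}" and u = p and B = "{v, a}"])
          (use nw d e e'(1,7) w(2) v D \<open>deg S p = 4\<close> y1 iso in auto)
      show "real (b (S - {a, c} - NN p)) \<le> y ^ 6 * x ^ card S"
        by (rule cut[OF ok, where d = 4 and Q = "{c}"]) (use nw d e w(2) in auto)
      show "real (b (S - {a, c, p} - NN q)) \<le> y ^ 7 * x ^ card S"
        by (rule cut[OF ok, where d = 4 and Q = "{a, p}"]) (use nw D e w(2) in auto)
      show "y ^ 5 + lam * y ^ 6 + y ^ 6 + y ^ 7 \<le> 1" using y_bounds unfolding lam_power_values by (simp add: y_powers)
    qed
    let ?T1 = "S - {a} - NN c" and ?T2 = "S - {a} - NN q"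
    have w': "nb S v = {a, q, p, c}" "distinct [a, q, p, c]" using w by auto
    show ?thesis
    proof (cases "isotri ?T1 p \<and> isotri ?T2 p")
      case False
      then show ?thesis using key[OF w D(2,4)] key[OF w' D(4,2)] e' by blast
    next
      case True
      obtain f g where f: "nb S p = {v, a, f, g}" "distinct [v, a, f, g]" "adj f g" "f \<in> ?T1" "g \<in> ?T1"
        "nb ?T1 f = {p, g}" "nb ?T1 g = {p, f}"
        using isotri_outer4[OF fin D(3) _ refl, of "{a}" c v a] True nw e' v by auto
      obtain f' g' where f': "nb S p = {v, a, f', g'}" "distinct [v, a, f', g']" "f' \<in> ?T2" "g' \<in> ?T2"
        "nb ?T2 f' = {p, g'}" "nb ?T2 g' = {p, f'}"
        using isotri_outer4[OF fin D(3) _ refl, of "{a}" q v a] True nw e' v by auto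
      have "{f, g} = {f', g'}" using f(1,2) f'(1,2) by auto
      then have T2: "f \<in> ?T2" "g \<in> ?T2" "nb ?T2 f = {p, g}" "nb ?T2 g = {p, f}"
        using f' f(2) by (auto simp: doubleton_eq_iff)
      note nf = nb4[OF f(1)]
      define M where "M = {m \<in> S. adj c m \<and> adj q m \<and> m \<noteq> v}"
      have sub: "nb S z \<subseteq> {p, z', a} \<union> M"
        if z: "z \<in> ?T1" "z \<in> ?T2" "adj p z" "nb ?T1 z = {p, z'}" "nb ?T2 z = {p, z'}" for z z'
      proof
        fix t assume t: "t \<in> nb S z"
        have zv: "\<not> adj z v"
        proof
          assume "adj z v"
          then have "z \<in> {a, c, p, q}" using nb_mem[OF w(1), of z] z(1) adj_sym by blast
          then show False using z e' adj_irrefl by auto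
        qed
        show "t \<in> {p, z', a} \<union> M"
        proof (rule ccontr)
          assume n: "t \<notin> {p, z', a} \<union> M"
          have "t \<notin> ?T1" using nb_mem[OF z(4), of t] t n by auto
          moreover have "t \<notin> ?T2" using nb_mem[OF z(5), of t] t n by auto
          moreover have "t \<noteq> c" "t \<noteq> q" using t z(1,2) adj_sym by auto
          ultimately have "adj c t" "adj q t" using t n by auto
          moreover have "t \<noteq> v" using t zv by auto
          ultimately show False using t n by (auto simp: M_def)
        qed
      qed
      have "\<not> (adj f a \<and> adj g a)"
        using K4freeD[OF K, of a p f g] nf nw e' f(3) adj_sym by blast
      then obtain z z' where z: "nb S z \<subseteq> {p, z', a} \<union> M" "\<not> adj z a" "z \<in> S"
        using sub[OF f(4) T2(1) nf(7) f(6) T2(3)] sub[OF f(5) T2(2) nf(8) f(7) T2(4)] nf by blast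
      have finM: "finite M" using fin by (simp add: M_def)
      have "nb S z \<subseteq> {p, z'} \<union> M" using z(1,2) by auto
      then have "deg S z \<le> card ({p, z'} \<union> M)" unfolding deg_def using finM by (intro card_mono) auto
      also have "\<dots> \<le> card {p, z'} + card M" by (rule card_Un_le)
      also have "card {p, z'} \<le> 2" by (simp add: card_insert_if)
      finally have "2 \<le> card M" using min[OF z(3)] by simp
      then obtain m1 m2 where m: "m1 \<in> M" "m2 \<in> M" "m1 \<noteq> m2"
        using card_le_Suc0_iff_eq[OF finM] by auto
      have ms: "m1 \<in> S" "m2 \<in> S" "adj c m1" "adj q m1" "adj c m2" "adj q m2" "m1 \<noteq> v" "m2 \<noteq> v" "m1 \<noteq> q" "m2 \<noteq> q"
        "adj m1 c" "adj m2 c" "adj m1 q" "adj m2 q"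
        using m adj_irrefl adj_sym by (auto simp: M_def)
      have nbc: "nb S c = {q, v, m1, m2}"
      proof (rule card_subset_eq[OF finite_nb[OF fin], symmetric])
        show "{q, v, m1, m2} \<subseteq> nb S c" using ms nw e' v by auto
        show "card {q, v, m1, m2} = card (nb S c)" using ms m(3) nw D(2) by (simp add: deg_def)
      qed
      have nv: "\<not> adj v m" if "m \<in> S" "adj c m" "adj q m" for m
      proof
        assume "adj v m"
        then have "m \<in> {a, c, p, q}" using nb_mem[OF w(1)] that by blast
        then show False using that e' adj_irrefl by auto
      qed
      have "\<not> adj m1 m2" using K4freeD[OF K, of c q m1 m2] ms nw e' by blast
      then have st: "star S c q v m1 m2"
        unfolding star_def using nbc ms m(3) nw nv v by simp
      show ?thesis by (rule deg4_star[OF ok K _ st]) (rule min)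
    qed
  qed
qed

text \<open>The triangle-free graphs on four vertices: star, cycle, path, path on three vertices
  plus a point, perfect matching, or at most one edge. \<open>two\<close> covers two edges at a
  common vertex.\<close>

lemma deg4:
  assumes ok: "ok S" and K: "K4free S" and v: "v \<in> S" "deg S v = 4" and min: "\<And>u. u \<in> S \<Longrightarrow> 4 \<le> deg S u"
  shows "real (b S) \<le> x ^ card S"
proof -
  obtain p q r s where w: "nb S v = {p, q, r, s}" "distinct [p, q, r, s]"
    using v(2) by (auto simp: deg_def card_Suc_eq eval_nat_numeral)
  have tri: "\<not> adj d e" if "c \<in> nb S v" "d \<in> nb S v" "e \<in> nb S v" "adj c d" "adj c e" for c d e
    using K4freeD[OF K v(1), of c d e] that by auto
  have two: ?thesis if n: "nb S v = {m, a, c, k}" "distinct [m, a, c, k]" "adj m a" "adj m c" for m a c k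
  proof -
    have mem: "m \<in> nb S v" "a \<in> nb S v" "c \<in> nb S v" "k \<in> nb S v" unfolding n(1) by simp_all
    have ac: "\<not> adj a c" using tri[OF mem(1-3)] n by blast
    note s = adj_sym[OF n(3)] adj_sym[OF n(4)] nadj_sym[OF ac]
    show ?thesis
    proof (cases "adj m k")
      case True
      have "\<not> adj a k" "\<not> adj c k" using tri[OF mem(1,2,4)] tri[OF mem(1,3,4)] n True by blast+
      then have st: "star S v m a c k" unfolding star_def using n ac True v(1) by simp
      show ?thesis by (rule deg4_star[OF ok K _ st]) (rule min)
    next
      case False
      note f = False nadj_sym[OF False]
      consider "adj a k" "adj c k" | "adj a k" "\<not> adj c k" | "\<not> adj a k" "adj c k" | "\<not> adj a k" "\<not> adj c k" by blast
      then show ?thesis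
      proof cases
        case 1
        show ?thesis
          by (rule deg4_cycle[OF ok min v(1), of a m c k]) (use 1 n s f ac adj_sym[OF 1(1)] in auto)
      next
        case 2
        show ?thesis
          by (rule deg4_path[OF ok min v(1), of k a m c]) (use 2 n s f ac adj_sym[OF 2(1)] nadj_sym[OF 2(2)] in auto)
      next
        case 3
        show ?thesis
          by (rule deg4_path[OF ok min v(1), of k c m a]) (use 3 n s f ac adj_sym[OF 3(2)] nadj_sym[OF 3(1)] in auto)
      next
        case 4
        show ?thesis
          by (rule deg4_path3[OF ok min v(1), of k a m c]) (use 4 n s f ac 4[THEN nadj_sym] in auto)
      qed
    qed
  qed
  have one: ?thesis if n: "nb S v = {a, c, e, f}" "distinct [a, c, e, f]" "adj a c" for a c e f
  proof (cases "adj a e \<or> adj a f \<or> adj c e \<or> adj c f")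
    case True
    have "nb S v = {a, c, f, e}" "nb S v = {c, a, e, f}" "nb S v = {c, a, f, e}" using n(1) by auto
    then show ?thesis
      using two[OF n(1)] two[of a c f e] two[of c a e f] two[of c a f e] n(2,3) adj_sym[OF n(3)] True by auto
  next
    case False
    have p: "nb S v = {a, e, c, f}" "nb S v = {e, f, a, c}" using n(1) by auto
    have "\<not> adj e a" "\<not> adj f a" "\<not> adj e c" "\<not> adj f c" using False adj_sym by blast+
    then show ?thesis
      using deg4_matching[OF ok K min v(1) p(1)] deg4_sparse[OF ok min v(1) p(2)] n(2,3) False by auto
  qed
  have p: "nb S v = {p, r, q, s}" "nb S v = {p, s, q, r}" "nb S v = {q, r, p, s}" "nb S v = {q, s, p, r}"
    using w(1) by auto
  have dis: "distinct [p, r, q, s]" "distinct [p, s, q, r]" "distinct [q, r, p, s]" "distinct [q, s, p, r]"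
    using w(2) by auto
  consider "adj p q" | "adj p r" | "adj p s" | "adj q r" | "adj q s"
    | "\<not> adj p q" "\<not> adj p r" "\<not> adj p s" "\<not> adj q r" "\<not> adj q s" by blast
  then show ?thesis
    by cases (rule one[OF w], assumption, rule one[OF p(1) dis(1)], assumption, rule one[OF p(2) dis(2)], assumption,
        rule one[OF p(3) dis(3)], assumption, rule one[OF p(4) dis(4)], assumption,
        rule deg4_sparse[OF ok min v(1) w], assumption+)
qed

subsection \<open>Minimum degree five\<close>

lemma order5:
  assumes ok: "ok S" and v: "v \<in> S" and w: "nb S v = {w1, w2, w3, w4, w5}" "distinct [w1, w2, w3, w4, w5]"
    and k: "k1 \<le> deg S w1" "k2 \<le> deg S w2" "k3 \<le> deg S w3" "k4 \<le> deg S w4" "k5 \<le> deg S w5"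
    and Q: "Q2 \<subseteq> {w1}" "Q3 \<subseteq> {w1, w2}" "Q4 \<subseteq> {w1, w2, w3}" "Q5 \<subseteq> {w1, w2, w3, w4}"
      "Q2 \<inter> NN w2 = {}" "Q3 \<inter> NN w3 = {}" "Q4 \<inter> NN w4 = {}" "Q5 \<inter> NN w5 = {}"
    and j: "j4 \<le> card Q4" "j5 \<le> card Q5"
    and sum: "y ^ (1 + k1) + y ^ (1 + k2 + card Q2) + y ^ (1 + k3 + card Q3) + y ^ (1 + k4 + j4) + y ^ (1 + k5 + j5) \<le> 1"
  shows "real (b S) \<le> x ^ card S"
proof (rule five_term_bound[OF expand5[OF ok_finite[OF ok] v w] _ _ _ _ _ sum])
  note nw = nb5[OF w(1)]
  show "real (b (S - {} - NN w1)) \<le> y ^ (1 + k1) * x ^ card S"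
    by (rule cut[OF ok, where d = k1 and Q = "{}"]) (use nw k in auto)
  show "real (b (S - {w1} - NN w2)) \<le> y ^ (1 + k2 + card Q2) * x ^ card S"
    by (rule cut[OF ok, where d = k2 and Q = Q2]) (use nw k Q in blast)+
  show "real (b (S - {w1, w2} - NN w3)) \<le> y ^ (1 + k3 + card Q3) * x ^ card S"
    by (rule cut[OF ok, where d = k3 and Q = Q3]) (use nw k Q in blast)+
  show "real (b (S - {w1, w2, w3} - NN w4)) \<le> y ^ (1 + k4 + j4) * x ^ card S"
    by (rule cut[OF ok nw(4) k(4) _ Q(3) Q(7)]) (use Q(3) nw(1-4) j in auto)
  show "real (b (S - {w1, w2, w3, w4} - NN w5)) \<le> y ^ (1 + k5 + j5) * x ^ card S"
    by (rule cut[OF ok nw(5) k(5) _ Q(4) Q(8)]) (use Q(4) nw(1-5) j in auto)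
qed

text \<open>If one of \<open>a1\<close>, \<open>a2\<close> has degree 5, the branch at the other
  takes \<open>v\<close> and the three common neighbours, leaving a leaf. Otherwise both have degree
  at least 6.\<close>

lemma deg5_K23:
  assumes ok: "ok S" and min: "\<And>u. u \<in> S \<Longrightarrow> 5 \<le> deg S u"
    and v: "v \<in> S" and w: "nb S v = {a1, c1, c2, c3, a2}" "distinct [a1, c1, c2, c3, a2]"
    and i: "\<not> adj c1 c2" "\<not> adj c1 c3" "\<not> adj c2 c3" "\<not> adj a1 a2"
    and e: "adj a1 c1" "adj a1 c2" "adj a1 c3" "adj a2 c1" "adj a2 c2" "adj a2 c3"
  shows "real (b S) \<le> x ^ card S"
proof -
  note fin = ok_finite[OF ok] and e' = e e[THEN adj_sym] i i[THEN nadj_sym]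
  have card2: "card {c1, c2} = 2" using w(2) by simp
  have key: ?thesis
    if w: "nb S v = {a1, c1, c2, c3, a2}" "distinct [a1, c1, c2, c3, a2]"
      and e: "adj a1 c1" "adj a1 c2" "adj a1 c3" "adj a2 c1" "adj a2 c2" "adj a2 c3" "\<not> adj a1 a2" "\<not> adj a2 a1"
      and d5: "deg S a2 = 5" for a1 a2
  proof (rule five_term_bound[OF expand5[OF fin v w]])
    note nw = nb5[OF w(1)]
    have d: "5 \<le> deg S a1" "5 \<le> deg S c1" "5 \<le> deg S c2" "5 \<le> deg S c3" using min nw by auto
    show "real (b (S - {} - NN a1)) \<le> y ^ (2 + 6) * x ^ card S"
      by (rule cut_leaf[OF ok, where d = 5 and Q = "{}" and u = a2 and B = "{v, c1, c2, c3}"])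
        (use nw d e w(2) v d5 in auto)
    show "real (b (S - {a1} - NN c1)) \<le> y ^ 6 * x ^ card S"
      by (rule cut[OF ok, where d = 5 and Q = "{}"]) (use nw d in auto)
    show "real (b (S - {a1, c1} - NN c2)) \<le> y ^ 7 * x ^ card S"
      by (rule cut[OF ok, where d = 5 and Q = "{c1}"]) (use nw d e' w(2) in auto)
    show "real (b (S - {a1, c1, c2} - NN c3)) \<le> y ^ 8 * x ^ card S"
      by (rule cut[OF ok, where d = 5 and Q = "{c1, c2}"]) (use nw d e' w(2) in auto)
    show "real (b (S - {a1, c1, c2, c3} - NN a2)) \<le> y ^ 7 * x ^ card S"
      by (rule cut[OF ok, where d = 5 and Q = "{a1}"]) (use nw d e w(2) d5 in auto)
    show "y ^ (2 + 6) + y ^ 6 + y ^ 7 + y ^ 8 + y ^ 7 \<le> 1" using y_bounds by (simp add: y_powers)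
  qed
  note nw = nb5[OF w(1)]
  have d: "5 \<le> deg S a1" "5 \<le> deg S c1" "5 \<le> deg S c2" "5 \<le> deg S c3" "5 \<le> deg S a2" using min nw by auto
  have w': "nb S v = {a2, c1, c2, c3, a1}" using w(1) by auto
  show ?thesis
  proof (cases "deg S a1 = 5 \<or> deg S a2 = 5")
    case True
    then show ?thesis using key[OF w] key[OF w'] w(2) e' by auto
  next
    case False
    then have "6 \<le> deg S a1" "6 \<le> deg S a2" using d by auto
    then show ?thesis
      using order5[OF ok v w, of 6 5 5 5 6 "{}" "{c1}" "{c1, c2}" "{a1}" 2 1] w(2) d e' y_bounds card2
      by (auto simp: y_powers)
  qed
qed

text \<open>\<open>c1\<close> comes first, so that it is gone in the branch at \<open>a1\<close>
  although not adjacent to \<open>a1\<close>; there \<open>a2\<close> is a leaf if its degree is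
  5.\<close>

lemma deg5_K23_minus_edge:
  assumes ok: "ok S" and min: "\<And>u. u \<in> S \<Longrightarrow> 5 \<le> deg S u"
    and v: "v \<in> S" and w: "nb S v = {c1, a1, c2, c3, a2}" "distinct [c1, a1, c2, c3, a2]"
    and i: "\<not> adj c1 c2" "\<not> adj c1 c3" "\<not> adj c2 c3" "\<not> adj a1 a2" "\<not> adj a1 c1"
    and e: "adj a1 c2" "adj a1 c3" "adj a2 c1" "adj a2 c2" "adj a2 c3"
  shows "real (b S) \<le> x ^ card S"
proof -
  note fin = ok_finite[OF ok] and e' = e e[THEN adj_sym] i i[THEN nadj_sym] and nw = nb5[OF w(1)]
  have card2: "card {c1, c2} = 2" using w(2) by simp
  have d: "5 \<le> deg S a1" "5 \<le> deg S c1" "5 \<le> deg S c2" "5 \<le> deg S c3" "5 \<le> deg S a2" using min nw by auto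
  show ?thesis
  proof (cases "deg S a2 = 5")
    case True
    show ?thesis
    proof (rule five_term_bound[OF expand5[OF fin v w]])
      show "real (b (S - {} - NN c1)) \<le> y ^ 6 * x ^ card S"
        by (rule cut[OF ok, where d = 5 and Q = "{}"]) (use nw d in auto)
      show "real (b (S - {c1} - NN a1)) \<le> y ^ (2 + 7) * x ^ card S"
        by (rule cut_leaf[OF ok, where d = 5 and Q = "{c1}" and u = a2 and B = "{v, c1, c2, c3}"])
          (use nw d e' w(2) v True in auto)
      show "real (b (S - {c1, a1} - NN c2)) \<le> y ^ 7 * x ^ card S"
        by (rule cut[OF ok, where d = 5 and Q = "{c1}"]) (use nw d e' w(2) in auto)
      show "real (b (S - {c1, a1, c2} - NN c3)) \<le> y ^ 8 * x ^ card S"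
        by (rule cut[OF ok, where d = 5 and Q = "{c1, c2}"]) (use nw d e' w(2) in auto)
      show "real (b (S - {c1, a1, c2, c3} - NN a2)) \<le> y ^ 7 * x ^ card S"
        by (rule cut[OF ok, where d = 5 and Q = "{a1}"]) (use nw d e' w(2) in auto)
      show "y ^ 6 + y ^ (2 + 7) + y ^ 7 + y ^ 8 + y ^ 7 \<le> 1" using y_bounds by (simp add: y_powers)
    qed
  next
    case False
    then have "6 \<le> deg S a2" using d by auto
    then show ?thesis
      using order5[OF ok v w, of 5 5 5 5 6 "{c1}" "{c1}" "{c1, c2}" "{a1}" 2 1] w(2) d e' y_bounds card2
      by (auto simp: y_powers)
  qed
qed

text \<open>The independent triple costs \<open>y ^ 6 + y ^ 7 + y ^ 8\<close>, and the rest fits if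
  \<open>a1\<close> and \<open>a2\<close> have at least three nonneighbours among the earlier
  vertices. If \<open>a1\<close> and \<open>a2\<close> are adjacent, K_4-freeness supplies one for
  each vertex of the triple. If not, their own nonadjacency counts once, and otherwise at most one
  edge to the triple is missing: K_(2,3), possibly without an edge.\<close>

lemma deg5_triple:
  assumes ok: "ok S" and K: "K4free S" and min: "\<And>u. u \<in> S \<Longrightarrow> 5 \<le> deg S u"
    and v: "v \<in> S" and w: "nb S v = {c1, c2, c3, a1, a2}" "distinct [c1, c2, c3, a1, a2]"
    and i: "\<not> adj c1 c2" "\<not> adj c1 c3" "\<not> adj c2 c3"
  shows "real (b S) \<le> x ^ card S"
proof -
  note i' = i i[THEN nadj_sym] and nw = nb5[OF w(1)]
  have d: "5 \<le> deg S a1" "5 \<le> deg S c1" "5 \<le> deg S c2" "5 \<le> deg S c3" "5 \<le> deg S a2" using min nw by auto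
  define Q where "Q a = {c \<in> {c1, c2, c3}. \<not> adj a c}" for a
  have finQ: "finite (Q a)" for a by (simp add: Q_def)
  define J where "J = (if adj a1 a2 then {} else {a1})"
  have QJ: "Q a2 \<inter> J = {}" using w(2) by (auto simp: Q_def J_def)
  have cQJ: "card (Q a2 \<union> J) = card (Q a2) + card J"
    by (rule card_Un_disjoint[OF finQ _ QJ]) (simp add: J_def)
  have card2: "card {c1, c2} = 2" using w(2) by simp
  have gen: ?thesis if "j4 \<le> card (Q a1)" "j5 \<le> card (Q a2 \<union> J)" "y ^ 6 + y ^ 7 + y ^ 8 + y ^ (6 + j4) + y ^ (6 + j5) \<le> 1" for j4 j5
  proof (rule order5[OF ok v w, of 5 5 5 5 5 "{c1}" "{c1, c2}" "Q a1" "Q a2 \<union> J" j4 j5])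
    show "(Q a2 \<union> J) \<inter> NN a2 = {}" using w(2) adj_sym[of a2 a1] by (auto simp: Q_def J_def)
    show "y ^ (1 + 5) + y ^ (1 + 5 + card {c1}) + y ^ (1 + 5 + card {c1, c2}) + y ^ (1 + 5 + j4) + y ^ (1 + 5 + j5) \<le> 1"
      using that(3) card2 by simp
  qed (use d w(2) i' that in \<open>auto simp: Q_def J_def\<close>)
  have num: "y ^ 6 + y ^ 7 + y ^ 8 + y ^ (6 + 0) + y ^ (6 + 3) \<le> 1" "y ^ 6 + y ^ 7 + y ^ 8 + y ^ (6 + 1) + y ^ (6 + 2) \<le> 1"
    "y ^ 6 + y ^ 7 + y ^ 8 + y ^ (6 + 2) + y ^ (6 + 1) \<le> 1" "y ^ 6 + y ^ 7 + y ^ 8 + y ^ (6 + 3) + y ^ (6 + 0) \<le> 1"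
    using y_bounds by (simp_all add: y_powers)
  show ?thesis
  proof (cases "3 \<le> card (Q a1) + card (Q a2 \<union> J)")
    case True
    then consider "3 \<le> card (Q a2 \<union> J)" | "1 \<le> card (Q a1)" "2 \<le> card (Q a2 \<union> J)"
      | "2 \<le> card (Q a1)" "1 \<le> card (Q a2 \<union> J)" | "3 \<le> card (Q a1)" by linarith
    then show ?thesis
      using gen[OF _ _ num(1)] gen[OF _ _ num(2)] gen[OF _ _ num(3)] gen[OF _ _ num(4)] by cases simp_all
  next
    case False
    have na: "\<not> adj a1 a2"
    proof
      assume a: "adj a1 a2"
      have "c \<in> Q a1 \<union> Q a2" if "c \<in> {c1, c2, c3}" for c
      proof (rule ccontr)
        assume "c \<notin> Q a1 \<union> Q a2"
        then have "adj a1 c" "adj a2 c" using that by (auto simp: Q_def)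
        moreover have "c \<in> S" "adj v c" using that nw by auto
        ultimately show False using K4freeD[OF K v, of a1 a2 c] a nw by blast
      qed
      then have "card {c1, c2, c3} \<le> card (Q a1 \<union> Q a2)" using finQ by (intro card_mono) auto
      also have "\<dots> \<le> card (Q a1) + card (Q a2)" by (rule card_Un_le)
      finally show False using False w(2) a by (simp add: J_def)
    qed
    then have le1: "card (Q a1) + card (Q a2) \<le> 1" using False cQJ by (simp add: J_def)
    note nn = na nadj_sym[OF na]
    show ?thesis
    proof (cases "Q a1 = {} \<and> Q a2 = {}")
      case True
      then have e: "adj a1 c1" "adj a1 c2" "adj a1 c3" "adj a2 c1" "adj a2 c2" "adj a2 c3" by (auto simp: Q_def)
      have w': "nb S v = {a1, c1, c2, c3, a2}" "distinct [a1, c1, c2, c3, a2]" using w by auto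
      show ?thesis by (rule deg5_K23[OF ok min v w' i na e])
    next
      case ne: False
      have key: ?thesis
        if n: "nb S v = {e1, f1, e2, e3, f2}" "distinct [e1, f1, e2, e3, f2]" and q: "Q f2 = {}" "Q f1 = {e1}"
          and i: "\<not> adj e1 e2" "\<not> adj e1 e3" "\<not> adj e2 e3" "\<not> adj f1 f2" and c: "{c1, c2, c3} = {e1, e2, e3}" for e1 e2 e3 f1 f2
      proof (rule deg5_K23_minus_edge[OF ok min v n i])
        show "\<not> adj f1 e1" using q(2) by (auto simp: Q_def)
        have "adj f1 z" if "z \<in> {e2, e3}" for z
        proof -
          have "z \<notin> Q f1" using q(2) n(2) that by auto
          then show ?thesis using that c by (auto simp: Q_def)
        qed
        then show "adj f1 e2" "adj f1 e3" by auto
        have "adj f2 z" if "z \<in> {e1, e2, e3}" for z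
          using q(1) that c unfolding Q_def by blast
        then show "adj f2 e1" "adj f2 e2" "adj f2 e3" by auto
      qed
      have key': ?thesis
        if f: "{f1, f2} = {a1, a2}" "f1 \<noteq> f2" "\<not> adj f1 f2" "Q f2 = {}" "Q f1 \<noteq> {}" "card (Q f1) \<le> 1" for f1 f2
      proof -
        have "card (Q f1) = 1" using f(5,6) finQ[of f1] by (simp add: le_Suc_eq)
        then obtain e where e: "Q f1 = {e}" by (auto simp: card_1_singleton_iff)
        have "e \<in> {c1, c2, c3}" using e by (auto simp: Q_def)
        have N: "nb S v = {c1, c2, c3} \<union> {f1, f2}" unfolding f(1) w(1) by auto
        have ff: "f1 \<in> {a1, a2}" "f2 \<in> {a1, a2}" using f(1) by auto
        consider "e = c1" | "e = c2" | "e = c3" using \<open>e \<in> _\<close> by blast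
        then show ?thesis
        proof cases
          case 1
          show ?thesis
            by (rule key[of c1 f1 c2 c3 f2]) (use 1 e f(2-4) i' w(2) ff N in auto)
        next
          case 2
          show ?thesis
            by (rule key[of c2 f1 c1 c3 f2]) (use 2 e f(2-4) i' w(2) ff N in auto)
        next
          case 3
          show ?thesis
            by (rule key[of c3 f1 c1 c2 f2]) (use 3 e f(2-4) i' w(2) ff N in auto)
        qed
      qed
      show ?thesis
      proof (cases "Q a2 = {}")
        case True
        then show ?thesis using key'[of a1 a2] ne nn le1 w(2) by auto
      next
        case False
        then have "card (Q a2) \<noteq> 0" using finQ by simp
        then have "card (Q a1) = 0" "card (Q a2) \<le> 1" using le1 by auto
        then have "Q a1 = {}" using finQ by simp
        then show ?thesis using key'[of a2 a1] False nn \<open>card (Q a2) \<le> 1\<close> w(2) by auto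
      qed
    qed
  qed
qed

lemma isotri_outer5:
  assumes "finite S" "deg S u = 5" "isotri T u" "T = S - R - NN w"
    "v \<in> nb S u" "q \<in> nb S u" "t \<in> nb S u" "distinct [v, q, t]" "v \<notin> T" "q \<notin> T" "t \<notin> T"
  shows "\<exists>e f. nb S u = {v, q, t, e, f} \<and> distinct [v, q, t, e, f] \<and> adj e f \<and> e \<in> T \<and> f \<in> T \<and>
    nb T e = {u, f} \<and> nb T f = {u, e}"
proof -
  obtain e f where ef: "e \<noteq> f" "adj e f" "nb T u = {e, f}" "nb T e = {u, f}" "nb T f = {u, e}"
    using assms(3) unfolding isotri_def by blast
  have m: "e \<in> T" "f \<in> T" "adj u e" "adj u f" using nbD[OF ef(3)] by auto
  have dis: "distinct [v, q, t, e, f]" using m assms(8-) ef(1) by auto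
  have "{v, q, t, e, f} = nb S u"
  proof (rule card_subset_eq[OF finite_nb[OF assms(1)]])
    show "{v, q, t, e, f} \<subseteq> nb S u" using m assms(4-7) by auto
    show "card {v, q, t, e, f} = card (nb S u)" using dis assms(2) by (simp add: deg_def)
  qed
  then show ?thesis using ef m dis by metis
qed

text \<open>The plain count \<open>y ^ 6 + 3 * y ^ 7 + y ^ 8\<close> exceeds 1 by less than 0.01, so
  only the case of all degrees 5 is hard. If no rotation or reflection of the cycle yields a saving,
  the outer neighbours \<open>t1\<close>, \<open>t2\<close> of \<open>c5\<close> reach degree 5 only
  by both being adjacent to \<open>c1\<close>, which is a K_4 with \<open>c5\<close>.\<close>

lemma deg5_cycle:
  assumes ok: "ok S" and K: "K4free S" and min: "\<And>u. u \<in> S \<Longrightarrow> 5 \<le> deg S u"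
    and v: "v \<in> S" and w: "nb S v = {c1, c2, c3, c4, c5}" "distinct [c1, c2, c3, c4, c5]"
    and e: "adj c1 c2" "adj c2 c3" "adj c3 c4" "adj c4 c5" "adj c5 c1"
    and i: "\<not> adj c1 c3" "\<not> adj c1 c4" "\<not> adj c2 c4" "\<not> adj c2 c5" "\<not> adj c3 c5"
  shows "real (b S) \<le> x ^ card S"
proof -
  note fin = ok_finite[OF ok] and e' = e e[THEN adj_sym] i i[THEN nadj_sym] and nw = nb5[OF w(1)]
  have d: "5 \<le> deg S c1" "5 \<le> deg S c2" "5 \<le> deg S c3" "5 \<le> deg S c4" "5 \<le> deg S c5" using min nw by auto
  have card2: "card {c1, c2} = 2" using w(2) by simp
  have w': "nb S v = {c1, c3, c5, c2, c4}" "distinct [c1, c3, c5, c2, c4]" using w by auto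
  note o5 = order5[OF ok v w', where ?Q2.0 = "{c1}" and ?Q3.0 = "{c3}" and ?Q4.0 = "{c5}" and ?Q5.0 = "{c1, c2}" and ?j4.0 = 1 and ?j5.0 = 2]
  consider "6 \<le> deg S c1" | "6 \<le> deg S c2" | "6 \<le> deg S c3" | "6 \<le> deg S c4" | "6 \<le> deg S c5"
    | "deg S c1 = 5" "deg S c2 = 5" "deg S c3 = 5" "deg S c4 = 5" "deg S c5 = 5" using d by linarith
  then show ?thesis
  proof cases
    case 1
    then show ?thesis using o5[of 6 5 5 5 5] w(2) d e' y_bounds card2 by (auto simp: y_powers)
  next
    case 2
    then show ?thesis using o5[of 5 5 5 6 5] w(2) d e' y_bounds card2 by (auto simp: y_powers)
  next
    case 3
    then show ?thesis using o5[of 5 6 5 5 5] w(2) d e' y_bounds card2 by (auto simp: y_powers)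
  next
    case 4
    then show ?thesis using o5[of 5 5 5 5 6] w(2) d e' y_bounds card2 by (auto simp: y_powers)
  next
    case 5
    then show ?thesis using o5[of 5 5 6 5 5] w(2) d e' y_bounds card2 by (auto simp: y_powers)
  next
    case D: 6
    show ?thesis
    proof (rule ccontr)
      assume neg: "\<not> ?thesis"
      have key: "isotri (S - {c1} - NN c3) c5"
        if w: "nb S v = {c1, c3, c5, c2, c4}" "distinct [c1, c3, c5, c2, c4]"
          and e: "adj c3 c4" "adj c4 c5" "adj c5 c1" "adj c5 c4" "adj c1 c5"
          and i: "\<not> adj c1 c3" "\<not> adj c1 c4" "\<not> adj c2 c4" "\<not> adj c2 c5" "\<not> adj c3 c5"
          and D: "deg S c1 = 5" "deg S c2 = 5" "deg S c3 = 5" "deg S c4 = 5" "deg S c5 = 5" for c1 c2 c3 c4 c5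
      proof (rule ccontr)
        assume iso: "\<not> isotri (S - {c1} - NN c3) c5"
        note nw = nb5[OF w(1)] and i' = i i[THEN nadj_sym]
        have "real (b S) \<le> x ^ card S"
        proof (rule five_term_bound[OF expand5[OF fin v w]])
          show "real (b (S - {} - NN c1)) \<le> y ^ 6 * x ^ card S"
            by (rule cut[OF ok, where d = 5 and Q = "{}"]) (use nw D in auto)
          show "real (b (S - {c1} - NN c3)) \<le> lam * y ^ 7 * x ^ card S"
            by (rule cut_low[OF ok, where d = 5 and Q = "{c1}" and u = c5 and B = "{v, c1, c4}"])
              (use nw D e i' w(2) v y1 iso in auto)
          show "real (b (S - {c1, c3} - NN c5)) \<le> y ^ 7 * x ^ card S"
            by (rule cut[OF ok, where d = 5 and Q = "{c3}"]) (use nw D i' w(2) in auto)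
          show "real (b (S - {c1, c3, c5} - NN c2)) \<le> y ^ 7 * x ^ card S"
            by (rule cut[OF ok, where d = 5 and Q = "{c5}"]) (use nw D i' w(2) in auto)
          show "real (b (S - {c1, c3, c5, c2} - NN c4)) \<le> y ^ 8 * x ^ card S"
            by (rule cut[OF ok, where d = 5 and Q = "{c1, c2}"]) (use nw D i' w(2) in auto)
          show "y ^ 6 + lam * y ^ 7 + y ^ 7 + y ^ 7 + y ^ 8 \<le> 1" using y_bounds unfolding lam_power_values by (simp add: y_powers)
        qed
        then show False using neg by blast
      qed
      let ?Ta = "S - {c1} - NN c3" and ?Tb = "S - {c4} - NN c2" and ?Tc = "S - {c4} - NN c1"
      have wb: "nb S v = {c4, c2, c5, c3, c1}" "nb S v = {c4, c1, c3, c5, c2}" using w(1) by auto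
      have Ia: "isotri ?Ta c5" by (rule key[OF w']) (use e' D in simp_all)
      have Ib: "isotri ?Tb c5" by (rule key[OF wb(1)]) (use e' D w(2) in auto)
      have Ic: "isotri ?Tc c3" by (rule key[OF wb(2)]) (use e' D w(2) in auto)
      obtain t1 t2 where t: "nb S c5 = {v, c1, c4, t1, t2}" "distinct [v, c1, c4, t1, t2]" "adj t1 t2" "t1 \<in> ?Ta" "t2 \<in> ?Ta"
        "nb ?Ta t1 = {c5, t2}" "nb ?Ta t2 = {c5, t1}"
        using isotri_outer5[OF fin D(5) Ia refl, of v c1 c4] nw e' v w(2) by auto
      obtain s1 s2 where s: "nb S c5 = {v, c1, c4, s1, s2}" "distinct [v, c1, c4, s1, s2]" "s1 \<in> ?Tb" "s2 \<in> ?Tb"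
        "nb ?Tb s1 = {c5, s2}" "nb ?Tb s2 = {c5, s1}"
        using isotri_outer5[OF fin D(5) Ib refl, of v c1 c4] nw e' v w(2) by auto
      obtain u1 u2 where u: "nb S c3 = {v, c2, c4, u1, u2}" "adj u1 u2"
        using isotri_outer5[OF fin D(3) Ic refl, of v c2 c4] nw e' v w(2) by auto
      have "{t1, t2} = {s1, s2}" using t(1,2) s(1,2) by auto
      then have Tb: "t1 \<in> ?Tb" "t2 \<in> ?Tb" "nb ?Tb t1 = {c5, t2}" "nb ?Tb t2 = {c5, t1}"
        using s t(2) by (auto simp: doubleton_eq_iff)
      note nt = nb5[OF t(1)] and nu = nb5[OF u(1)]
      have "\<not> (adj c2 u1 \<and> adj c2 u2)"
        using K4freeD[OF K, of c2 c3 u1 u2] nu nw e' u(2) by blast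
      \<comment> \<open>At most one of \<open>u1\<close>, \<open>u2\<close> is adjacent to
        \<open>c2\<close>. This \<open>m\<close> is the only vertex besides \<open>c1\<close>,
        \<open>c4\<close> and their own triangle that \<open>t1\<close> and \<open>t2\<close> can be
        adjacent to.\<close>
      then obtain m where m: "\<And>z. adj c2 z \<Longrightarrow> z \<in> {u1, u2} \<Longrightarrow> z = m" by blast
      have full: "adj z c1"
        if z: "z \<in> ?Ta" "z \<in> ?Tb" "adj c5 z" "nb ?Ta z = {c5, z'}" "nb ?Tb z = {c5, z'}" for z z'
      proof -
        have zv: "\<not> adj z v"
        proof
          assume "adj z v"
          then have "z \<in> {c1, c2, c3, c4, c5}" using nb_mem[OF w(1), of z] z(1) adj_sym by blast
          then show False using z e' adj_irrefl by auto
        qed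
        have sub: "nb S z \<subseteq> {c5, z', c1, c4, m}"
        proof
          fix t assume t: "t \<in> nb S z"
          show "t \<in> {c5, z', c1, c4, m}"
          proof (rule ccontr)
            assume n: "t \<notin> {c5, z', c1, c4, m}"
            have "t \<notin> ?Ta" using nb_mem[OF z(4), of t] t n by auto
            moreover have "t \<notin> ?Tb" using nb_mem[OF z(5), of t] t n by auto
            moreover have "t \<noteq> c3" "t \<noteq> c2" using t z(1,2) adj_sym by auto
            ultimately have a: "adj c3 t" "adj c2 t" "t \<in> S" using t n by auto
            have "t \<noteq> v" using t zv by auto
            then have "t \<in> {u1, u2}" using nb_mem[OF u(1) a(3,1)] n \<open>t \<noteq> c2\<close> by auto
            then show False using m[OF a(2)] n by auto
          qed
        qed
        have eq: "nb S z = {c5, z', c1, c4, m}"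
        proof (rule card_seteq[OF _ sub])
          have "card {c5, z', c1, c4, m} \<le> 5" by (simp add: card_insert_if)
          then show "card {c5, z', c1, c4, m} \<le> card (nb S z)" using min[of z] z(1) by (simp add: deg_def)
        qed simp
        have "c1 \<in> nb S z" unfolding eq by simp
        then show ?thesis by simp
      qed
      have "adj t1 c1" "adj t2 c1" using full[OF t(4) Tb(1) _ t(6) Tb(3)] full[OF t(5) Tb(2) _ t(7) Tb(4)] nt by blast+
      then show False using K4freeD[OF K, of c5 c1 t1 t2] nt nw e' t(3) adj_sym by blast
    qed
  qed
qed

text \<open>A triangle-free graph on five vertices contains an independent triple or is a 5-cycle.
  The cases follow the number of neighbours of \<open>p\<close> in it.\<close>

lemma deg5:
  assumes ok: "ok S" and K: "K4free S" and v: "v \<in> S" "deg S v = 5" and min: "\<And>u. u \<in> S \<Longrightarrow> 5 \<le> deg S u"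
  shows "real (b S) \<le> x ^ card S"
proof -
  have "card (nb S v) = Suc 4" using v(2) by (simp add: deg_def)
  then obtain p N where N: "nb S v = insert p N" "p \<notin> N" "card N = 4" unfolding card_Suc_eq by blast
  then obtain q r s t where "N = {q, r, s, t}" "distinct [q, r, s, t]"
    by (auto simp: card_Suc_eq eval_nat_numeral)
  with N have w: "nb S v = {p, q, r, s, t}" "distinct [p, q, r, s, t]" by simp_all
  have tri: "\<not> adj d e" if "c \<in> nb S v" "d \<in> nb S v" "e \<in> nb S v" "adj c d" "adj c e" for c d e
    using K4freeD[OF K v(1), of c d e] that by auto
  have three: ?thesis if n: "nb S v = {p, a, c, e, f}" "distinct [p, a, c, e, f]" "adj p a" "adj p c" "adj p e" for a c e f
  proof (rule deg5_triple[OF ok K min v(1), of a c e p f])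
    have mem: "p \<in> nb S v" "a \<in> nb S v" "c \<in> nb S v" "e \<in> nb S v" unfolding n(1) by simp_all
    show "\<not> adj a c" "\<not> adj a e" "\<not> adj c e" using tri mem n(3-5) by blast+
  qed (use n(1,2) in auto)
  have none: ?thesis if n: "nb S v = {p, a, c, e, f}" "distinct [p, a, c, e, f]" "\<not> adj p a" "\<not> adj p c" "\<not> adj p e" for a c e f
  proof -
    have mem: "a \<in> nb S v" "c \<in> nb S v" "e \<in> nb S v" unfolding n(1) by simp_all
    have p': "nb S v = {p, a, c, e, f}" "nb S v = {p, a, e, c, f}" "nb S v = {p, c, e, a, f}" using n(1) by auto
    consider "\<not> adj a c" | "\<not> adj a e" | "\<not> adj c e" using tri[OF mem] by blast
    then show ?thesis
    proof cases
      case 1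
      show ?thesis by (rule deg5_triple[OF ok K min v(1) p'(1)]) (use 1 n(2-) in auto)
    next
      case 2
      show ?thesis by (rule deg5_triple[OF ok K min v(1) p'(2)]) (use 2 n(2-) in auto)
    next
      case 3
      show ?thesis by (rule deg5_triple[OF ok K min v(1) p'(3)]) (use 3 n(2-) in auto)
    qed
  qed
  have two: ?thesis
    if n: "nb S v = {p, a, c, e, f}" "distinct [p, a, c, e, f]" "adj p a" "adj p c" "\<not> adj p e" "\<not> adj p f" for a c e f
  proof -
    have mem: "p \<in> nb S v" "a \<in> nb S v" "c \<in> nb S v" "e \<in> nb S v" "f \<in> nb S v" unfolding n(1) by simp_all
    have ac: "\<not> adj a c" using tri[OF mem(1-3)] n by blast
    have cyc: ?thesis
      if m: "nb S v = {p, a, e, f, c}" "distinct [p, a, e, f, c]" "adj p a" "adj p c" "\<not> adj p e" "\<not> adj p f" "\<not> adj a c"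
        "adj e f" "adj a e" for a c e f
    proof -
      have mem: "a \<in> nb S v" "c \<in> nb S v" "e \<in> nb S v" "f \<in> nb S v" unfolding m(1) by simp_all
      have af: "\<not> adj a f" using tri[OF mem(3,1,4)] m(8,9) adj_sym by blast
      have tr: ?thesis if "\<not> adj c f"
      proof (rule deg5_triple[OF ok K min v(1), of a c f p e])
      qed (use m(1,2,7) af that in auto)
      have ce: ?thesis if "adj c e" "adj c f"
        using tri[OF mem(2,3,4)] that m(8) by blast
      show ?thesis
      proof (cases "adj c f \<and> \<not> adj c e")
        case True
        show ?thesis
          by (rule deg5_cycle[OF ok K min v(1) m(1,2)]) (use m af True adj_sym nadj_sym in blast)+
      next
        case False
        then show ?thesis using tr ce by blast
      qed
    qed
    have q: "nb S v = {p, e, f, a, c}" "nb S v = {a, c, e, p, f}" "nb S v = {p, a, e, f, c}" "nb S v = {p, c, e, f, a}"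
      using n(1) by auto
    show ?thesis
    proof (cases "adj e f")
      case False
      show ?thesis by (rule deg5_triple[OF ok K min v(1) q(1)]) (use n(2-) False in auto)
    next
      case True
      consider "adj a e" | "adj c e" | "\<not> adj a e" "\<not> adj c e" by blast
      then show ?thesis
      proof cases
        case 1
        show ?thesis by (rule cyc[OF q(3)]) (use n(2-) ac True 1 in auto)
      next
        case 2
        show ?thesis by (rule cyc[OF q(4)]) (use n(2-) nadj_sym[OF ac] True 2 in auto)
      next
        case 3
        show ?thesis by (rule deg5_triple[OF ok K min v(1) q(2)]) (use n(2) ac 3 in auto)
      qed
    qed
  qed
  have perm: "nb S v = {p, q, r, t, s}" "nb S v = {p, q, s, t, r}" "nb S v = {p, r, s, t, q}"
    "nb S v = {p, q, s, r, t}" "nb S v = {p, q, t, r, s}" "nb S v = {p, r, s, q, t}" "nb S v = {p, r, t, q, s}" "nb S v = {p, s, t, q, r}"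
    using w(1) by auto
  have dis: "distinct [p, q, r, t, s]" "distinct [p, q, s, t, r]" "distinct [p, r, s, t, q]"
    "distinct [p, q, s, r, t]" "distinct [p, q, t, r, s]" "distinct [p, r, s, q, t]" "distinct [p, r, t, q, s]" "distinct [p, s, t, q, r]"
    using w(2) by auto
  note T = three[OF w] three[OF perm(1) dis(1)] three[OF perm(2) dis(2)] three[OF perm(3) dis(3)]
  note N = none[OF w] none[OF perm(1) dis(1)] none[OF perm(2) dis(2)] none[OF perm(3) dis(3)]
  note W = two[OF w] two[OF perm(4) dis(4)] two[OF perm(5) dis(5)] two[OF perm(6) dis(6)] two[OF perm(7) dis(7)] two[OF perm(8) dis(8)]
  show ?thesis
    by (cases "adj p q"; cases "adj p r"; cases "adj p s"; cases "adj p t") (use T N W in blast)+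
qed

text \<open>Degree 2 is tight, \<open>2 * y ^ 3 = 1\<close>, as disjoint triangles show. From degree
  6 on branching at \<open>v\<close> alone works, because \<open>y + y ^ 7 \<le> 1\<close>.\<close>

theorem K4_free_bound:
  assumes "finite S" "K4free S"
  shows "real (b S) \<le> x ^ card S"
proof (rule induct_bound[where P = K4free])
  fix S v assume K: "K4free S" and ok: "ok S" and v: "v \<in> S" and min: "\<And>u. u \<in> S \<Longrightarrow> deg S v \<le> deg S u"
  consider "deg S v \<le> 1" | "deg S v = 2" | "deg S v = 3" | "deg S v = 4" | "deg S v = 5" | "6 \<le> deg S v" by linarith
  then show "real (b S) \<le> x ^ card S"
  proof cases
    case 1
    have "y ^ 2 \<le> 1" using y_le1 y_pos by (simp add: power_le_one)
    with leaf[OF ok v 1] show ?thesis by (rule scaled_bound)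
  next
    case 2
    show ?thesis by (rule branch_two[OF ok v 2]) (use min 2 y3 in auto)
  next
    case 3
    show ?thesis by (rule deg3[OF ok K v 3]) (use min 3 in simp)
  next
    case 4
    show ?thesis by (rule deg4[OF ok K v 4]) (use min 4 in simp)
  next
    case 5
    show ?thesis by (rule deg5[OF ok K v 5]) (use min 5 in simp)
  next
    case 6
    show ?thesis by (rule branch_high_degree[OF ok v 6]) (use y_bounds in \<open>simp add: y_powers\<close>)
  qed
next
  fix S T assume "K4free S" "T \<subseteq> S"
  then show "K4free T" unfolding K4free_def by blast
qed (use assms in auto)

end

section \<open>Forbidding disjoint cliques\<close>

context rate
begin

definition is_clique :: "'a set \<Rightarrow> bool" where
  "is_clique A \<longleftrightarrow> (\<forall>u\<in>A. \<forall>v\<in>A. u \<noteq> v \<longrightarrow> adj u v)"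

text \<open>Pairwise nonadjacent copies of K_i picked one after the other; the recursive form lets
  \<open>bounded_degree_family\<close> remove them one at a time.\<close>

fun family :: "nat \<Rightarrow> nat \<Rightarrow> 'a set \<Rightarrow> bool" where
  "family i 0 S \<longleftrightarrow> True"
| "family i (Suc m) S \<longleftrightarrow> (\<exists>A\<subseteq>S. card A = i \<and> is_clique A \<and> family i m (S - (\<Union>a\<in>A. NN a)))"

lemma family_mono: "family i m T \<Longrightarrow> T \<subseteq> S \<Longrightarrow> family i m S"
proof (induction m arbitrary: S T)
  case (Suc m)
  then obtain A where A: "A \<subseteq> T" "card A = i" "is_clique A" "family i m (T - (\<Union>a\<in>A. NN a))"
    unfolding family.simps by (elim exE conjE)
  have "family i m (S - (\<Union>a\<in>A. NN a))"
    by (rule Suc.IH[OF A(4)]) (rule Diff_mono[OF Suc.prems(2) order_refl])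
  moreover have "A \<subseteq> S" using A(1) Suc.prems(2) by (rule order_trans)
  ultimately show ?case using A(2,3) unfolding family.simps by (intro exI[of _ A] conjI)
qed simp

text \<open>Branching at a vertex of \<open>R\<close> produces two sets that both miss it, so each
  vertex of \<open>R\<close> costs a factor of at most 2.\<close>

lemma delete_set:
  assumes "finite S" "R \<subseteq> S" "\<And>U. U \<subseteq> S - R \<Longrightarrow> real (b U) \<le> B" "0 \<le> B"
  shows "real (b S) \<le> 2 ^ card R * B"
  using assms
proof (induction "card R" arbitrary: S R rule: less_induct)
  case less
  show ?case
  proof (cases "R = {}")
    case True
    then show ?thesis using less.prems by simp
  next
    case False
    then obtain w where w: "w \<in> R" by blast
    have finR: "finite R" using less.prems finite_subset by blast
    have half: "real (b T) \<le> 2 ^ (card R - 1) * B" if T: "T \<subseteq> S" "w \<notin> T" for T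
    proof -
      have "R \<inter> T \<subseteq> R - {w}" using T by blast
      then have c: "card (R \<inter> T) \<le> card R - 1"
        using card_mono[of "R - {w}" "R \<inter> T"] finR w by simp
      moreover have "card R > 0" using finR w card_gt_0_iff by blast
      ultimately have "card (R \<inter> T) < card R" by linarith
      then have "real (b T) \<le> 2 ^ card (R \<inter> T) * B"
        using less.prems T finite_subset[OF T(1)] by (intro less.hyps) auto
      also have "\<dots> \<le> 2 ^ (card R - 1) * B"
        using c less.prems(4) by (intro mult_right_mono power_increasing) auto
      finally show ?thesis .
    qed
    have "real (b (S - {w})) \<le> 2 ^ (card R - 1) * B" "real (b (S - {} - NN w)) \<le> 2 ^ (card R - 1) * B"
      by (rule half; auto)+
    moreover have "b S \<le> b (S - {w}) + b (S - {} - NN w)"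
      using branch1[OF less.prems(1)] w less.prems(2) by blast
    ultimately have "real (b S) \<le> 2 * 2 ^ (card R - 1) * B" by linarith
    also have "2 * 2 ^ (card R - 1) = (2 :: real) ^ card R"
    proof -
      have "card R = Suc (card R - 1)" using w finR card_gt_0_iff[of R] by auto
      then show ?thesis by (metis power_Suc)
    qed
    finally show ?thesis .
  qed
qed

text \<open>The closed neighbourhood of a copy of K_i has at most \<open>i * Suc D\<close> vertices.
  Its deletion lowers the number of disjoint copies still excluded by one, so the factor does not
  depend on \<open>S\<close>.\<close>

lemma bounded_degree_family:
  assumes "finite S" "\<And>u. u \<in> S \<Longrightarrow> deg S u \<le> D" "\<not> family i m S" "0 \<le> B"
    and "\<And>U. U \<subseteq> S \<Longrightarrow> (\<And>A. A \<subseteq> U \<Longrightarrow> card A = i \<Longrightarrow> \<not> is_clique A) \<Longrightarrow> real (b U) \<le> B"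
  shows "real (b S) \<le> 2 ^ (m * (i * Suc D)) * B"
  using assms
proof (induction m arbitrary: S)
  case (Suc m)
  show ?case
  proof (cases "\<exists>A\<subseteq>S. card A = i \<and> is_clique A")
    case False
    then have "real (b S) \<le> B" using Suc.prems(5)[of S] by blast
    also have "B \<le> 2 ^ (Suc m * (i * Suc D)) * B"
      using Suc.prems(4) mult_right_mono[of 1 "2 ^ (Suc m * (i * Suc D))" B] one_le_power[of "2::real"] by simp
    finally show ?thesis .
  next
    case True
    then obtain A where A: "A \<subseteq> S" "card A = i" "is_clique A" by blast
    define R where "R = S \<inter> (\<Union>a\<in>A. NN a)"
    have SR: "S - R = S - (\<Union>a\<in>A. NN a)" by (auto simp: R_def)
    have finA: "finite A" using A(1) Suc.prems(1) finite_subset by blast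
    have "card R \<le> (\<Sum>a\<in>A. card (S \<inter> NN a))"
      unfolding R_def Int_UN_distrib by (rule card_UN_le[OF finA])
    also have "\<dots> \<le> (\<Sum>a\<in>A. Suc D)"
    proof (rule sum_mono)
      fix a assume "a \<in> A"
      then have a: "a \<in> S" using A(1) by blast
      have "S \<inter> NN a = insert a (nb S a)" using a by (auto simp: NN_def nb_def)
      then have "card (S \<inter> NN a) \<le> Suc (card (nb S a))"
        by (simp add: card_insert_le_m1 card_insert_if finite_nb Suc.prems(1))
      then show "card (S \<inter> NN a) \<le> Suc D" using Suc.prems(2)[OF a] by (simp add: deg_def)
    qed
    finally have cR: "card R \<le> i * Suc D" using A(2) by simp
    have "real (b U) \<le> 2 ^ (m * (i * Suc D)) * B" if U: "U \<subseteq> S - R" for U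
    proof (rule Suc.IH)
      show "finite U" using U Suc.prems(1) finite_subset by blast
      show "deg U u \<le> D" if "u \<in> U" for u
      proof -
        have "deg U u \<le> deg S u" unfolding deg_def
          using U Suc.prems(1) by (intro card_mono finite_nb) (auto simp: nb_def)
        then show ?thesis using Suc.prems(2)[of u] U that by auto
      qed
      show "\<not> family i m U"
      proof
        assume "family i m U"
        then have "family i m (S - (\<Union>a\<in>A. NN a))" by (rule family_mono) (use U in \<open>simp only: SR\<close>)
        then have "family i (Suc m) S" unfolding family.simps using A by (intro exI[of _ A] conjI)
        then show False using Suc.prems(3) by contradiction
      qed
      fix U' assume "U' \<subseteq> U" "\<And>A. A \<subseteq> U' \<Longrightarrow> card A = i \<Longrightarrow> \<not> is_clique A"
      then show "real (b U') \<le> B" using Suc.prems(5)[of U'] U by blast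
    qed (rule Suc.prems(4))
    then have "real (b S) \<le> 2 ^ card R * (2 ^ (m * (i * Suc D)) * B)"
      using Suc.prems(1,4) by (intro delete_set) (auto simp: R_def)
    also have "\<dots> \<le> 2 ^ (i * Suc D) * (2 ^ (m * (i * Suc D)) * B)"
      using cR Suc.prems(4) by (intro mult_right_mono power_increasing) auto
    also have "\<dots> = 2 ^ (Suc m * (i * Suc D)) * B" by (simp add: power_add)
    finally show ?thesis .
  qed
qed simp

text \<open>Branching at a vertex of degree above \<open>D\<close> preserves the bound, as
  \<open>y + y ^ (2 + D) \<le> 1\<close>. The constant factor is paid only once, when all degrees
  are at most \<open>D\<close>.\<close>

theorem multipartite_bound:
  assumes "finite S" "y + y ^ (2 + D) \<le> 1" "\<not> family i m S" "0 \<le> C"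
    and C: "\<And>U. U \<subseteq> S \<Longrightarrow> (\<And>A. A \<subseteq> U \<Longrightarrow> card A = i \<Longrightarrow> \<not> is_clique A) \<Longrightarrow> real (b U) \<le> C * x ^ card U"
  shows "real (b S) \<le> 2 ^ (m * (i * Suc D)) * C * x ^ card S"
  using assms(1,3,5)
proof (induction rule: finite_psubset_induct)
  case (psubset S)
  let ?M = "2 ^ (m * (i * Suc D)) * C"
  have M: "0 \<le> ?M" using assms(4) by simp
  have IH: "real (b T) \<le> ?M * x ^ card T" if "T \<subset> S" for T
  proof (rule psubset.IH[OF that])
    show "\<not> family i m T" using family_mono[of i m T S] psubset.prems(1) that by blast
  qed (use psubset.prems(2) that in blast)
  show ?case
  proof (cases "\<forall>u\<in>S. deg S u \<le> D")
    case True
    have "real (b S) \<le> 2 ^ (m * (i * Suc D)) * (C * x ^ card S)"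
    proof (rule bounded_degree_family[OF psubset.hyps _ psubset.prems(1)])
      fix U assume U: "U \<subseteq> S" "\<And>A. A \<subseteq> U \<Longrightarrow> card A = i \<Longrightarrow> \<not> is_clique A"
      have "real (b U) \<le> C * x ^ card U" using psubset.prems(2) U by blast
      also have "\<dots> \<le> C * x ^ card S"
        using assms(4) x1 card_mono[OF psubset.hyps U(1)] by (intro mult_left_mono power_increasing) auto
      finally show "real (b U) \<le> C * x ^ card S" .
    qed (use True assms(4) x1 in auto)
    then show ?thesis by (simp add: mult.assoc)
  next
    case False
    then obtain w where w: "w \<in> S" "Suc D \<le> deg S w" by auto
    have "x ^ card (S - {w}) \<le> y ^ 1 * x ^ card S"
      using psubset.hyps w by (intro pow_cut[where Q = "{w}"]) auto
    then have "?M * x ^ card (S - {w}) \<le> ?M * (y ^ 1 * x ^ card S)" by (rule mult_left_mono[OF _ M])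
    then have "real (b (S - {w})) \<le> ?M * (y ^ 1 * x ^ card S)"
      by (rule order_trans[OF IH, rotated]) (use w in auto)
    moreover have "x ^ card (S - {} - NN w) \<le> y ^ (2 + D) * x ^ card S"
      using psubset.hyps w by (intro pow_cut_nn[where d = "Suc D" and Q = "{}"]) auto
    then have "?M * x ^ card (S - {} - NN w) \<le> ?M * (y ^ (2 + D) * x ^ card S)" by (rule mult_left_mono[OF _ M])
    then have "real (b (S - {} - NN w)) \<le> ?M * (y ^ (2 + D) * x ^ card S)"
      by (rule order_trans[OF IH, rotated]) (use w in auto)
    ultimately have "real (b S) \<le> ?M * (y ^ 1 * x ^ card S) + ?M * (y ^ (2 + D) * x ^ card S)"
      using branch1[OF psubset.hyps w(1)] by linarith
    also have "\<dots> = ?M * x ^ card S * (y + y ^ (2 + D))" by (simp add: algebra_simps)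
    also have "\<dots> \<le> ?M * x ^ card S * 1"
      using assms(2) M x_power_pos[of "card S"] by (intro mult_left_mono) auto
    finally show ?thesis by simp
  qed
qed

text \<open>Each class of \<open>f\<close> is placed inside one of the cliques. Different cliques
  are not adjacent, so in the complement this is an induced complete multipartite graph.\<close>

lemma family_embedding:
  fixes f :: "nat \<Rightarrow> nat"
  assumes "finite S" "finite VH" "f ` VH \<subseteq> {..<m}" "\<And>j. card {v\<in>VH. f v = j} \<le> i" "family i m S"
  shows "\<exists>g. inj_on g VH \<and> g ` VH \<subseteq> S \<and> (\<forall>u\<in>VH. \<forall>v\<in>VH. u \<noteq> v \<longrightarrow> (adj (g u) (g v) \<longleftrightarrow> f u = f v))"
  using assms
proof (induction m arbitrary: VH S)
  case 0
  then show ?case by auto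
next
  case (Suc m)
  obtain A where A: "A \<subseteq> S" "card A = i" "is_clique A" "family i m (S - (\<Union>a\<in>A. NN a))"
    using Suc.prems(5) unfolding family.simps by (elim exE conjE)
  let ?S = "S - (\<Union>a\<in>A. NN a)"
  let ?V = "{v\<in>VH. f v < m}" and ?W = "{v\<in>VH. f v = m}"
  have finA: "finite A" using A(1) Suc.prems(1) finite_subset by blast
  have "\<exists>g. inj_on g ?V \<and> g ` ?V \<subseteq> ?S \<and> (\<forall>u\<in>?V. \<forall>v\<in>?V. u \<noteq> v \<longrightarrow> (adj (g u) (g v) \<longleftrightarrow> f u = f v))"
  proof (rule Suc.IH[OF _ _ _ _ A(4)])
    fix j
    have "card {v\<in>?V. f v = j} \<le> card {v\<in>VH. f v = j}" using Suc.prems(2) by (intro card_mono) auto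
    then show "card {v\<in>?V. f v = j} \<le> i" using Suc.prems(4)[of j] by linarith
  qed (use Suc.prems(1,2) in auto)
  then obtain g where g: "inj_on g ?V" "g ` ?V \<subseteq> ?S"
    "\<forall>u\<in>?V. \<forall>v\<in>?V. u \<noteq> v \<longrightarrow> (adj (g u) (g v) \<longleftrightarrow> f u = f v)" by (elim exE conjE)
  obtain k where k: "k ` ?W \<subseteq> A" "inj_on k ?W"
    using card_le_inj[of ?W A] finA Suc.prems(2) Suc.prems(4)[of m] A(2) by auto
  define h where "h v = (if f v = m then k v else g v)" for v
  have cases: "v \<in> ?V \<or> v \<in> ?W" if "v \<in> VH" for v
    using Suc.prems(3) that by (auto simp: image_subset_iff less_Suc_eq)
  have hV: "h v = g v" "h v \<in> ?S" if "v \<in> ?V" for v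
    using that g(2) by (auto simp: h_def image_subset_iff)
  have hW: "h v = k v" "h v \<in> A" if "v \<in> ?W" for v using that k(1) by (auto simp: h_def)
  have cross: "h u \<noteq> h v \<and> \<not> adj (h u) (h v) \<and> \<not> adj (h v) (h u)" if "u \<in> ?V" "v \<in> ?W" for u v
    using hV(2)[OF that(1)] hW(2)[OF that(2)] adj_sym by auto
  have ne: "h u \<noteq> h v" if uv: "u \<in> VH" "v \<in> VH" "u \<noteq> v" for u v
  proof -
    consider "u \<in> ?V" "v \<in> ?V" | "u \<in> ?W" "v \<in> ?W" | "u \<in> ?V" "v \<in> ?W" | "u \<in> ?W" "v \<in> ?V"
      using cases[OF uv(1)] cases[OF uv(2)] by argo
    then show ?thesis
    proof cases
      case 1
      then show ?thesis using inj_onD[OF g(1) _ 1] hV(1)[OF 1(1)] hV(1)[OF 1(2)] uv(3) by auto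
    next
      case 2
      then show ?thesis using inj_onD[OF k(2) _ 2] hW(1)[OF 2(1)] hW(1)[OF 2(2)] uv(3) by auto
    next
      case 3
      then show ?thesis using cross[OF 3] by simp
    next
      case 4
      then show ?thesis using cross[OF 4(2,1)] by auto
    qed
  qed
  have adjh: "adj (h u) (h v) \<longleftrightarrow> f u = f v" if uv: "u \<in> VH" "v \<in> VH" "u \<noteq> v" for u v
  proof -
    consider "u \<in> ?V" "v \<in> ?V" | "u \<in> ?W" "v \<in> ?W" | "u \<in> ?V" "v \<in> ?W" | "u \<in> ?W" "v \<in> ?V"
      using cases[OF uv(1)] cases[OF uv(2)] by argo
    then show ?thesis
    proof cases
      case 1
      then show ?thesis using g(3)[rule_format, OF 1 uv(3)] hV(1)[OF 1(1)] hV(1)[OF 1(2)] by simp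
    next
      case 2
      then show ?thesis using A(3) hW(2)[OF 2(1)] hW(2)[OF 2(2)] ne[OF uv] by (simp add: is_clique_def)
    next
      case 3
      then show ?thesis using cross[OF 3] by auto
    next
      case 4
      then show ?thesis using cross[OF 4(2,1)] by auto
    qed
  qed
  have "h ` VH \<subseteq> S"
  proof
    fix z assume "z \<in> h ` VH"
    then obtain v where v: "v \<in> VH" "z = h v" by (rule imageE) simp
    then show "z \<in> S" using cases[OF v(1)] hV(2)[of v] hW(2)[of v] A(1) by blast
  qed
  moreover have "inj_on h VH" by (rule inj_onI) (use ne in blast)
  ultimately show ?case using adjh by (intro exI[of _ h]) simp
qed

end

section \<open>The rates for clique complexes of graphs without large independent sets\<close>

lemma branching_total_betti:
  "branching (\<lambda>u v. u \<noteq> v \<and> {u, v} \<notin> E) (\<lambda>S. total_betti K S E)"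
proof
  fix S :: "nat set" and w assume S: "finite S" "w \<in> S"
  have "link_verts S E w = S - insert w {u. w \<noteq> u \<and> {w, u} \<notin> E}"
    by (auto simp: link_verts_def insert_commute)
  then show "total_betti K S E \<le> total_betti K (S - {w}) E + total_betti K (S - insert w {u. w \<noteq> u \<and> {w, u} \<notin> E}) E"
    using total_betti_delete_link[OF S, of K E] by simp
next
  fix S :: "nat set" and v assume S: "finite S" "v \<in> S" "\<And>u. u \<in> S \<Longrightarrow> \<not> (v \<noteq> u \<and> {v, u} \<notin> E)"
  then have "link_verts S E v = S - {v}" by (auto simp: link_verts_def insert_commute)
  then show "total_betti K S E = 0" using total_betti_cone S by blast
qed (auto simp: total_betti_empty insert_commute)

definition indep_set :: "nat set set \<Rightarrow> nat set \<Rightarrow> bool" where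
  "indep_set E A \<longleftrightarrow> (\<forall>u\<in>A. \<forall>v\<in>A. u \<noteq> v \<longrightarrow> {u, v} \<notin> E)"

definition indep_free :: "nat \<Rightarrow> nat set \<Rightarrow> nat set set \<Rightarrow> bool" where
  "indep_free i V E \<longleftrightarrow> (\<forall>A\<subseteq>V. card A = i \<longrightarrow> \<not> indep_set E A)"

lemma rate_total_betti:
  assumes "1 \<le> x" shows "rate (\<lambda>u v. u \<noteq> v \<and> {u, v} \<notin> E) (\<lambda>S. total_betti K S E) x (1 / x)"
  using assms branching_total_betti by (intro rate.intro rate_axioms.intro) auto

lemma root_ge_1: "0 < n \<Longrightarrow> 1 \<le> a \<Longrightarrow> 1 \<le> root n a"
  using real_root_le_mono[of n 1 a] by simp

lemma total_betti_general:
  assumes "finite V" shows "real (total_betti K V E) \<le> root 5 4 ^ card V"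
proof -
  interpret rate "\<lambda>u v. u \<noteq> v \<and> {u, v} \<notin> E" "\<lambda>S. total_betti K S E" "root 5 4" "1 / root 5 4"
    by (rule rate_total_betti) (simp add: root_ge_1)
  show ?thesis by (rule general_bound) (use assms in \<open>auto simp: power_divide\<close>)
qed

lemma total_betti_indep5:
  assumes "finite V" "indep_free 5 V E" shows "real (total_betti K V E) \<le> root 4 3 ^ card V"
proof -
  interpret rate "\<lambda>u v. u \<noteq> v \<and> {u, v} \<notin> E" "\<lambda>S. total_betti K S E" "root 4 3" "1 / root 4 3"
    by (rule rate_total_betti) (simp add: root_ge_1)
  show ?thesis
  proof (rule K5_free_bound)
    fix v p q r s
    assume m: "{v, p, q, r, s} \<subseteq> V" "v \<noteq> p \<and> {v, p} \<notin> E" "v \<noteq> q \<and> {v, q} \<notin> E" "v \<noteq> r \<and> {v, r} \<notin> E" "v \<noteq> s \<and> {v, s} \<notin> E"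
      "p \<noteq> q \<and> {p, q} \<notin> E" "p \<noteq> r \<and> {p, r} \<notin> E" "p \<noteq> s \<and> {p, s} \<notin> E" "q \<noteq> r \<and> {q, r} \<notin> E" "q \<noteq> s \<and> {q, s} \<notin> E"
      "r \<noteq> s \<and> {r, s} \<notin> E"
    have "indep_set E {v, p, q, r, s}" using m by (auto simp: indep_set_def insert_commute)
    moreover have "card {v, p, q, r, s} = 5" using m by simp
    ultimately show False using assms(2) m(1) by (auto simp: indep_free_def)
  qed (use assms in \<open>auto simp: power_divide\<close>)
qed

lemma total_betti_indep4:
  assumes "finite V" "indep_free 4 V E" shows "real (total_betti K V E) \<le> root 3 2 ^ card V"
proof -
  interpret rate "\<lambda>u v. u \<noteq> v \<and> {u, v} \<notin> E" "\<lambda>S. total_betti K S E" "root 3 2" "1 / root 3 2"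
    by (rule rate_total_betti) (simp add: root_ge_1)
  interpret rate_K4 "\<lambda>u v. u \<noteq> v \<and> {u, v} \<notin> E" "\<lambda>S. total_betti K S E" "root 3 2" "1 / root 3 2"
    by unfold_locales (simp add: power_divide)
  show ?thesis
  proof (rule K4_free_bound[OF assms(1)], unfold K4free_def, intro ballI impI)
    fix p q r s
    assume m: "p \<in> V" "q \<in> V" "r \<in> V" "s \<in> V"
      "p \<noteq> q \<and> {p, q} \<notin> E" "p \<noteq> r \<and> {p, r} \<notin> E" "p \<noteq> s \<and> {p, s} \<notin> E" "q \<noteq> r \<and> {q, r} \<notin> E" "q \<noteq> s \<and> {q, s} \<notin> E"
      "r \<noteq> s \<and> {r, s} \<notin> E"
    have "indep_set E {p, q, r, s}" using m by (auto simp: indep_set_def insert_commute)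
    moreover have "card {p, q, r, s} = 4" using m by simp
    ultimately show False using assms(2) m by (auto simp: indep_free_def)
  qed
qed

lemma sum_inverse_powers:
  fixes x :: real
  assumes "x \<noteq> 0"
  shows "((1 / x) ^ 5 + (1 / x) ^ 6 + (1 / x) ^ 7 + (1 / x) ^ 8) * x ^ 8 = x ^ 3 + x ^ 2 + x + 1"
proof -
  have "(1 / x) ^ k * x ^ 8 = x ^ (8 - k)" if "k \<le> 8" for k
    using that assms by (simp add: power_diff power_divide)
  from this[of 5] this[of 6] this[of 7] this[of 8] show ?thesis
    unfolding distrib_right by simp
qed

text \<open>Division by \<open>x ^ 8\<close> gives \<open>y ^ 5 + y ^ 6 + y ^ 7 + y ^ 8 = 1\<close>
  for \<open>y = 1 / x\<close>. Its left side is strictly monotone, hence uniqueness; it is also the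
  form in which the constant enters \<open>K3_free_bound\<close>.\<close>

lemma Gamma4_ex1: "\<exists>!x::real. 1 \<le> x \<and> x \<le> 2 \<and> x ^ 8 - x ^ 3 - x ^ 2 - x - 1 = 0"
proof -
  let ?f = "\<lambda>x::real. x ^ 8 - x ^ 3 - x ^ 2 - x - 1"
  have "\<exists>x. 1 \<le> x \<and> x \<le> 2 \<and> ?f x = 0"
    by (rule IVT) (auto intro!: continuous_intros)
  moreover have "x = z" if "1 \<le> x" "?f x = 0" "1 \<le> z" "?f z = 0" for x z
  proof -
    have one: "(1 / x) ^ 5 + (1 / x) ^ 6 + (1 / x) ^ 7 + (1 / x) ^ 8 = 1" if "1 \<le> x" "?f x = 0" for x :: real
    proof -
      have "((1 / x) ^ 5 + (1 / x) ^ 6 + (1 / x) ^ 7 + (1 / x) ^ 8) * x ^ 8 = x ^ 3 + x ^ 2 + x + 1"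
        using that(1) by (intro sum_inverse_powers) simp
      also have "\<dots> = x ^ 8" using that(2) by simp
      finally show ?thesis using that(1) by simp
    qed
    have mono: "(1 / x) ^ 5 + (1 / x) ^ 6 + (1 / x) ^ 7 + (1 / x) ^ 8 > (1 / z) ^ 5 + (1 / z) ^ 6 + (1 / z) ^ 7 + (1 / z) ^ 8"
      if "1 \<le> x" "x < z" for x z :: real
    proof -
      have "1 / z < 1 / x" "0 < 1 / z" using that by (auto simp: field_simps)
      then show ?thesis by (intro add_strict_mono power_strict_mono) auto
    qed
    show ?thesis
      using mono[of x z] mono[of z x] one[OF that(1,2)] one[OF that(3,4)] that(1,3) by (cases x z rule: linorder_cases) auto
  qed
  ultimately show ?thesis by blast
qed

lemma Gamma4_root: "1 \<le> Gamma4" "Gamma4 ^ 8 = Gamma4 ^ 3 + Gamma4 ^ 2 + Gamma4 + 1"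
  using theI'[OF Gamma4_ex1] unfolding Gamma4_def by (auto simp: algebra_simps)

lemma total_betti_indep3:
  assumes "finite V" "indep_free 3 V E" shows "real (total_betti K V E) \<le> Gamma4 ^ card V"
proof -
  let ?y = "1 / Gamma4"
  interpret rate "\<lambda>u v. u \<noteq> v \<and> {u, v} \<notin> E" "\<lambda>S. total_betti K S E" Gamma4 ?y
    by (rule rate_total_betti[OF Gamma4_root(1)])
  have "(?y ^ 5 + ?y ^ 6 + ?y ^ 7 + ?y ^ 8) * Gamma4 ^ 8 = Gamma4 ^ 3 + Gamma4 ^ 2 + Gamma4 + 1"
    using Gamma4_root(1) by (intro sum_inverse_powers) simp
  then have sum: "?y ^ 5 + ?y ^ 6 + ?y ^ 7 + ?y ^ 8 = 1"
    using Gamma4_root by (metis mult_cancel_right2 not_one_le_zero power_not_zero)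
  have y0: "0 < ?y" using Gamma4_root(1) by simp
  show ?thesis
  proof (rule K3_free_bound)
    \<comment> \<open>At 0.8046 the sum of the four powers already exceeds 1. At 0.62, just above
      the positive root of \<open>y + y\<^sup>2 = 1\<close>, it is still far below 1.\<close>
    show "?y \<le> 8046 / 10000"
    proof (rule ccontr)
      assume "\<not> ?thesis"
      then have "(8046 / 10000) ^ k \<le> ?y ^ k" for k by (intro power_mono) auto
      from this[of 5] this[of 6] this[of 7] this[of 8] show False using sum by (simp add: power_divide)
    qed
    show "1 \<le> ?y + ?y\<^sup>2"
    proof (rule ccontr)
      assume n: "\<not> ?thesis"
      have "?y \<le> 62 / 100"
      proof (rule ccontr)
        assume "\<not> ?thesis"
        then have "62 / 100 \<le> ?y" "(62 / 100)\<^sup>2 \<le> ?y\<^sup>2" by (auto intro!: power_mono)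
        then show False using n by (simp add: power_divide)
      qed
      then have "?y ^ k \<le> (62 / 100) ^ k" for k using y0 by (intro power_mono) auto
      from this[of 5] this[of 6] this[of 7] this[of 8] show False using sum by (simp add: power_divide)
    qed
    fix p q r assume m: "{p, q, r} \<subseteq> V" "p \<noteq> q \<and> {p, q} \<notin> E" "p \<noteq> r \<and> {p, r} \<notin> E" "q \<noteq> r \<and> {q, r} \<notin> E"
    have "indep_set E {p, q, r}" using m by (auto simp: indep_set_def insert_commute)
    moreover have "card {p, q, r} = 3" using m by simp
    ultimately show False using assms(2) m(1) by (auto simp: indep_free_def)
  qed (use sum assms in auto)
qed

lemma total_betti_indep2:
  assumes "finite V" "indep_free i V E" "i \<le> 2" shows "total_betti K V E \<le> 1"
proof (cases "V = {}")
  case True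
  then show ?thesis by (simp add: total_betti_empty)
next
  case False
  then obtain v where v: "v \<in> V" by blast
  consider "i = 0" | "i = 1" | "i = 2" using assms(3) by linarith
  then show ?thesis
  proof cases
    case 1
    then have "\<not> indep_set E {}" using assms(2)[unfolded indep_free_def, rule_format, of "{}"] by simp
    then show ?thesis by (simp add: indep_set_def)
  next
    case 2
    then have "\<not> indep_set E {v}" using assms(2)[unfolded indep_free_def, rule_format, of "{v}"] v by simp
    then show ?thesis by (simp add: indep_set_def)
  next
    case 3
    have "link_verts V E v = V - {v}"
    proof -
      have "{u, v} \<in> E" if "u \<in> V" "u \<noteq> v" for u
      proof (rule ccontr)
        assume "{u, v} \<notin> E"
        then have "indep_set E {u, v}" by (auto simp: indep_set_def insert_commute)
        moreover have "card {u, v} = 2" using that by simp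
        ultimately show False using assms(2) that v 3 by (auto simp: indep_free_def)
      qed
      then show ?thesis by (auto simp: link_verts_def)
    qed
    then show ?thesis using total_betti_cone[OF assms(1) v, of E K] by simp
  qed
qed

section \<open>The extremal function\<close>

text \<open>\<open>induced_sub\<close> also compares singletons as edges. Dropping the case
  \<open>u = v\<close> gives a notion that applies to edge sets containing singletons.\<close>

definition embeds :: "nat set \<Rightarrow> nat set set \<Rightarrow> nat set \<Rightarrow> nat set set \<Rightarrow> bool" where
  "embeds VH EH V E \<longleftrightarrow> (\<exists>f. inj_on f VH \<and> f ` VH \<subseteq> V \<and>
     (\<forall>u\<in>VH. \<forall>v\<in>VH. u \<noteq> v \<longrightarrow> ({u, v} \<in> EH \<longleftrightarrow> {f u, f v} \<in> E)))"

lemma induced_sub_iff_embeds: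
  assumes "\<And>u. {u} \<notin> EH" "\<And>u. {u} \<notin> E"
  shows "induced_sub VH EH V E \<longleftrightarrow> embeds VH EH V E"
proof -
  have "({u, v} \<in> EH \<longleftrightarrow> {f u, f v} \<in> E) \<longleftrightarrow> (u \<noteq> v \<longrightarrow> ({u, v} \<in> EH \<longleftrightarrow> {f u, f v} \<in> E))" for u v f
    using assms by auto
  then show ?thesis unfolding induced_sub_def embeds_def by presburger
qed

lemma simple_graph_no_loop: "simple_graph V E \<Longrightarrow> {u} \<notin> E"
  by (auto simp: simple_graph_def)

lemma finite_betti_values:
  "finite {total_betti K V E | V E. V \<subseteq> {..<n} \<and> simple_graph V E \<and> \<not> induced_sub VH EH V E}"
proof -
  have "{total_betti K V E | V E. V \<subseteq> {..<n} \<and> simple_graph V E \<and> \<not> induced_sub VH EH V E}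
      \<subseteq> (\<lambda>(V, E). total_betti K V E) ` (Pow {..<n} \<times> Pow (Pow {..<n}))"
    by (auto simp: simple_graph_def)
  then show ?thesis by (rule finite_subset) simp
qed

lemma bH_le:
  assumes "\<And>V E. V \<subseteq> {..<n} \<Longrightarrow> simple_graph V E \<Longrightarrow> \<not> induced_sub VH EH V E \<Longrightarrow> real (total_betti K V E) \<le> c" "0 \<le> c"
  shows "real (bH K VH EH n) \<le> c"
proof -
  let ?X = "{total_betti K V E | V E. V \<subseteq> {..<n} \<and> simple_graph V E \<and> \<not> induced_sub VH EH V E}"
  show ?thesis
  proof (cases "?X = {}")
    \<comment> \<open>If no graph qualifies, the supremum of the empty set of natural numbers is 0;
      this is where \<open>0 \<le> c\<close> is used.\<close>
    case True
    then show ?thesis using assms(2) unfolding bH_def True by simp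
  next
    case False
    have "Max ?X \<in> ?X" by (rule Max_in[OF finite_betti_values False])
    then have "real (Max ?X) \<le> c" using assms(1) by force
    then show ?thesis unfolding bH_def using cSup_eq_Max[OF finite_betti_values False] by simp
  qed
qed

lemma bH_attained:
  assumes "VH \<noteq> {}"
  shows "\<exists>V E. V \<subseteq> {..<n} \<and> simple_graph V E \<and> \<not> induced_sub VH EH V E \<and> bH K VH EH n = total_betti K V E"
proof -
  let ?X = "{total_betti K V E | V E. V \<subseteq> {..<n} \<and> simple_graph V E \<and> \<not> induced_sub VH EH V E}"
  have "simple_graph {} {}" "\<not> induced_sub VH EH {} {}"
    using assms by (auto simp: simple_graph_def induced_sub_def)
  then have ne: "?X \<noteq> {}" by blast
  have "bH K VH EH n = Max ?X" unfolding bH_def using cSup_eq_Max[OF finite_betti_values ne] .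
  moreover have "Max ?X \<in> ?X" by (rule Max_in[OF finite_betti_values ne])
  ultimately show ?thesis by auto
qed

lemma bH_ge:
  assumes "V \<subseteq> {..<n}" "simple_graph V E" "\<not> induced_sub VH EH V E"
  shows "total_betti K V E \<le> bH K VH EH n"
  unfolding bH_def using assms
  by (intro cSup_upper bdd_above_finite finite_betti_values) auto

lemma mem_edge_rel:
  assumes "\<And>u v. P u v \<Longrightarrow> P v u"
  shows "{a, c} \<in> {{u, v} | u v. P u v} \<longleftrightarrow> P a c"
  using assms by (auto simp: doubleton_eq_iff)

text \<open>\<open>bH\<close> ranges over simple graphs with vertices below \<open>n\<close>. The
  rank of a vertex within \<open>V\<close> is the order-preserving relabelling that
  \<open>total_betti_relabel\<close> asks for, and singletons in \<open>E\<close> are discarded on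
  the way.\<close>

lemma bH_ge_relabelled:
  assumes fin: "finite V" and n: "card V \<le> n" and H: "simple_graph VH EH" "\<not> embeds VH EH V E"
  shows "total_betti K V E \<le> bH K VH EH n"
proof -
  define g where "g v = card {u \<in> V. u < v}" for v
  have gm: "g u < g v" if "u \<in> V" "v \<in> V" "u < v" for u v
    unfolding g_def by (rule psubset_card_mono) (use fin that in auto)
  have inj: "inj_on g V" by (rule inj_onI) (metis gm linorder_neqE_nat less_irrefl)
  define h where "h = inv_into V g"
  have hg: "h (g v) = v" if "v \<in> V" for v
    unfolding h_def using inj that by simp
  have img: "g ` V \<subseteq> {..<card V}"
  proof
    fix z assume "z \<in> g ` V"
    then obtain v where v: "v \<in> V" "z = g v" by blast
    have "g v < card V" unfolding g_def by (rule psubset_card_mono) (use fin v in auto)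
    then show "z \<in> {..<card V}" using v by simp
  qed
  let ?P = "\<lambda>a c. \<exists>u\<in>V. \<exists>v\<in>V. u \<noteq> v \<and> {u, v} \<in> E \<and> a = g u \<and> c = g v"
  define E' where "E' = {{a, c} | a c. ?P a c}"
  have symP: "?P c a" if "?P a c" for a c using that by (metis insert_commute)
  have E'P: "{a, c} \<in> E' \<longleftrightarrow> ?P a c" for a c
    unfolding E'_def by (rule mem_edge_rel) (rule symP)
  have E'g: "{g u, g v} \<in> E' \<longleftrightarrow> {u, v} \<in> E" if "u \<in> V" "v \<in> V" "u \<noteq> v" for u v
    unfolding E'P using that inj by (auto dest: inj_onD)
  have sg: "simple_graph (g ` V) E'"
    unfolding simple_graph_def
  proof (intro conjI ballI)
    fix e assume "e \<in> E'"
    then obtain u v where uv: "u \<in> V" "v \<in> V" "u \<noteq> v" "e = {g u, g v}" unfolding E'_def by auto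
    then show "e \<subseteq> g ` V" "card e = 2" using inj by (auto simp: inj_on_eq_iff)
  qed (use fin in simp)
  have "\<not> embeds VH EH (g ` V) E'"
  proof
    assume "embeds VH EH (g ` V) E'"
    then obtain f where f: "inj_on f VH" "f ` VH \<subseteq> g ` V"
      "\<forall>u\<in>VH. \<forall>v\<in>VH. u \<noteq> v \<longrightarrow> ({u, v} \<in> EH \<longleftrightarrow> {f u, f v} \<in> E')"
      unfolding embeds_def by (elim exE conjE)
    have fg: "h (f u) \<in> V" "g (h (f u)) = f u" if "u \<in> VH" for u
    proof -
      have "f u \<in> g ` V" using f(2) that by (rule subsetD[OF _ imageI])
      then obtain v where "v \<in> V" "f u = g v" by (rule imageE)
      then show "h (f u) \<in> V" "g (h (f u)) = f u" using hg by auto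
    qed
    have ne: "h (f u) \<noteq> h (f v)" if "u \<in> VH" "v \<in> VH" "u \<noteq> v" for u v
      using fg(2)[OF that(1)] fg(2)[OF that(2)] f(1) that by (metis inj_onD)
    have "embeds VH EH V E"
      unfolding embeds_def
    proof (intro exI[of _ "\<lambda>u. h (f u)"] conjI ballI impI)
      show "inj_on (\<lambda>u. h (f u)) VH" using ne by (meson inj_onI)
      show "(\<lambda>u. h (f u)) ` VH \<subseteq> V" using fg by auto
      fix u v assume uv: "u \<in> VH" "v \<in> VH" "u \<noteq> v"
      show "{u, v} \<in> EH \<longleftrightarrow> {h (f u), h (f v)} \<in> E"
        using f(3)[rule_format, OF uv] E'g[OF fg(1)[OF uv(1)] fg(1)[OF uv(2)] ne[OF uv]] fg(2) uv by simp
    qed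
    then show False using H(2) by blast
  qed
  then have ni: "\<not> induced_sub VH EH (g ` V) E'"
    using induced_sub_iff_embeds[of EH E'] simple_graph_no_loop[OF H(1)] simple_graph_no_loop[OF sg] by blast
  let ?E2 = "{e \<in> E. card e = 2}"
  have "total_betti K V E = total_betti K V ?E2" by (rule total_betti_cong_edges) auto
  also have "\<dots> \<le> total_betti K (g ` V) E'"
  proof (rule total_betti_relabel[OF fin gm])
    fix u v assume uv: "u \<in> V" "v \<in> V"
    show "{g u, g v} \<in> E' \<longleftrightarrow> {u, v} \<in> ?E2"
      using E'g[OF uv] simple_graph_no_loop[OF sg] by (cases "u = v") auto
  qed
  also have "\<dots> \<le> bH K VH EH n" by (rule bH_ge[OF _ sg ni]) (use img n in auto)
  finally show ?thesis .
qed

text \<open>Division of \<open>n\<close> by \<open>m\<close> with remainder; the remainder may be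
  dropped because all terms are at least 1. The second part makes a single example a lower bound for
  the limit.\<close>

lemma fekete:
  fixes a :: "nat \<Rightarrow> nat"
  assumes pos: "\<And>n. 1 \<le> a n" and super: "\<And>m n. a m * a n \<le> a (m + n)"
    and bd: "\<And>n. real (a n) \<le> C ^ n" and C: "1 \<le> C"
  shows "convergent (\<lambda>n. root n (real (a n)))"
    and "0 < m \<Longrightarrow> root m (real (a m)) \<le> lim (\<lambda>n. root n (real (a n)))"
proof -
  define f where "f n = ln (real (a n))" for n
  have f0: "0 \<le> f n" for n using pos[of n] by (simp add: f_def)
  have fsup: "f m + f n \<le> f (m + n)" for m n
  proof -
    have "f m + f n = ln (real (a m) * real (a n))"
      using pos[of m] pos[of n] by (simp add: f_def ln_mult)
    also have "\<dots> \<le> f (m + n)"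
      unfolding f_def using super[of m n] pos[of m] pos[of n] pos[of "m + n"]
      by (subst ln_le_cancel_iff) (auto simp flip: of_nat_mult)
    finally show ?thesis .
  qed
  have fmul: "real q * f m \<le> f (q * m)" for q m
  proof (induction q)
    case (Suc q)
    then show ?case using fsup[of m "q * m"] by (simp add: algebra_simps)
  qed (simp add: f0)
  have fle: "f m / real m - f m / real n \<le> f n / real n" if "0 < m" "0 < n" for m n
  proof -
    have "real (n div m) * f m \<le> f n"
      using fmul[of "n div m" m] fsup[of "n div m * m" "n mod m"] f0[of "n mod m"] by simp
    moreover have "real n / real m - 1 \<le> real (n div m)"
    proof -
      have "n < m + n div m * m" by (rule dividend_less_div_times[OF that(1)])
      then have "real n < real m + real (n div m) * real m" by (metis of_nat_less_iff of_nat_add of_nat_mult)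
      then show ?thesis using that by (simp add: field_simps)
    qed
    ultimately have "(real n / real m - 1) * f m \<le> f n"
      using mult_right_mono[OF _ f0] order_trans by blast
    then have "(real n / real m - 1) * f m / real n \<le> f n / real n"
      using that by (simp add: divide_right_mono)
    moreover have "(real n / real m - 1) * f m / real n = f m / real m - f m / real n"
      using that by (simp add: field_simps)
    ultimately show ?thesis by simp
  qed
  have fC: "f n / real n \<le> ln C" if "0 < n" for n
  proof -
    have "f n \<le> ln (C ^ n)" unfolding f_def using bd[of n] pos[of n] C by (subst ln_le_cancel_iff) auto
    also have "\<dots> = real n * ln C" using C by (simp add: ln_realpow)
    finally show ?thesis using that by (simp add: field_simps)
  qed
  define L where "L = Sup ((\<lambda>n. f n / real n) ` {0<..})"
  have bdd: "bdd_above ((\<lambda>n. f n / real n) ` {0<..})" by (rule bdd_aboveI[of _ "ln C"]) (use fC in auto)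
  have le_L: "f n / real n \<le> L" if "0 < n" for n
    unfolding L_def by (rule cSup_upper[OF _ bdd]) (use that in auto)
  have lim_f: "(\<lambda>n. f n / real n) \<longlonglongrightarrow> L"
  proof (rule LIMSEQ_I)
    fix e :: real assume e: "0 < e"
    have "\<exists>z\<in>(\<lambda>n. f n / real n) ` {0<..}. L - e / 2 < z"
      using less_cSup_iff[OF _ bdd, of "L - e / 2"] e by (simp add: L_def[symmetric])
    then obtain m where m: "0 < m" "L - e / 2 < f m / real m" by auto
    obtain N where N: "f m / (e / 2) < real N" using reals_Archimedean2 by blast
    show "\<exists>no. \<forall>n\<ge>no. norm (f n / real n - L) < e"
    proof (intro exI[of _ "Suc N"] allI impI)
      fix n assume n: "Suc N \<le> n"
      have "f m / (e / 2) < real n" using N n by linarith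
      then have "f m / real n < e / 2" using e n by (simp add: field_simps)
      then have "L - e < f n / real n" using fle[OF m(1), of n] m(2) n by linarith
      moreover have "f n / real n \<le> L" using le_L n by simp
      ultimately show "norm (f n / real n - L) < e" by (simp add: abs_if)
    qed
  qed
  have rt: "root n (real (a n)) = exp (f n / real n)" if "0 < n" for n
    using that pos[of n] by (simp add: f_def root_powr_inverse powr_def field_simps)
  have "(\<lambda>n. root n (real (a n))) \<longlonglongrightarrow> exp L"
    by (rule Lim_transform_eventually[OF tendsto_exp[OF lim_f]])
      (use rt in \<open>auto simp: eventually_sequentially intro!: exI[of _ 1]\<close>)
  then show "convergent (\<lambda>n. root n (real (a n)))" "0 < m \<Longrightarrow> root m (real (a m)) \<le> lim (\<lambda>n. root n (real (a n)))"
    using le_L[of m] rt[of m] by (auto simp: convergent_def limI)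
qed

section \<open>Edgeless forbidden graphs\<close>

text \<open>The extremal function of the edgeless graph on \<open>i\<close> vertices, with which all
  complete multipartite graphs of largest part \<open>i\<close> are compared.\<close>

definition bI :: "'k::field itself \<Rightarrow> nat \<Rightarrow> nat \<Rightarrow> nat" where
  "bI K i n = bH K {..<i} {} n"

definition cI :: "'k::field itself \<Rightarrow> nat \<Rightarrow> real" where
  "cI K i = lim (\<lambda>n. root n (real (bI K i n)))"

lemma simple_graph_edgeless: "simple_graph {..<i::nat} {}"
  by (simp add: simple_graph_def)

lemma embeds_edgeless_iff: "embeds {..<i} {} V E \<longleftrightarrow> \<not> indep_free i V E"
proof
  assume "embeds {..<i} {} V E"
  then obtain f where f: "inj_on f {..<i}" "f ` {..<i} \<subseteq> V"
    "\<forall>u\<in>{..<i}. \<forall>v\<in>{..<i}. u \<noteq> v \<longrightarrow> ({u, v} \<in> {} \<longleftrightarrow> {f u, f v} \<in> E)"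
    unfolding embeds_def by (elim exE conjE)
  have "indep_set E (f ` {..<i})"
    unfolding indep_set_def
  proof (intro ballI impI)
    fix a c assume "a \<in> f ` {..<i}" "c \<in> f ` {..<i}" "a \<noteq> c"
    then obtain u v where "u < i" "v < i" "a = f u" "c = f v" "u \<noteq> v" by auto
    then show "{a, c} \<notin> E" using f(3)[rule_format, of u v] by simp
  qed
  moreover have "card (f ` {..<i}) = i" using f(1) by (simp add: card_image)
  ultimately show "\<not> indep_free i V E" using f(2) unfolding indep_free_def by blast
next
  assume "\<not> indep_free i V E"
  then obtain A where A: "A \<subseteq> V" "card A = i" "indep_set E A" by (auto simp: indep_free_def)
  show "embeds {..<i} {} V E"
  proof (cases "i = 0")
    case True
    then show ?thesis by (simp add: embeds_def)
  next
    case False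
    then have "finite A" using A(2) card_ge_0_finite by auto
    then obtain h where h: "bij_betw h {..<i} A"
      using ex_bij_betw_nat_finite[of A] A(2) by (auto simp: atLeast0LessThan)
    show ?thesis
      unfolding embeds_def
    proof (intro exI[of _ h] conjI ballI impI)
      show "inj_on h {..<i}" using h by (simp add: bij_betw_def)
      show "h ` {..<i} \<subseteq> V" using h A(1) by (simp add: bij_betw_def)
      fix u v assume uv: "u \<in> {..<i}" "v \<in> {..<i}" "u \<noteq> v"
      then have "h u \<in> A" "h v \<in> A" "h u \<noteq> h v" using h by (auto simp: bij_betw_def inj_on_def)
      then show "{u, v} \<in> {} \<longleftrightarrow> {h u, h v} \<in> E" using A(3) by (simp add: indep_set_def)
    qed
  qed
qed

lemma induced_edgeless_iff: "simple_graph V E \<Longrightarrow> induced_sub {..<i} {} V E \<longleftrightarrow> \<not> indep_free i V E"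
  using induced_sub_iff_embeds[of "{}" E "{..<i}" V] simple_graph_no_loop[of V E] by (simp add: embeds_edgeless_iff)

lemma bI_ge:
  assumes "finite V" "card V \<le> n" "indep_free i V E"
  shows "total_betti K V E \<le> bI K i n"
  unfolding bI_def
  by (rule bH_ge_relabelled[OF assms(1,2) simple_graph_edgeless]) (simp add: embeds_edgeless_iff assms(3))

lemma bI_le:
  assumes "\<And>V E. finite V \<Longrightarrow> card V \<le> n \<Longrightarrow> indep_free i V E \<Longrightarrow> real (total_betti K V E) \<le> c" "0 \<le> c"
  shows "real (bI K i n) \<le> c"
  unfolding bI_def
proof (rule bH_le[OF _ assms(2)])
  fix V E assume V: "V \<subseteq> {..<n}" "simple_graph V E" "\<not> induced_sub {..<i} {} V E"
  have "card V \<le> n" using card_mono[OF _ V(1)] by simp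
  then show "real (total_betti K V E) \<le> c"
    using V induced_edgeless_iff by (intro assms(1)) (auto simp: simple_graph_def)
qed

lemma indep_free_empty: "1 \<le> i \<Longrightarrow> indep_free i {} E"
  by (auto simp: indep_free_def)

lemma bI_ge_1: "1 \<le> i \<Longrightarrow> 1 \<le> bI K i n"
  using bI_ge[of "{}" n i "{}" K] indep_free_empty by (simp add: total_betti_empty)

lemma bI_le_general: "real (bI K i n) \<le> root 5 4 ^ n"
proof (rule bI_le)
  fix V :: "nat set" and E assume "finite V" "card V \<le> n"
  then have "root 5 4 ^ card V \<le> root 5 4 ^ n" by (intro power_increasing root_ge_1) auto
  then show "real (total_betti K V E) \<le> root 5 4 ^ n"
    using total_betti_general[OF \<open>finite V\<close>, of K E] by linarith
qed simp

text \<open>The join of two extremal graphs, the second one shifted by \<open>m\<close> to lie above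
  the first. All edges across are present, so an independent set stays on one side, while Betti
  numbers multiply.\<close>

lemma bI_supermult:
  assumes i: "1 \<le> i" shows "bI K i m * bI K i n \<le> bI K i (m + n)"
proof -
  have "0 \<in> {..<i}" using i by simp
  then have ne: "{..<i} \<noteq> {}" by blast
  obtain V1 E1 where 1: "V1 \<subseteq> {..<m}" "simple_graph V1 E1" "\<not> induced_sub {..<i} {} V1 E1" "bI K i m = total_betti K V1 E1"
    using bH_attained[OF ne, of m "{}" K] unfolding bI_def by blast
  obtain V2 E2 where 2: "V2 \<subseteq> {..<n}" "simple_graph V2 E2" "\<not> induced_sub {..<i} {} V2 E2" "bI K i n = total_betti K V2 E2"
    using bH_attained[OF ne, of n "{}" K] unfolding bI_def by blast
  have free: "indep_free i V1 E1" "indep_free i V2 E2" using 1 2 induced_edgeless_iff by auto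
  have fin: "finite V1" "finite V2" using 1 2 by (auto simp: simple_graph_def)
  let ?g = "\<lambda>v. m + v"
  let ?P = "\<lambda>u v. if u < m \<and> v < m then {u, v} \<in> E1 else if m \<le> u \<and> m \<le> v then {u - m, v - m} \<in> E2 else True"
  define E where "E = {{u, v} | u v. ?P u v}"
  have EP: "{u, v} \<in> E \<longleftrightarrow> ?P u v" for u v
    unfolding E_def by (rule mem_edge_rel) (auto simp: insert_commute split: if_splits)
  let ?V2 = "?g ` V2"
  have "total_betti K V1 E1 = total_betti K V1 E"
    by (rule total_betti_cong_edges) (use 1(1) in \<open>auto simp: EP\<close>)
  moreover have "total_betti K V2 E2 \<le> total_betti K ?V2 E"
    by (rule total_betti_relabel[OF fin(2)]) (auto simp: EP)
  moreover have "total_betti K V1 E * total_betti K ?V2 E \<le> total_betti K (V1 \<union> ?V2) E"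
    by (rule total_betti_join) (use fin 1(1) in \<open>auto simp: EP\<close>)
  moreover have "total_betti K (V1 \<union> ?V2) E \<le> bI K i (m + n)"
  proof (rule bI_ge)
    show "finite (V1 \<union> ?V2)" using fin by simp
    have "V1 \<union> ?V2 \<subseteq> {..<m + n}" using 1(1) 2(1) by auto
    then show "card (V1 \<union> ?V2) \<le> m + n" using card_mono[of "{..<m + n}"] by fastforce
    show "indep_free i (V1 \<union> ?V2) E"
      unfolding indep_free_def
    proof (intro allI impI notI)
      fix A assume A: "A \<subseteq> V1 \<union> ?V2" "card A = i" "indep_set E A"
      show False
      proof (cases "A \<subseteq> V1")
        case True
        have "indep_set E1 A"
          unfolding indep_set_def
        proof (intro ballI impI)
          fix u v assume uv: "u \<in> A" "v \<in> A" "u \<noteq> v"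
          then have "{u, v} \<notin> E" using A(3) by (simp add: indep_set_def)
          moreover have "u < m" "v < m" using uv True 1(1) by auto
          ultimately show "{u, v} \<notin> E1" by (simp add: EP)
        qed
        then show False using free(1) True A(2) by (simp add: indep_free_def)
      next
        case False
        then obtain a where a: "a \<in> A" "a \<in> ?V2" "a \<notin> V1" using A(1) by blast
        have sub: "A \<subseteq> ?V2"
        proof
          fix c assume c: "c \<in> A"
          show "c \<in> ?V2"
          proof (rule ccontr)
            assume "c \<notin> ?V2"
            then have "c \<in> V1" "c \<noteq> a" using A(1) c a by auto
            then have "c < m" "m \<le> a" using 1(1) a by auto
            then have "{c, a} \<in> E" by (simp add: EP)
            then show False using A(3) c a(1) \<open>c \<noteq> a\<close> by (simp add: indep_set_def)
          qed
        qed
        then obtain B where B: "B \<subseteq> V2" "A = ?g ` B" by (auto simp: subset_image_iff)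
        have "card B = i" using A(2) B(2) by (simp add: card_image)
        moreover have "indep_set E2 B"
          unfolding indep_set_def
        proof (intro ballI impI)
          fix u v assume uv: "u \<in> B" "v \<in> B" "u \<noteq> v"
          then have "{m + u, m + v} \<notin> E" using A(3) B(2) by (simp add: indep_set_def)
          then show "{u, v} \<notin> E2" by (simp add: EP)
        qed
        ultimately show False using free(2) B(1) by (simp add: indep_free_def)
      qed
    qed
  qed
  ultimately show ?thesis using 1(4) 2(4) by (metis (no_types, lifting) mult_le_mono order_refl order_trans)
qed

lemma cI_tendsto:
  assumes i: "1 \<le> i" shows "(\<lambda>n. root n (real (bI K i n))) \<longlonglongrightarrow> cI K i"
proof -
  have "convergent (\<lambda>n. root n (real (bI K i n)))"
    by (rule fekete(1)[OF bI_ge_1[OF i] bI_supermult[OF i] bI_le_general]) (simp add: root_ge_1)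
  then show ?thesis unfolding cI_def by (simp add: convergent_LIMSEQ_iff)
qed

lemma cI_ge:
  assumes i: "1 \<le> i" and "0 < m" shows "root m (real (bI K i m)) \<le> cI K i"
  unfolding cI_def
  by (rule fekete(2)[OF bI_ge_1[OF i] bI_supermult[OF i] bI_le_general _ assms(2)]) (simp add: root_ge_1)

lemma cI_le:
  assumes "1 \<le> i" "1 \<le> x" "\<And>V E. finite V \<Longrightarrow> indep_free i V E \<Longrightarrow> real (total_betti K V E) \<le> x ^ card V"
  shows "cI K i \<le> x"
proof (rule LIMSEQ_le_const2[OF cI_tendsto[OF assms(1)]])
  show "\<exists>N. \<forall>n\<ge>N. root n (real (bI K i n)) \<le> x"
  proof (intro exI[of _ 1] allI impI)
    fix n :: nat assume n: "1 \<le> n"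
    have "real (bI K i n) \<le> x ^ n"
    proof (rule bI_le)
      fix V :: "nat set" and E assume V: "finite V" "card V \<le> n" "indep_free i V E"
      have "x ^ card V \<le> x ^ n" using V(2) assms(2) by (intro power_increasing) auto
      then show "real (total_betti K V E) \<le> x ^ n" using assms(3)[OF V(1,3)] by linarith
    qed (use assms(2) in simp)
    then have "root n (real (bI K i n)) \<le> root n (x ^ n)" using n by (intro real_root_le_mono) auto
    then show "root n (real (bI K i n)) \<le> x" using n assms(2) by (simp add: real_root_power_cancel)
  qed
qed

lemma total_betti_edgeless:
  assumes "finite V" "indep_set E V"
  shows "card V \<le> total_betti K V E + 1"
proof -
  have cf: "clique_faces V E = insert {} ((\<lambda>v. {v}) ` V)"
  proof (intro equalityI subsetI)
    fix \<sigma> assume s: "\<sigma> \<in> clique_faces V E"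
    have "\<sigma> = {} \<or> (\<exists>v\<in>V. \<sigma> = {v})"
    proof (cases "\<sigma> = {}")
      case False
      then obtain v where v: "v \<in> \<sigma>" by blast
      have "u = v" if "u \<in> \<sigma>" for u
        using s v that assms(2) unfolding clique_faces_def indep_set_def by blast
      then have "\<sigma> = {v}" using v by blast
      then show ?thesis using s by (auto simp: clique_faces_def)
    qed simp
    then show "\<sigma> \<in> insert {} ((\<lambda>v. {v}) ` V)" by blast
  qed (auto simp: clique_faces_def)
  have "(\<Sum>\<sigma>\<in>clique_faces V E. (-1) ^ card \<sigma> :: int) = 1 + (\<Sum>\<sigma>\<in>(\<lambda>v. {v}) ` V. (-1) ^ card \<sigma>)"
    unfolding cf using assms(1) by (subst sum.insert) auto
  also have "(\<Sum>\<sigma>\<in>(\<lambda>v. {v}) ` V. (-1) ^ card \<sigma> :: int) = - int (card V)"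
    by (subst sum.reindex) (auto simp: inj_on_def)
  finally show ?thesis using euler_char_le_total_betti[OF assms(1), of E K] by linarith
qed

text \<open>\<open>i - 1\<close> isolated points have reduced homology of dimension
  \<open>i - 2\<close>. For \<open>i = 5\<close> and \<open>i = 4\<close> this meets the upper
  bounds 3^(1/4) and 2^(1/3).\<close>

lemma cI_ge_edgeless:
  assumes "2 \<le> i" shows "root (i - 1) (real (i - 2)) \<le> cI K i"
proof -
  have free: "indep_free i {..<i - 1} {}"
  proof -
    have "card A \<noteq> i" if "A \<subseteq> {..<i - 1}" for A
      using card_mono[OF _ that] assms by fastforce
    then show ?thesis by (auto simp: indep_free_def)
  qed
  have "i - 2 \<le> total_betti K {..<i - 1} {}"
    using total_betti_edgeless[of "{..<i - 1}" "{}" K] by (auto simp: indep_set_def)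
  also have "\<dots> \<le> bI K i (i - 1)" by (rule bI_ge[OF _ _ free]) auto
  finally have "root (i - 1) (real (i - 2)) \<le> root (i - 1) (real (bI K i (i - 1)))"
    using assms by (intro real_root_le_mono) auto
  also have "\<dots> \<le> cI K i" using assms by (intro cI_ge) auto
  finally show ?thesis .
qed

section \<open>The theorem\<close>

text \<open>From below: a graph without \<open>i\<close> independent vertices cannot contain
  \<open>H\<close>, which has a part of size \<open>i\<close>. From above: each \<open>x\<close>
  beyond \<open>cI K i\<close> bounds those graphs up to a constant, and
  \<open>multipartite_bound\<close> carries this over to graphs without \<open>H\<close> with a
  larger constant, which the n-th root removes.\<close>

theorem multipartite_limit:
  fixes f :: "nat \<Rightarrow> nat"
  assumes H: "simple_graph VH EH" and EH: "\<And>u v. u \<in> VH \<Longrightarrow> v \<in> VH \<Longrightarrow> u \<noteq> v \<Longrightarrow> {u, v} \<in> EH \<longleftrightarrow> f u \<noteq> f v"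
    and i: "1 \<le> i" and parts: "\<And>j. card {v\<in>VH. f v = j} \<le> i" and big: "card {v\<in>VH. f v = j0} = i"
  shows "(\<lambda>n. root n (real (bH K VH EH n))) \<longlonglongrightarrow> cI K i"
proof -
  have finH: "finite VH" using H by (simp add: simple_graph_def)
  have free: "\<not> embeds VH EH V E" if "indep_free i V E" for V E
  proof
    assume "embeds VH EH V E"
    then obtain g where g: "inj_on g VH" "g ` VH \<subseteq> V"
      "\<forall>u\<in>VH. \<forall>v\<in>VH. u \<noteq> v \<longrightarrow> ({u, v} \<in> EH \<longleftrightarrow> {g u, g v} \<in> E)" unfolding embeds_def by (elim exE conjE)
    let ?W = "{v\<in>VH. f v = j0}"
    have "card (g ` ?W) = i" using big inj_on_subset[OF g(1), of ?W] by (simp add: card_image)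
    moreover have "indep_set E (g ` ?W)"
      unfolding indep_set_def
    proof (intro ballI impI)
      fix a c assume "a \<in> g ` ?W" "c \<in> g ` ?W" "a \<noteq> c"
      then obtain u v where "u \<in> ?W" "v \<in> ?W" "a = g u" "c = g v" "u \<noteq> v" by auto
      then show "{a, c} \<notin> E" using g(3)[rule_format, of u v] EH[of u v] by simp
    qed
    moreover have "g ` ?W \<subseteq> V" using g(2) by blast
    ultimately show False using that by (simp add: indep_free_def)
  qed
  have lower: "bI K i n \<le> bH K VH EH n" for n
  proof -
    have "real (bI K i n) \<le> real (bH K VH EH n)"
    proof (rule bI_le)
      fix V E assume V: "finite V" "card V \<le> n" "indep_free i V E"
      show "real (total_betti K V E) \<le> real (bH K VH EH n)"
        using bH_ge_relabelled[OF V(1,2) H free[OF V(3)], of K] by simp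
    qed simp
    then show ?thesis by simp
  qed
  have c1: "1 \<le> cI K i" using cI_ge[OF i, of 1 K] bI_ge_1[OF i, of K 1] by simp
  have upper: "\<exists>M>0. \<forall>n. real (bH K VH EH n) \<le> M * x ^ n" if x: "cI K i < x" for x
  proof -
    have x1: "1 < x" using c1 x by simp
    obtain N where N: "\<And>n. N \<le> n \<Longrightarrow> root n (real (bI K i n)) < x"
      using order_tendstoD(2)[OF cI_tendsto[OF i] x] by (auto simp: eventually_sequentially)
    \<comment> \<open>The constant absorbs the finitely many \<open>n\<close> for which the root is
      not yet known to be below \<open>x\<close>.\<close>
    define C where "C = real (\<Sum>n\<le>N. bI K i n) + 1"
    have C: "real (bI K i n) \<le> C * x ^ n" for n
    proof (cases "n \<le> N")
      case True
      have "bI K i n \<le> (\<Sum>n\<le>N. bI K i n)" using True by (intro member_le_sum) auto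
      then have "real (bI K i n) \<le> C" unfolding C_def by linarith
      also have "C = C * 1" by simp
      also have "\<dots> \<le> C * x ^ n"
        using x1 by (intro mult_left_mono one_le_power) (auto simp: C_def sum_nonneg)
      finally show ?thesis .
    next
      case False
      then have "root n (real (bI K i n)) ^ n \<le> x ^ n" using N[of n] by (intro power_mono) auto
      then have "real (bI K i n) \<le> x ^ n" using False by simp
      also have "\<dots> \<le> C * x ^ n" using x1 by (simp add: C_def sum_nonneg)
      finally show ?thesis .
    qed
    \<comment> \<open>Branching at large degrees must be free, which needs \<open>1 < x\<close>; the
      strict room above \<open>cI K i\<close> provides this even if that limit is 1.\<close>
    obtain D where D: "(1 / x) ^ D < 1 - 1 / x" using real_arch_pow_inv[of "1 - 1 / x" "1 / x"] x1 by auto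
    \<comment> \<open>A bound on the part labels serves as the number of parts; labels that do not
      occur are empty parts.\<close>
    define m where "m = Suc (Max (insert 0 (f ` VH)))"
    have fm: "f ` VH \<subseteq> {..<m}"
    proof
      fix z assume "z \<in> f ` VH"
      then show "z \<in> {..<m}" using Max_ge[of "insert 0 (f ` VH)" z] finH by (simp add: m_def less_Suc_eq_le)
    qed
    define M where "M = 2 ^ (m * (i * Suc D)) * C"
    have Cpos: "0 < C" unfolding C_def by (rule add_nonneg_pos[OF of_nat_0_le_iff]) simp
    then have M: "0 < M" unfolding M_def by (intro mult_pos_pos) auto
    have "real (bH K VH EH n) \<le> M * x ^ n" for n
    proof (rule bH_le)
      fix V E assume V: "V \<subseteq> {..<n}" "simple_graph V E" "\<not> induced_sub VH EH V E"
      have fin: "finite V" using V(2) by (simp add: simple_graph_def)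
      interpret rate "\<lambda>u v. u \<noteq> v \<and> {u, v} \<notin> E" "\<lambda>S. total_betti K S E" x "1 / x"
        by (rule rate_total_betti) (use x1 in simp)
      have "\<not> family i m V"
      proof
        assume "family i m V"
        from family_embedding[OF fin finH fm parts this]
        obtain g where g: "inj_on g VH" "g ` VH \<subseteq> V"
          "\<forall>u\<in>VH. \<forall>v\<in>VH. u \<noteq> v \<longrightarrow> ((g u \<noteq> g v \<and> {g u, g v} \<notin> E) \<longleftrightarrow> f u = f v)" by (elim exE conjE)
        have "embeds VH EH V E"
          unfolding embeds_def
        proof (intro exI[of _ g] conjI ballI impI g(1,2))
          fix u v assume uv: "u \<in> VH" "v \<in> VH" "u \<noteq> v"
          then have "g u \<noteq> g v" using g(1) by (meson inj_onD)
          then show "{u, v} \<in> EH \<longleftrightarrow> {g u, g v} \<in> E" using g(3)[rule_format, OF uv] EH[OF uv] by blast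
        qed
        then show False
          using V(3) induced_sub_iff_embeds[of EH E VH V] simple_graph_no_loop[OF H] simple_graph_no_loop[OF V(2)] by simp
      qed
      moreover have "1 / x + (1 / x) ^ (2 + D) \<le> 1"
      proof -
        have "(1 / x) ^ (2 + D) \<le> (1 / x) ^ D" using x1 by (intro power_decreasing) auto
        then show ?thesis using D by linarith
      qed
      moreover have "real (total_betti K U E) \<le> C * x ^ card U"
        if "U \<subseteq> V" "\<And>A. A \<subseteq> U \<Longrightarrow> card A = i \<Longrightarrow> \<not> is_clique A" for U
      proof -
        have "indep_free i U E"
          unfolding indep_free_def
        proof (intro allI impI notI)
          fix A assume "A \<subseteq> U" "card A = i" "indep_set E A"
          moreover from this have "is_clique A" by (simp add: is_clique_def indep_set_def)
          ultimately show False using that(2) by blast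
        qed
        then have "total_betti K U E \<le> bI K i (card U)"
          using fin that(1) finite_subset by (intro bI_ge) auto
        then show ?thesis using C[of "card U"] by linarith
      qed
      ultimately have "real (total_betti K V E) \<le> M * x ^ card V"
        unfolding M_def using Cpos by (intro multipartite_bound[OF fin]) auto
      also have "\<dots> \<le> M * x ^ n"
        using M x1 card_mono[OF _ V(1)] by (intro mult_left_mono power_increasing) auto
      finally show "real (total_betti K V E) \<le> M * x ^ n" .
    qed (use M x1 in simp)
    then show ?thesis using M by blast
  qed
  show ?thesis
  proof (rule order_tendstoI)
    fix a assume "a < cI K i"
    with cI_tendsto[OF i] have "\<forall>\<^sub>F n in sequentially. a < root n (real (bI K i n))"
      by (rule order_tendstoD(1))
    then show "\<forall>\<^sub>F n in sequentially. a < root n (real (bH K VH EH n))"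
      using eventually_gt_at_top[of 0]
    proof eventually_elim
      case (elim n)
      have "root n (real (bI K i n)) \<le> root n (real (bH K VH EH n))"
        using lower[of n] elim(2) by (intro real_root_le_mono) auto
      then show ?case using elim(1) by linarith
    qed
  next
    fix a assume "cI K i < a"
    then obtain x where x: "cI K i < x" "x < a" using dense by blast
    obtain M where M: "0 < M" "\<And>n. real (bH K VH EH n) \<le> M * x ^ n" using upper[OF x(1)] by blast
    have x0: "0 \<le> x" using x(1) c1 by linarith
    have "(\<lambda>n. root n M * x) \<longlonglongrightarrow> 1 * x"
      by (intro tendsto_intros LIMSEQ_root_const M(1))
    then have "\<forall>\<^sub>F n in sequentially. root n M * x < a" using x(2) by (intro order_tendstoD(2)) auto
    then show "\<forall>\<^sub>F n in sequentially. root n (real (bH K VH EH n)) < a"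
      using eventually_gt_at_top[of 0]
    proof eventually_elim
      case (elim n)
      have "root n (real (bH K VH EH n)) \<le> root n (M * x ^ n)"
        using M(2)[of n] elim(2) by (intro real_root_le_mono) auto
      also have "\<dots> = root n M * x"
        using elim(2) x0 by (simp add: real_root_mult real_root_power_cancel)
      finally show ?case using elim(1) by linarith
    qed
  qed
qed

lemma K5inf_edge: "{u, v} \<in> K5inf_E \<longleftrightarrow> u div 5 \<noteq> v div 5"
  unfolding K5inf_E_def by (rule mem_edge_rel) auto

lemma K5_total_betti: "4 ^ k \<le> total_betti K {..<5 * k} K5inf_E"
proof (induction k)
  case 0
  then show ?case by (simp add: total_betti_empty)
next
  case (Suc k)
  let ?W = "{5 * k..<5 * k + 5}"
  have d: "v div 5 = k" if "v \<in> ?W" for v using that by (auto simp: div_nat_eqI)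
  have "indep_set K5inf_E ?W" unfolding indep_set_def using d by (simp add: K5inf_edge)
  then have "4 \<le> total_betti K ?W K5inf_E"
    using total_betti_edgeless[of ?W K5inf_E K] by simp
  then have "4 ^ k * 4 \<le> total_betti K {..<5 * k} K5inf_E * total_betti K ?W K5inf_E"
    using Suc by (rule mult_le_mono[rotated])
  also have "\<dots> \<le> total_betti K ({..<5 * k} \<union> ?W) K5inf_E"
  proof (rule total_betti_join)
    fix u v assume uv: "u \<in> {..<5 * k}" "v \<in> ?W"
    have "u div 5 < k" using uv(1) by (simp add: less_mult_imp_div_less mult.commute)
    then show "{u, v} \<in> K5inf_E" using d[OF uv(2)] by (simp add: K5inf_edge)
  qed auto
  also have "{..<5 * k} \<union> ?W = {..<5 * Suc k}" by auto
  finally show ?case by simp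
qed

text \<open>Finite pieces of the infinite multipartite graph avoid \<open>H\<close> and match the
  upper bound valid for all graphs.\<close>

theorem nonmultipartite_limit:
  assumes H: "simple_graph VH EH" and ni: "\<not> induced_sub VH EH K5inf_V K5inf_E"
  shows "(\<lambda>n. root n (real (bH K VH EH n))) \<longlonglongrightarrow> root 5 4"
proof -
  have ne: "\<not> embeds VH EH {..<5 * k} K5inf_E" for k
  proof
    assume "embeds VH EH {..<5 * k} K5inf_E"
    then have "embeds VH EH K5inf_V K5inf_E" unfolding embeds_def K5inf_V_def by blast
    then have "induced_sub VH EH K5inf_V K5inf_E"
      using induced_sub_iff_embeds[of EH K5inf_E VH K5inf_V] simple_graph_no_loop[OF H] K5inf_edge[of u u for u] by simp
    then show False using ni by contradiction
  qed
  \<comment> \<open>The exact rate is visible only at multiples of 5; \<open>fekete\<close>, applied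
    to this sequence, takes care of the other \<open>n\<close>.\<close>
  define a where "a n = (4 :: nat) ^ (n div 5)" for n
  have lower: "a n \<le> bH K VH EH n" for n
    using order_trans[OF K5_total_betti[of "n div 5" K] bH_ge_relabelled[OF _ _ H ne]] by (simp add: a_def)
  have upper: "real (bH K VH EH n) \<le> root 5 4 ^ n" for n
  proof (rule bH_le)
    fix V E assume V: "V \<subseteq> {..<n}" "simple_graph V E"
    have "root 5 4 ^ card V \<le> root 5 4 ^ n"
      using card_mono[OF _ V(1)] by (intro power_increasing root_ge_1) auto
    moreover have "real (total_betti K V E) \<le> root 5 4 ^ card V"
      by (rule total_betti_general) (use V(2) in \<open>simp add: simple_graph_def\<close>)
    ultimately show "real (total_betti K V E) \<le> root 5 4 ^ n" by linarith
  qed simp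
  have a: "1 \<le> a n" "a m * a n \<le> a (m + n)" "real (a n) \<le> root 5 4 ^ n" for m n
  proof -
    show "1 \<le> a n" by (simp add: a_def)
    have "m div 5 + n div 5 \<le> (m + n) div 5" by (subst div_add1_eq[of m n]) simp
    then show "a m * a n \<le> a (m + n)" unfolding a_def power_add[symmetric] by (intro power_increasing) auto
    show "real (a n) \<le> root 5 4 ^ n" using lower[of n] upper[of n] by linarith
  qed
  have r1: "1 \<le> root 5 (4::real)" by (simp add: root_ge_1)
  let ?L = "lim (\<lambda>n. root n (real (a n)))"
  have L: "(\<lambda>n. root n (real (a n))) \<longlonglongrightarrow> ?L"
    using fekete(1)[OF a r1] by (simp add: convergent_LIMSEQ_iff)
  have rle: "root n z \<le> root 5 4" if "0 < n" "z \<le> root 5 4 ^ n" for n z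
  proof -
    have "root n z \<le> root n (root 5 4 ^ n)" using that by (intro real_root_le_mono) auto
    then show ?thesis using that r1 by (simp add: real_root_power_cancel)
  qed
  have "root 5 4 \<le> ?L" using fekete(2)[OF a r1, of 5] by (simp add: a_def)
  moreover have "?L \<le> root 5 4"
    by (rule LIMSEQ_le_const2[OF L]) (use rle a(3) in \<open>auto intro!: exI[of _ 1]\<close>)
  ultimately have L5: "(\<lambda>n. root n (real (a n))) \<longlonglongrightarrow> root 5 4" using L by simp
  show ?thesis
  proof (rule tendsto_sandwich[OF _ _ L5 tendsto_const])
    show "\<forall>\<^sub>F n in sequentially. root n (real (a n)) \<le> root n (real (bH K VH EH n))"
      using eventually_gt_at_top[of 0] by eventually_elim (use lower in simp)
    show "\<forall>\<^sub>F n in sequentially. root n (real (bH K VH EH n)) \<le> root 5 4"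
      using eventually_gt_at_top[of 0] by eventually_elim (use rle upper in simp)
  qed
qed

text \<open>The reduced Euler characteristic up to sign, computed by deletion and link on the list
  of remaining vertices with \<open>R\<close> as adjacency. It evaluates without enumerating the
  faces.\<close>

fun chi :: "(nat \<Rightarrow> nat \<Rightarrow> bool) \<Rightarrow> nat list \<Rightarrow> int" where
  "chi R [] = 1"
| "chi R (w # ws) = chi R ws - chi R (filter (R w) ws)"

lemma chi_correct:
  assumes "distinct ws" "\<And>u v. u \<in> set ws \<Longrightarrow> v \<in> set ws \<Longrightarrow> u \<noteq> v \<Longrightarrow> {u, v} \<in> E \<longleftrightarrow> R u v"
  shows "(\<Sum>\<sigma>\<in>clique_faces (set ws) E. (-1) ^ card \<sigma>) = chi R ws"
  using assms
proof (induction "length ws" arbitrary: ws rule: less_induct)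
  case less
  show ?case
  proof (cases ws)
    case Nil
    have "clique_faces {} E = {{}}" by (auto simp: clique_faces_def)
    then show ?thesis using Nil by simp
  next
    case (Cons w us)
    let ?V = "set ws" and ?L = "clique_faces (link_verts (set ws) E w) E"
    have w: "w \<in> ?V" "?V - {w} = set us" using Cons less.prems(1) by auto
    have "{x, w} \<in> E \<longleftrightarrow> R w x" if "x \<in> set us" for x
      using less.prems(2)[of w x] less.prems(1) that Cons by (auto simp: insert_commute)
    then have L: "link_verts ?V E w = set (filter (R w) us)"
      using less.prems(1) Cons by (auto simp: link_verts_def)
    have nL: "w \<notin> \<tau>" "finite \<tau>" if "\<tau> \<in> ?L" for \<tau>
      using that by (auto simp: clique_faces_def link_verts_def dest: finite_subset)
    have "(\<Sum>\<sigma>\<in>clique_faces ?V E. (-1) ^ card \<sigma> :: int)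
      = (\<Sum>\<sigma>\<in>clique_faces (set us) E. (-1) ^ card \<sigma>) + (\<Sum>\<sigma>\<in>insert w ` ?L. (-1) ^ card \<sigma>)"
      unfolding clique_faces_split[OF w(1)] w(2)
      by (rule sum.union_disjoint) (use w(2) in \<open>auto simp: finite_clique_faces L clique_faces_def[of "set us"]\<close>)
    also have "(\<Sum>\<sigma>\<in>insert w ` ?L. (-1) ^ card \<sigma> :: int) = (\<Sum>\<tau>\<in>?L. (-1) ^ card (insert w \<tau>))"
      by (rule sum.reindex_cong[of "insert w"]) (use nL in \<open>auto intro!: inj_onI simp: insert_ident\<close>)
    also have "\<dots> = - (\<Sum>\<tau>\<in>?L. (-1) ^ card \<tau>)"
      unfolding sum_negf[symmetric] by (rule sum.cong) (use nL in auto)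
    also have "(\<Sum>\<tau>\<in>?L. (-1) ^ card \<tau> :: int) = chi R (filter (R w) us)"
      unfolding L by (rule less.hyps) (use Cons less.prems in \<open>auto simp: less_Suc_eq_le\<close>)
    also have "(\<Sum>\<sigma>\<in>clique_faces (set us) E. (-1) ^ card \<sigma> :: int) = chi R us"
      by (rule less.hyps) (use Cons less.prems in auto)
    finally show ?thesis using Cons by simp
  qed
qed

text \<open>Neighbour lists of a graph found by computer search.\<close>
definition F14 :: "nat list list" where
  "F14 = [[1, 6, 11, 12],
    [0, 3, 10, 13],
    [5, 7, 10, 13],
    [1, 4, 9, 11],
    [3, 7, 8, 13],
    [2, 9, 11, 12],
    [0, 7, 8, 10],
    [2, 4, 6, 11],
    [4, 6, 9, 12],
    [3, 5, 8, 10],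
    [1, 2, 6, 9],
    [0, 3, 5, 7],
    [0, 5, 8, 13],
    [1, 2, 4, 12]]"

lemma F14_symmetric: "\<forall>u\<in>set [0..<14]. \<forall>v\<in>set (F14 ! u). u \<in> set (F14 ! v)"
  by code_simp

lemma F14_triangle_free: "\<forall>u\<in>set [0..<14]. \<forall>v\<in>set (F14 ! u). \<forall>w\<in>set (F14 ! v). w \<notin> set (F14 ! u)"
  by code_simp

lemma chi_F14: "\<bar>chi (\<lambda>u v. v \<notin> set (F14 ! u)) [0..<14]\<bar> = 8"
  by code_simp

lemma bI_3_14: "8 \<le> bI K 3 14"
proof -
  let ?P = "\<lambda>u v. u < 14 \<and> v < 14 \<and> v \<notin> set (F14 ! u)"
  \<comment> \<open>Since no vertex occurs in its own list, \<open>E\<close> also contains the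
    singletons below 14; \<open>bI_ge\<close> admits such edge sets.\<close>
  define E where "E = {{u, v} | u v. ?P u v}"
  have sym: "u \<in> set (F14 ! v)" if "v \<in> set (F14 ! u)" "u < 14" for u v
    using F14_symmetric that by simp
  have EP: "{u, v} \<in> E \<longleftrightarrow> ?P u v" for u v
    unfolding E_def by (rule mem_edge_rel) (use sym in blast)
  have V: "set [0..<14] = {..<14}" by auto
  have "(\<Sum>\<sigma>\<in>clique_faces {..<14} E. (-1) ^ card \<sigma>) = chi (\<lambda>u v. v \<notin> set (F14 ! u)) [0..<14]"
    unfolding V[symmetric] by (rule chi_correct) (auto simp: EP)
  then have "8 \<le> total_betti K {..<14} E"
    using euler_char_le_total_betti[of "{..<14}" E K] chi_F14 by simp
  also have "\<dots> \<le> bI K 3 14"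
  proof (rule bI_ge)
    show "indep_free 3 {..<14} E"
      unfolding indep_free_def
    proof (intro allI impI notI)
      fix A assume A: "A \<subseteq> {..<14}" "card A = 3" "indep_set E A"
      then obtain u v w where A': "A = {u, v, w}" "u \<noteq> v" "u \<noteq> w" "v \<noteq> w"
        by (auto simp: card_Suc_eq eval_nat_numeral)
      have lt: "u < 14" "v < 14" "w < 14" using A(1) A'(1) by auto
      have "{u, v} \<notin> E" "{v, w} \<notin> E" "{u, w} \<notin> E" using A(3) A' by (auto simp: indep_set_def)
      then have "v \<in> set (F14 ! u)" "w \<in> set (F14 ! v)" "w \<in> set (F14 ! u)" using lt by (auto simp: EP)
      then show False using F14_triangle_free lt(1) by auto
    qed
  qed auto
  finally show ?thesis .
qed

lemma cI_5: "cI K 5 = root 4 3"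
  using cI_ge_edgeless[of 5 K] cI_le[of 5 "root 4 3" K] total_betti_indep5 root_ge_1[of 4 3] by force

lemma cI_4: "cI K 4 = root 3 2"
  using cI_ge_edgeless[of 4 K] cI_le[of 4 "root 3 2" K] total_betti_indep4 root_ge_1[of 3 2] by force

lemma cI_3: "root 14 8 \<le> cI K 3" "cI K 3 \<le> Gamma4"
proof -
  have "root 14 8 \<le> root 14 (real (bI K 3 14))" using bI_3_14[of K] by (intro real_root_le_mono) auto
  also have "\<dots> \<le> cI K 3" by (rule cI_ge) auto
  finally show "root 14 8 \<le> cI K 3" .
  show "cI K 3 \<le> Gamma4" by (rule cI_le) (use Gamma4_root(1) total_betti_indep3 in auto)
qed

lemma cI_small:
  assumes "1 \<le> i" "i \<le> 2" shows "cI K i = 1"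
proof (rule antisym)
  show "cI K i \<le> 1"
  proof (rule cI_le[OF assms(1)])
    fix V E assume "finite V" "indep_free i V E"
    then show "real (total_betti K V E) \<le> 1 ^ card V" using total_betti_indep2[OF _ _ assms(2), of V E K] by simp
  qed simp
  show "1 \<le> cI K i" using cI_ge[OF assms(1), of 1 K] bI_ge_1[OF assms(1), of K 1] by simp
qed

lemma bH_no_vertices: "bH K {} EH n = 0"
proof -
  have "induced_sub {} EH V E" for V :: "nat set" and E by (simp add: induced_sub_def)
  then show ?thesis by (simp add: bH_def)
qed

text \<open>If \<open>H\<close> embeds into the infinite multipartite graph, it is itself complete
  multipartite, with the part of the image as label, and its largest part decides the limit. The
  graph without vertices is contained in every graph, so there the sequence is constantly 0.\<close>

lemma convergent_bH:
  assumes H: "simple_graph VH EH"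
  shows "convergent (\<lambda>n. root n (real (bH K VH EH n)))"
proof -
  consider "VH = {}" | "\<not> induced_sub VH EH K5inf_V K5inf_E" | "VH \<noteq> {}" "induced_sub VH EH K5inf_V K5inf_E" by blast
  then show ?thesis
  proof cases
    case 1
    then show ?thesis by (simp add: bH_no_vertices convergent_const)
  next
    case 2
    then show ?thesis using nonmultipartite_limit[OF H] by (auto simp: convergent_def)
  next
    case 3
    then obtain g where g: "inj_on g VH" "\<forall>u\<in>VH. \<forall>v\<in>VH. {u, v} \<in> EH \<longleftrightarrow> {g u, g v} \<in> K5inf_E"
      unfolding induced_sub_def by (elim exE conjE)
    define f where "f v = g v div 5" for v
    define part where "part j = {v\<in>VH. f v = j}" for j
    have fin: "finite VH" using H by (simp add: simple_graph_def)
    define i where "i = Max ((\<lambda>v. card (part (f v))) ` VH)"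
    have "i \<in> (\<lambda>v. card (part (f v))) ` VH" unfolding i_def using fin 3(1) by (intro Max_in) auto
    then obtain v0 where v0: "v0 \<in> VH" "card (part (f v0)) = i" by auto
    have parts: "card (part j) \<le> i" for j
    proof (cases "\<exists>v\<in>VH. f v = j")
      case True
      then show ?thesis unfolding i_def using fin by (intro Max_ge) auto
    next
      case False
      then have "part j = {}" by (auto simp: part_def)
      then show ?thesis by simp
    qed
    have "v0 \<in> part (f v0)" "finite (part (f v0))" using v0(1) fin by (auto simp: part_def)
    then have i: "1 \<le> i" unfolding v0(2)[symmetric] by (simp add: Suc_le_eq card_gt_0_iff) blast
    have EH: "{u, v} \<in> EH \<longleftrightarrow> f u \<noteq> f v" if "u \<in> VH" "v \<in> VH" "u \<noteq> v" for u v
      using g(2) that by (simp add: K5inf_edge f_def)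
    have "(\<lambda>n. root n (real (bH K VH EH n))) \<longlonglongrightarrow> cI K i"
      by (rule multipartite_limit[OF H EH i parts[unfolded part_def] v0(2)[unfolded part_def]])
    then show ?thesis by (auto simp: convergent_def)
  qed
qed

lemma cH_complete_multipartite:
  assumes H: "simple_graph VH EH" and mp: "complete_multipartite VH EH ps" "ps \<noteq> []" "sorted (rev ps)" "\<forall>p\<in>set ps. 1 \<le> p"
  shows "cH K VH EH = cI K (hd ps)"
proof -
  obtain f :: "nat \<Rightarrow> nat" where f: "f ` VH = {..<length ps}" "\<forall>j<length ps. card {v\<in>VH. f v = j} = ps ! j"
    "EH = {{u, v} | u v. u \<in> VH \<and> v \<in> VH \<and> f u \<noteq> f v}"
    using mp(1) unfolding complete_multipartite_def by (elim conjE exE)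
  have EH: "{u, v} \<in> EH \<longleftrightarrow> f u \<noteq> f v" if "u \<in> VH" "v \<in> VH" "u \<noteq> v" for u v
    unfolding f(3) using that by (subst mem_edge_rel) auto
  have h: "hd ps = ps ! 0" "0 < length ps" using mp(2) by (auto simp: hd_conv_nth)
  have le: "ps ! j \<le> hd ps" if "j < length ps" for j
  proof -
    have "rev ps ! (length ps - Suc j) \<le> rev ps ! (length ps - 1)"
      by (rule sorted_nth_mono[OF mp(3)]) (use that in auto)
    then show ?thesis using that h by (simp add: rev_nth)
  qed
  have parts: "card {v\<in>VH. f v = j} \<le> hd ps" for j
  proof (cases "j < length ps")
    case True
    then show ?thesis using f(2) le by simp
  next
    case False
    then have e: "{v\<in>VH. f v = j} = {}" using f(1) by (auto simp: image_subset_iff set_eq_iff)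
    show ?thesis unfolding e by simp
  qed
  have "(\<lambda>n. root n (real (bH K VH EH n))) \<longlonglongrightarrow> cI K (hd ps)"
    by (rule multipartite_limit[OF H EH _ parts, where ?j0.0 = 0]) (use f(2) h mp(2,4) in auto)
  then show ?thesis unfolding cH_def by (rule limI)
qed

theorem theorem1p2:
  fixes K :: "'k::field itself"
  shows "(\<forall>VH EH. simple_graph VH EH \<longrightarrow> convergent (\<lambda>n. root n (real (bH K VH EH n))))
    \<and> (\<forall>VH EH. simple_graph VH EH \<and> \<not> induced_sub VH EH K5inf_V K5inf_E
          \<longrightarrow> cH K VH EH = root 5 4)
    \<and> (\<exists>c' :: nat \<Rightarrow> real.
          (\<forall>VH EH ps. simple_graph VH EH \<and> complete_multipartite VH EH ps \<and> ps \<noteq> [] \<and>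
               sorted (rev ps) \<and> (\<forall>p\<in>set ps. 1 \<le> p \<and> p \<le> 5)
             \<longrightarrow> cH K VH EH = c' (hd ps))
        \<and> c' 5 = root 4 3 \<and> c' 4 = root 3 2
        \<and> root 14 8 \<le> c' 3 \<and> c' 3 \<le> Gamma4 \<and> c' 2 = 1 \<and> c' 1 = 1)"
proof (intro conjI allI impI)
  fix VH :: "nat set" and EH assume "simple_graph VH EH"
  then show "convergent (\<lambda>n. root n (real (bH K VH EH n)))" by (rule convergent_bH)
next
  fix VH :: "nat set" and EH assume "simple_graph VH EH \<and> \<not> induced_sub VH EH K5inf_V K5inf_E"
  then show "cH K VH EH = root 5 4" unfolding cH_def using nonmultipartite_limit limI by blast
next
  show "\<exists>c' :: nat \<Rightarrow> real.
          (\<forall>VH EH ps. simple_graph VH EH \<and> complete_multipartite VH EH ps \<and> ps \<noteq> [] \<and>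
               sorted (rev ps) \<and> (\<forall>p\<in>set ps. 1 \<le> p \<and> p \<le> 5)
             \<longrightarrow> cH K VH EH = c' (hd ps))
        \<and> c' 5 = root 4 3 \<and> c' 4 = root 3 2
        \<and> root 14 8 \<le> c' 3 \<and> c' 3 \<le> Gamma4 \<and> c' 2 = 1 \<and> c' 1 = 1"
    by (rule exI[of _ "cI K"]) (simp add: cH_complete_multipartite cI_5 cI_4 cI_3 cI_small)
qed

end
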